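(* Under the hypotheses of the main universality theorem ($W=e^{-Q}\in\mathcal F(C^2)$, $Q$ even, $\lim_{x\to\infty}T(x)=\alpha\in(1,\infty)$; $\xi_k$ independent, mean $0$, variance $1$, $\sup_k\mathbb E|\xi_k|^{2+\varepsilon_0}<\infty$; $\tilde\xi_k$ i.i.d. standard Gaussian), $$\lim_{\varepsilon\to0}\lim_{n\to\infty}\frac{\mathbb E[N_{P_n^*}(\mathbb R\setminus D(\varepsilon))]}{n}=\lim_{\varepsilon\to0}\lim_{n\to\infty}\frac{\mathbb E[N_{\widetilde P_n^*}(\mathbb R\setminus D(\varepsilon))]}{n}=0,$$ where $D(\varepsilon)=[-1+\varepsilon,1-\varepsilon]$ (the inner limits may be replaced by $\limsup$).
   Context: $P_n^*(x)=\sum_{j=0}^n\xi_jp_j(a_nx)$, $\widetilde P_n^*(x)=\sum_{j=0}^n\tilde\xi_jp_j(a_nx)$; $N_P(E)$ is the number of zeros of $P$ in $E$. Weight class $\mathcal F(C^2)$: $W=e^{-Q}$ with $Q:\mathbb R\to[0,\infty)$, $Q'$ continuous, $Q(0)=0$, $Q'$ non-decreasing, $Q''$ exists off $0$, $Q\to\infty$ at $\pm\infty$, $T(t)=tQ'(t)/Q(t)$ quasi-increasing on $(0,\infty)$ and on $(-\infty,0)$ with $T\ge\Lambda>1$, and $Q''/|Q'|\le C_2|Q'|/Q$ off $0$. $p_j$: orthonormal polynomials w.r.t. $W^2dx$. $a_n>0$: $n=\frac2\pi\int_0^1\frac{a_ntQ'(a_nt)}{\sqrt{1-t^2}}dt$.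 *)

theory Defs
  imports "HOL-Probability.Probability" "HOL-Computational_Algebra.Polynomial"
begin

definition T_fun :: "(real \<Rightarrow> real) \<Rightarrow> real \<Rightarrow> real" where
  "T_fun Q t = t * deriv Q t / Q t"

definition quasi_increasing_on :: "real set \<Rightarrow> (real \<Rightarrow> real) \<Rightarrow> bool" where
  "quasi_increasing_on S f \<longleftrightarrow> (\<exists>C>0. \<forall>x\<in>S. \<forall>y\<in>S. x \<le> y \<longrightarrow> f x \<le> C * f y)"

text \<open>The weight class F(C^2) for W = exp(-Q), phrased in terms of Q.\<close>
definition F_C2 :: "(real \<Rightarrow> real) \<Rightarrow> bool" where
  "F_C2 Q \<longleftrightarrow>
     (\<forall>x. Q x \<ge> 0) \<and>
     (\<forall>x. Q differentiable (at x)) \<and> continuous_on UNIV (deriv Q) \<and>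
     Q 0 = 0 \<and>
     mono (deriv Q) \<and>
     (\<forall>x. x \<noteq> 0 \<longrightarrow> deriv Q differentiable (at x)) \<and>
     filterlim Q at_top at_top \<and> filterlim Q at_top at_bot \<and>
     quasi_increasing_on {0<..} (T_fun Q) \<and> quasi_increasing_on {..<0} (T_fun Q) \<and>
     (\<exists>\<Lambda>>1. \<forall>t. t \<noteq> 0 \<longrightarrow> T_fun Q t \<ge> \<Lambda>) \<and>
     (\<exists>C2. \<forall>x. x \<noteq> 0 \<longrightarrow>
         deriv (deriv Q) x / \<bar>deriv Q x\<bar> \<le> C2 * \<bar>deriv Q x\<bar> / Q x)"

definition orthonormal_polys :: "(real \<Rightarrow> real) \<Rightarrow> (nat \<Rightarrow> real poly) \<Rightarrow> bool" where
  "orthonormal_polys Q p \<longleftrightarrow>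
     (\<forall>j. degree (p j) = j \<and> lead_coeff (p j) > 0) \<and>
     (\<forall>j k. integrable lborel (\<lambda>x. poly (p j) x * poly (p k) x * exp (- Q x) ^ 2) \<and>
            (\<integral>x. poly (p j) x * poly (p k) x * exp (- Q x) ^ 2 \<partial>lborel) =
              (if j = k then 1 else 0))"

text \<open>Mhaskar-Rakhmanov-Saff number a_n (n \<ge> 1).\<close>
definition MRS_number :: "(real \<Rightarrow> real) \<Rightarrow> nat \<Rightarrow> real \<Rightarrow> bool" where
  "MRS_number Q n a \<longleftrightarrow> a > 0 \<and>
     real n = 2 / pi * (LBINT t=0..1. a * t * deriv Q (a * t) / sqrt (1 - t\<^sup>2))"

definition D_set :: "real \<Rightarrow> real set" where
  "D_set \<epsilon> = {-1 + \<epsilon> .. 1 - \<epsilon>}"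

definition N_zeros :: "(real \<Rightarrow> real) \<Rightarrow> real set \<Rightarrow> nat" where
  "N_zeros P E = card {x \<in> E. P x = 0}"

definition rand_poly :: "(nat \<Rightarrow> real poly) \<Rightarrow> (nat \<Rightarrow> real) \<Rightarrow> (nat \<Rightarrow> real) \<Rightarrow> nat \<Rightarrow> real \<Rightarrow> real" where
  "rand_poly p a c n x = (\<Sum>j\<le>n. c j * poly (p j) (a n * x))"

definition expected_outer_zeros :: "'w measure \<Rightarrow> (nat \<Rightarrow> real poly) \<Rightarrow> (nat \<Rightarrow> real) \<Rightarrow> (nat \<Rightarrow> 'w \<Rightarrow> real) \<Rightarrow> real \<Rightarrow> nat \<Rightarrow> ennreal" where
  "expected_outer_zeros M p a \<xi> \<epsilon> n =
     (\<integral>\<^sup>+ \<omega>. ennreal (real (N_zeros (rand_poly p a (\<lambda>j. \<xi> j \<omega>) n) (UNIV - D_set \<epsilon>))) \<partial>M) / of_nat n"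

end

theory Submission
  imports Defs
    "HOL-Computational_Algebra.Fundamental_Theorem_Algebra"
    "HOL-Library.Discrete_Functions"
    "HOL-Real_Asymp.Real_Asymp"
begin

text \<open>The logarithm of a polynomial \<open>P\<close> with zeros \<open>z\<^sub>i\<close> is integrated against the arcsine law
  of \<open>[-b, b]\<close> with \<open>b = (1 - 2\<epsilon>) a\<^sub>n\<close>. A zero contributes at least \<open>ln (b/2)\<close>, and an additional
  \<open>ln (green (z/b))\<close>, of order at least \<open>\<surd>\<epsilon>\<close>, if it is real and lies outside \<open>D(\<epsilon>)\<close> (after
  scaling). The integral is bounded above by that of \<open>Q\<close>, because \<open>P\<close> has polynomial norm in
  \<open>L\<^sup>2(W\<^sup>2)\<close>. It remains to bound the leading coefficients of the orthonormal polynomials from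
  below. Since \<open>Q(x) = \<integral> ln (green (x/a\<^sub>s)) ds\<close>, a product of Chebyshev polynomials for the intervals
  \<open>[-a\<^sub>k\<^sub>m, a\<^sub>k\<^sub>m]\<close> is, up to a factor \<open>exp (o(n))\<close>, as small in the weighted norm as a monic polynomial
  can be. Convexity of \<open>Q\<close> then leaves \<open>n ln (1/(1-2\<epsilon>)) + o(n)\<close>, so that the proportion of outer zeros is
  \<open>O(\<surd>\<epsilon>) + o(1)\<close>. The leading coefficient \<open>\<xi>\<^sub>n \<gamma>\<^sub>n\<close> itself may be tiny; instead some coefficient of
  index in \<open>(n - \<surd>n, n]\<close> is large with probability tending to 1, which costs only \<open>\<surd>n\<close> zeros.\<close>

section \<open>Integrals over the quarter period\<close>

text \<open>No asymptotics of \<open>a n\<close> or of the orthonormal polynomials enter. The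
  integral of the field contributes the arcsine mean of \<open>Q\<close> and the leading coefficient
  contributes the sum of the \<open>ln (a i)\<close>; neither is evaluated, but
  \<open>arcsine_mean_a_le\<close> bounds them together by (d + 1) ln (a d), through summation by
  parts. The interval of the arcsine law must be strictly shorter than the one whose outside is
  examined. Shrinking it costs a logarithm linear in epsilon per degree, whereas the Green function
  grows like a square root at the endpoint and pays sqrt epsilon per outer zero; the quotient tends
  to 0. The Chebyshev polynomials are taken in blocks because one of degree m loses only a factor 2
  against the capacity of its interval, while m linear factors would lose 2 ^ m. About d / m such
  losses stand against an error of order m ln d from treating the \<open>a i\<close> of a block as
  equal, and m near sqrt n makes both o(n).\<close>

definition wallis :: "nat \<Rightarrow> real" where
  "wallis k = integral {0..pi/2} (\<lambda>\<theta>. sin \<theta> ^ k)"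

lemma wallis_0: "wallis 0 = pi / 2"
  by (simp add: wallis_def)

lemma wallis_1: "wallis (Suc 0) = 1"
proof -
  have "((\<lambda>\<theta>. sin \<theta>) has_integral (- cos (pi/2) - (- cos 0))) {0..pi/2}"
    by (rule fundamental_theorem_of_calculus)
       (auto intro!: derivative_eq_intros simp flip: has_real_derivative_iff_has_vector_derivative)
  then show ?thesis
    by (simp add: wallis_def integral_unique)
qed

lemma wallis_Suc_Suc: "real (k + 2) * wallis (k + 2) = real (k + 1) * wallis k"
proof -
  have "((\<lambda>\<theta>. real (k + 2) * sin \<theta> ^ (k + 2) - real (k + 1) * sin \<theta> ^ k) has_integral
      (- (cos (pi/2) * sin (pi/2) ^ (k + 1)) - - (cos 0 * sin 0 ^ (k + 1)))) {0..pi/2}"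
  proof (rule fundamental_theorem_of_calculus)
    fix x :: real
    have c: "(cos x)\<^sup>2 = 1 - (sin x)\<^sup>2"
      by (simp add: cos_squared_eq)
    have "((\<lambda>\<theta>. - (cos \<theta> * sin \<theta> ^ (k + 1))) has_real_derivative
        sin x * sin x ^ (k + 1) - cos x * (real (k + 1) * (cos x * sin x ^ k))) (at x)"
      by (rule derivative_eq_intros refl | simp)+
    also have "sin x * sin x ^ (k + 1) - cos x * (real (k + 1) * (cos x * sin x ^ k))
      = sin x ^ (k + 2) - real (k + 1) * (cos x)\<^sup>2 * sin x ^ k"
      by (simp add: power2_eq_square algebra_simps)
    also have "\<dots> = real (k + 2) * sin x ^ (k + 2) - real (k + 1) * sin x ^ k"
      unfolding c by (simp add: power2_eq_square algebra_simps)
    finally show "((\<lambda>\<theta>. - (cos \<theta> * sin \<theta> ^ (k + 1))) has_vector_derivative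
        real (k + 2) * sin x ^ (k + 2) - real (k + 1) * sin x ^ k) (at x within {0..pi/2})"
      using has_field_derivative_at_within has_real_derivative_iff_has_vector_derivative by blast
  qed simp
  moreover have "((\<lambda>\<theta>. real (k + 2) * sin \<theta> ^ (k + 2) - real (k + 1) * sin \<theta> ^ k) has_integral
      (real (k + 2) * wallis (k + 2) - real (k + 1) * wallis k)) {0..pi/2}"
    unfolding wallis_def
    by (intro has_integral_diff has_integral_mult_right integrable_integral integrable_continuous_real continuous_intros)
  ultimately have "real (k + 2) * wallis (k + 2) - real (k + 1) * wallis k = 0"
    by (auto dest: has_integral_unique)
  then show ?thesis by simp
qed

text \<open>The recurrence in steps of two makes this product independent of \<open>k\<close>. It is
  the moment identity behind \<open>hat_box\<close>: the function x ^ k produces exactly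
  \<open>wallis k * wallis (k + 1)\<close>.\<close>

lemma wallis_product: "real (k + 1) * wallis (k + 1) * wallis k = pi / 2"
proof (induction k)
  case 0
  then show ?case by (simp add: wallis_0 wallis_1)
next
  case (Suc k)
  have "real (Suc k + 1) * wallis (Suc k + 1) * wallis (Suc k) = (real (k + 2) * wallis (k + 2)) * wallis (k + 1)"
    by simp
  also have "\<dots> = real (k + 1) * wallis (k + 1) * wallis k"
    unfolding wallis_Suc_Suc by (simp only: mult_ac)
  finally show ?case using Suc.IH by (simp only:)
qed

text \<open>Archimedes' hat-box theorem on an octant of the sphere: a coordinate of a uniformly
  distributed point is uniformly distributed.\<close>
lemma hat_box:
  fixes f :: "real \<Rightarrow> real"
  assumes f: "continuous_on {0..1} f"
  shows "((\<lambda>\<psi>. integral {0..pi/2} (\<lambda>\<theta>. sin \<theta> * f (sin \<psi> * sin \<theta>)))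
    has_integral pi / 2 * integral {0..1} f) {0..pi/2}"
proof -
  \<comment> \<open>\<open>I\<close> takes the function as an argument because polynomials replace
    \<open>f\<close> below: they are settled by \<open>wallis_product\<close>, and
    \<open>I_bound\<close> transfers the result to \<open>f\<close>.\<close>
  define I where "I f = integral {0..pi/2} (\<lambda>\<psi>. integral {0..pi/2} (\<lambda>\<theta>. sin \<theta> * f (sin \<psi> * sin \<theta>)))"
    for f :: "real \<Rightarrow> real"
  have range: "sin \<psi> * sin \<theta> \<in> {0..1}" if "\<psi> \<in> {0..pi/2}" "\<theta> \<in> {0..pi/2}" for \<psi> \<theta> :: real
    using that by (auto intro!: mult_nonneg_nonneg mult_le_one sin_ge_zero)
  have cont2: "continuous_on ({0..pi/2} \<times> cbox 0 (pi/2)) (\<lambda>(\<psi>, \<theta>). sin \<theta> * g (sin \<psi> * sin \<theta>))"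
    if "continuous_on {0..1} g" for g :: "real \<Rightarrow> real"
  proof -
    have "continuous_on ({0..pi/2} \<times> cbox 0 (pi/2)) (\<lambda>z. g (sin (fst z) * sin (snd z)))"
      by (rule continuous_on_compose2[OF that]) (use range in \<open>auto intro!: continuous_intros\<close>)
    then show ?thesis
      by (auto simp: case_prod_unfold intro!: continuous_intros)
  qed
  have int1: "(\<lambda>\<theta>. sin \<theta> * g (sin \<psi> * sin \<theta>)) integrable_on {0..pi/2}"
    if "continuous_on {0..1} g" "\<psi> \<in> {0..pi/2}" for g :: "real \<Rightarrow> real" and \<psi>
    using that range
    by (auto intro!: integrable_continuous_real continuous_intros continuous_on_compose2[OF that(1)])
  have int2: "(\<lambda>\<psi>. integral {0..pi/2} (\<lambda>\<theta>. sin \<theta> * g (sin \<psi> * sin \<theta>))) integrable_on {0..pi/2}"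
    if "continuous_on {0..1} g" for g :: "real \<Rightarrow> real"
    using integral_continuous_on_param[OF cont2[OF that]] by (intro integrable_continuous_real) simp
  have I_bound: "\<bar>I f - I g\<bar> \<le> (pi/2)\<^sup>2 * e"
    if fg: "continuous_on {0..1} g" "\<And>x. x \<in> {0..1} \<Longrightarrow> \<bar>f x - g x\<bar> \<le> e" for g e
  proof -
    have e: "0 \<le> e" using fg(2)[of 0] by simp
    have inner: "\<bar>integral {0..pi/2} (\<lambda>\<theta>. sin \<theta> * f (sin \<psi> * sin \<theta>)) - integral {0..pi/2} (\<lambda>\<theta>. sin \<theta> * g (sin \<psi> * sin \<theta>))\<bar>
        \<le> e * (pi/2)" if \<psi>: "\<psi> \<in> {0..pi/2}" for \<psi>
    proof -
      have "norm (integral {0..pi/2} (\<lambda>\<theta>. sin \<theta> * f (sin \<psi> * sin \<theta>) - sin \<theta> * g (sin \<psi> * sin \<theta>)))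
          \<le> integral {0..pi/2} (\<lambda>\<theta>. e)"
      proof (rule integral_norm_bound_integral)
        show "norm (sin \<theta> * f (sin \<psi> * sin \<theta>) - sin \<theta> * g (sin \<psi> * sin \<theta>)) \<le> e"
          if \<theta>: "\<theta> \<in> {0..pi/2}" for \<theta>
        proof -
          have "\<bar>sin \<theta>\<bar> * \<bar>f (sin \<psi> * sin \<theta>) - g (sin \<psi> * sin \<theta>)\<bar> \<le> 1 * e"
            using fg(2)[OF range[OF \<psi> \<theta>]] by (intro mult_mono) auto
          then show ?thesis by (simp add: right_diff_distrib[symmetric] abs_mult)
        qed
      qed (use int1 f fg \<psi> in \<open>auto intro!: integrable_diff\<close>)
      then show ?thesis
        using int1[OF f \<psi>] int1[OF fg(1) \<psi>] by (simp add: integral_diff mult.commute)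
    qed
    have "norm (integral {0..pi/2} (\<lambda>\<psi>. integral {0..pi/2} (\<lambda>\<theta>. sin \<theta> * f (sin \<psi> * sin \<theta>)) - integral {0..pi/2} (\<lambda>\<theta>. sin \<theta> * g (sin \<psi> * sin \<theta>))))
        \<le> integral {0..pi/2} (\<lambda>\<psi>. e * (pi/2))"
      using inner int2[OF f] int2[OF fg(1)] by (intro integral_norm_bound_integral integrable_diff) auto
    then show ?thesis
      using int2[OF f] int2[OF fg(1)] by (simp add: I_def integral_diff power2_eq_square mult_ac)
  qed
  have I_poly: "I (\<lambda>x. \<Sum>i\<le>n. c i * x ^ i) = pi / 2 * integral {0..1} (\<lambda>x. \<Sum>i\<le>n. c i * x ^ i)" for c and n :: nat
  proof -
    have "I (\<lambda>x. \<Sum>i\<le>n. c i * x ^ i) = (\<Sum>i\<le>n. c i * (wallis i * wallis (i + 1)))"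
    proof -
      have inner: "integral {0..pi/2} (\<lambda>\<theta>. sin \<theta> * (\<Sum>i\<le>n. c i * (sin \<psi> * sin \<theta>) ^ i)) = (\<Sum>i\<le>n. c i * wallis (i + 1) * sin \<psi> ^ i)" for \<psi> :: real
      proof -
        have "((\<lambda>\<theta>. \<Sum>i\<le>n. c i * sin \<psi> ^ i * sin \<theta> ^ (i + 1)) has_integral (\<Sum>i\<le>n. c i * sin \<psi> ^ i * wallis (i + 1))) {0..pi/2}"
          unfolding wallis_def
          by (intro has_integral_sum has_integral_mult_right integrable_integral integrable_continuous_real continuous_intros) auto
        then show ?thesis
          by (intro integral_unique) (simp add: sum_distrib_left power_mult_distrib mult_ac)
      qed
      have "((\<lambda>\<psi>. \<Sum>i\<le>n. c i * wallis (i + 1) * sin \<psi> ^ i) has_integral (\<Sum>i\<le>n. c i * wallis (i + 1) * wallis i)) {0..pi/2}"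
        unfolding wallis_def[of "i" for i]
        by (intro has_integral_sum has_integral_mult_right integrable_integral integrable_continuous_real continuous_intros) auto
      then show ?thesis
        unfolding I_def inner by (intro trans[OF integral_unique]) (auto simp: mult_ac)
    qed
    also have "\<dots> = (\<Sum>i\<le>n. c i * (pi / 2 / real (i + 1)))"
    proof (rule sum.cong)
      have "wallis i * wallis (i + 1) = pi / 2 / real (i + 1)" for i
        using wallis_product[of i] by (simp add: field_simps)
      then show "c i * (wallis i * wallis (i + 1)) = c i * (pi / 2 / real (i + 1))" for i
        by simp
    qed simp
    also have "\<dots> = pi / 2 * (\<Sum>i\<le>n. c i * (1 / real (i + 1)))"
      by (simp add: sum_distrib_left mult_ac)
    also have "((\<lambda>x. \<Sum>i\<le>n. c i * x ^ i) has_integral (\<Sum>i\<le>n. c i * (1 / real (i + 1)))) {0..1}"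
    proof (intro has_integral_sum has_integral_mult_right)
      fix i
      have "((\<lambda>x. x ^ i) has_integral (1 ^ (i + 1) / real (i + 1) - 0 ^ (i + 1) / real (i + 1))) {0..1}"
      proof (rule fundamental_theorem_of_calculus)
        show "((\<lambda>x. x ^ (i + 1) / real (i + 1)) has_vector_derivative x ^ i) (at x within {0..1})" for x :: real
          using DERIV_cdivide[OF DERIV_pow[of "i + 1" x "{0..1}"], of "real (i + 1)"]
          by (simp del: of_nat_Suc of_nat_add flip: has_real_derivative_iff_has_vector_derivative)
      qed simp
      then show "((\<lambda>x. x ^ i) has_integral (1 / real (i + 1))) {0..1}" by simp
    qed simp
    then have "(\<Sum>i\<le>n. c i * (1 / real (i + 1))) = integral {0..1} (\<lambda>x. \<Sum>i\<le>n. c i * x ^ i)"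
      by (simp add: integral_unique)
    finally show ?thesis .
  qed
  have "\<bar>I f - pi / 2 * integral {0..1} f\<bar> \<le> e" if "e > 0" for e
  proof -
    \<comment> \<open>The approximation costs (pi/2)^2 d in \<open>I\<close> and pi/2 d in the
      integral over [0, 1]; together these are e.\<close>
    define d where "d = e / ((pi/2)\<^sup>2 + pi / 2)"
    have D: "(pi/2)\<^sup>2 + pi / 2 > 0" by (simp add: add_pos_pos)
    have "d > 0" using D that by (simp add: d_def)
    then obtain g where g: "real_polynomial_function g" "\<And>x. x \<in> {0..1} \<Longrightarrow> \<bar>f x - g x\<bar> < d"
      using Stone_Weierstrass_real_polynomial_function[OF compact_Icc f] by metis
    obtain c n where gs: "g = (\<lambda>x. \<Sum>i\<le>n. c i * x ^ i)"
      using g(1) unfolding real_polynomial_function_iff_sum by blast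
    have cg: "continuous_on {0..1} g" unfolding gs by (intro continuous_intros)
    have "\<bar>integral {0..1} f - integral {0..1} g\<bar> \<le> d"
    proof -
      have "norm (integral {0..1} (\<lambda>x. f x - g x)) \<le> integral {0..1} (\<lambda>x::real. d)"
        using g(2) f cg by (intro integral_norm_bound_integral integrable_diff integrable_continuous_real) (auto intro: less_imp_le)
      then show ?thesis
        using f cg by (simp add: integral_diff integrable_continuous_real)
    qed
    then have "pi / 2 * \<bar>integral {0..1} g - integral {0..1} f\<bar> \<le> pi / 2 * d"
      by (intro mult_left_mono) (auto simp: abs_minus_commute)
    then have "\<bar>pi / 2 * integral {0..1} g - pi / 2 * integral {0..1} f\<bar> \<le> pi / 2 * d"
      by (simp only: right_diff_distrib[symmetric] abs_mult) simp
    moreover have "\<bar>I f - I g\<bar> \<le> (pi/2)\<^sup>2 * d"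
      using g(2) by (intro I_bound cg) (auto intro: less_imp_le)
    moreover have "I g = pi / 2 * integral {0..1} g" unfolding gs by (rule I_poly)
    ultimately have "\<bar>I f - pi / 2 * integral {0..1} f\<bar> \<le> ((pi/2)\<^sup>2 + pi / 2) * d"
      unfolding distrib_right by linarith
    then show ?thesis using D by (simp add: d_def)
  qed
  then have "\<bar>I f - pi / 2 * integral {0..1} f\<bar> \<le> 0"
    by (meson field_le_epsilon dense_ge)
  then have "I f = pi / 2 * integral {0..1} f" by simp
  then show ?thesis using integrable_integral[OF int2[OF f]] by (simp only: I_def)
qed

text \<open>The antiderivative of 1 / sin is ln (tan (x / 2)), written as ln (sin x) - ln (1 + cos
  x). The value is arcosh (1 / u); with u = a i / x it is what the number \<open>a i\<close>
  contributes to \<open>Q x\<close> in \<open>Q_ge_sum_ln_green\<close>.\<close>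

lemma integral_inverse_sin:
  fixes u :: real
  assumes u: "0 < u" "u < 1"
  shows "((\<lambda>\<psi>. if u \<le> sin \<psi> then 1 / sin \<psi> else 0) has_integral ln ((1 + sqrt (1 - u\<^sup>2)) / u)) {0..pi/2}"
proof -
  define \<phi> where "\<phi> = arcsin u"
  have \<phi>: "0 < \<phi>" "\<phi> < pi/2" "sin \<phi> = u"
    using u arcsin_less_arcsin[of 0 u] arcsin_less_arcsin[of u 1] by (auto simp: \<phi>_def)
  have "cos \<phi> = sqrt (1 - u\<^sup>2)" using u by (simp add: \<phi>_def cos_arcsin)
  have "((\<lambda>\<psi>. 1 / sin \<psi>) has_integral
      (ln (sin (pi/2)) - ln (1 + cos (pi/2))) - (ln (sin \<phi>) - ln (1 + cos \<phi>))) {\<phi>..pi/2}"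
  proof (rule fundamental_theorem_of_calculus)
    fix x assume x: "x \<in> {\<phi>..pi/2}"
    then have s: "sin x > 0" using \<phi> by (intro sin_gt_zero) auto
    have c: "1 + cos x > 0" using x \<phi> cos_ge_zero[of x] by (simp add: add_pos_nonneg)
    have "((\<lambda>x. ln (sin x) - ln (1 + cos x)) has_real_derivative (cos x / sin x + sin x / (1 + cos x))) (at x)"
      using s c by (auto intro!: derivative_eq_intros simp: field_simps)
    also have "cos x / sin x + sin x / (1 + cos x) = (cos x * (1 + cos x) + sin x * sin x) / (sin x * (1 + cos x))"
      using s c by (simp add: add_frac_eq)
    also have "cos x * (1 + cos x) + sin x * sin x = 1 + cos x"
      using sin_cos_squared_add3[of x] by (simp add: algebra_simps)
    also have "(1 + cos x) / (sin x * (1 + cos x)) = 1 / sin x"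
      using c by simp
    finally show "((\<lambda>x. ln (sin x) - ln (1 + cos x)) has_vector_derivative 1 / sin x) (at x within {\<phi>..pi/2})"
      using has_field_derivative_at_within has_real_derivative_iff_has_vector_derivative by blast
  qed (use \<phi> in simp)
  also have "(ln (sin (pi/2)) - ln (1 + cos (pi/2))) - (ln (sin \<phi>) - ln (1 + cos \<phi>)) = ln ((1 + sqrt (1 - u\<^sup>2)) / u)"
  proof -
    have "1 + sqrt (1 - u\<^sup>2) > 0" using u by (intro add_pos_nonneg) (auto simp: power_le_one)
    then show ?thesis using u \<phi> \<open>cos \<phi> = _\<close> by (simp add: ln_div)
  qed
  finally have "((\<lambda>\<psi>. if \<psi> \<in> {\<phi>..pi/2} then 1 / sin \<psi> else 0) has_integral ln ((1 + sqrt (1 - u\<^sup>2)) / u)) {0..pi/2}"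
    using \<phi> by (subst has_integral_restrict) auto
  moreover have "(u \<le> sin \<psi>) = (\<psi> \<in> {\<phi>..pi/2})" if "\<psi> \<in> {0..pi/2}" for \<psi>
    using sin_mono_le_eq[of \<phi> \<psi>] that \<phi> by auto
  ultimately show ?thesis
    by (subst has_integral_cong[where g = "\<lambda>\<psi>. if \<psi> \<in> {\<phi>..pi/2} then 1 / sin \<psi> else 0"]) auto
qed

section \<open>Logarithmic means over the arcsine law\<close>

text \<open>Up to pi / 3 the cosine is at least 1/2, so sin x - x / 2 increases; beyond that point
  numerical bounds suffice, 0.85 for the sine against 0.8 for x / 2.\<close>

lemma half_le_sin:
  fixes x :: real
  assumes "0 \<le> x" "x \<le> pi / 2"
  shows "x / 2 \<le> sin x"
proof (cases "x \<le> pi / 3")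
  case True
  have "sin 0 - 0 / 2 \<le> sin x - x / 2"
  proof (rule DERIV_nonneg_imp_nondecreasing[OF assms(1)])
    fix y assume y: "0 \<le> y" "y \<le> x"
    have "cos (pi / 3) \<le> cos y"
      using y True by (intro cos_monotone_0_pi_le) auto
    then show "\<exists>d. ((\<lambda>y. sin y - y / 2) has_real_derivative d) (at y) \<and> 0 \<le> d"
      by (intro exI[of _ "cos y - 1 / 2"]) (auto intro!: derivative_eq_intros simp: cos_60)
  qed
  then show ?thesis by simp
next
  case False
  have "sqrt 3 / 2 \<le> sin x"
    using False assms sin_monotone_2pi_le[of "pi / 3" x] by (simp add: sin_60)
  moreover have "x \<le> 1.6"
    using assms pi_less_4 pi_approx by simp
  moreover have "(1.7::real) \<le> sqrt 3"
    by (rule real_le_rsqrt) (simp add: power2_eq_square)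
  ultimately show ?thesis by simp
qed

text \<open>With half-difference d and half-sum s the difference is 2 sin s sin d, and d <= s <= pi
  - d gives sin s >= sin d >= d / 2. The quadratic order is attained at 0 and pi, where the cosine
  is flat.\<close>

lemma abs_cos_diff_ge:
  assumes "\<theta> \<in> {0..pi}" "\<phi> \<in> {0..pi}"
  shows "(\<theta> - \<phi>)\<^sup>2 / 8 \<le> \<bar>cos \<theta> - cos \<phi>\<bar>"
proof -
  have *: "(\<theta> - \<phi>)\<^sup>2 / 8 \<le> \<bar>cos \<theta> - cos \<phi>\<bar>" if "0 \<le> \<theta>" "\<theta> \<le> \<phi>" "\<phi> \<le> pi" for \<theta> \<phi>
  proof -
    define d s where "d = (\<phi> - \<theta>) / 2" and "s = (\<theta> + \<phi>) / 2"
    have ds: "0 \<le> d" "d \<le> pi / 2" "d \<le> s" "s \<le> pi - d" using that by (auto simp: d_def s_def field_simps)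
    have sd: "d / 2 \<le> sin d" using half_le_sin ds by simp
    have "sin d \<le> sin s"
    proof (cases "s \<le> pi / 2")
      case True
      then show ?thesis using ds by (intro sin_monotone_2pi_le) auto
    next
      case False
      then have "sin d \<le> sin (pi - s)" using ds by (intro sin_monotone_2pi_le) auto
      then show ?thesis by simp
    qed
    with sd ds have "(d / 2) * (d / 2) \<le> sin s * sin d" by (intro mult_mono) auto
    moreover have "cos \<theta> - cos \<phi> = 2 * (sin s * sin d)"
      unfolding cos_diff_cos s_def d_def by simp
    ultimately have "2 * ((d / 2) * (d / 2)) \<le> cos \<theta> - cos \<phi>" by simp
    moreover have "2 * ((d / 2) * (d / 2)) = (\<theta> - \<phi>)\<^sup>2 / 8"
      by (simp add: d_def power2_eq_square field_simps)
    ultimately show ?thesis by linarith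
  qed
  show ?thesis
  proof (cases "\<theta> \<le> \<phi>")
    case True
    with *[of \<theta> \<phi>] assms show ?thesis by simp
  next
    case False
    with *[of \<phi> \<theta>] assms show ?thesis by (simp add: power2_commute abs_minus_commute)
  qed
qed

text \<open>Up to the factor -pi, the logarithmic potential of the arcsine law of [-1, 1]. For real
  t the true value is pi * ln (green t / 2); the proof derives and uses lower bounds.\<close>

definition log_mean :: "complex \<Rightarrow> real" where
  "log_mean z = integral {0..pi} (\<lambda>\<theta>. ln (cmod (of_real (cos \<theta>) - z)))"

text \<open>The inverse square root is an explicitly integrable majorant of the logarithmic
  singularity of \<open>log_mean\<close>, by \<open>neg_ln_le_powr\<close>.\<close>

lemma has_integral_abs_powr_minus_half:
  fixes \<phi> :: real
  assumes "\<phi> \<in> {0..c}"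
  shows "((\<lambda>\<theta>. \<bar>\<theta> - \<phi>\<bar> powr (-1/2)) has_integral 2 * (sqrt \<phi> + sqrt (c - \<phi>))) {0..c}"
proof -
  have base: "((\<lambda>x. x powr (-1/2)) has_integral 2 * sqrt d) {0..d}" if "d \<ge> 0" for d :: real
    using has_integral_powr_from_0[of "-1/2" d] that by (simp add: powr_half_sqrt mult.commute)
  have r: "((\<lambda>\<theta>. \<bar>\<theta> - \<phi>\<bar> powr (-1/2)) has_integral 2 * sqrt (c - \<phi>)) {\<phi>..c}"
  proof -
    have "((\<lambda>x. (1 *\<^sub>R x + (- \<phi>)) powr (-1/2)) has_integral (2 * sqrt (c - \<phi>)) /\<^sub>R 1 ^ DIM(real))
        (cbox ((0 - (- \<phi>)) /\<^sub>R 1) ((c - \<phi> - (- \<phi>)) /\<^sub>R 1))"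
      by (rule has_integral_affinity') (use base[of "c - \<phi>"] assms in auto)
    then have "((\<lambda>x. (x - \<phi>) powr (-1/2)) has_integral 2 * sqrt (c - \<phi>)) {\<phi>..c}" by simp
    then show ?thesis
      by (rule has_integral_cong[THEN iffD1, rotated]) simp
  qed
  have l: "((\<lambda>\<theta>. \<bar>\<theta> - \<phi>\<bar> powr (-1/2)) has_integral 2 * sqrt \<phi>) {0..\<phi>}"
  proof -
    have "((\<lambda>x. (1 *\<^sub>R x + \<phi>) powr (-1/2)) has_integral (2 * sqrt \<phi>) /\<^sub>R 1 ^ DIM(real))
        (cbox ((0 - \<phi>) /\<^sub>R 1) ((\<phi> - \<phi>) /\<^sub>R 1))"
      by (rule has_integral_affinity') (use base[of \<phi>] assms in auto)
    then have "((\<lambda>x. (x + \<phi>) powr (-1/2)) has_integral 2 * sqrt \<phi>) {- \<phi>..- 0}" by simp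
    then have "((\<lambda>x. (- x + \<phi>) powr (-1/2)) has_integral 2 * sqrt \<phi>) {0..\<phi>}"
      using has_integral_reflect_real[of "\<lambda>x. (x + \<phi>) powr (-1/2)" _ 0 "- \<phi>"] by simp
    then show ?thesis
      by (rule has_integral_cong[THEN iffD1, rotated]) simp
  qed
  show ?thesis
    using has_integral_combine[OF _ _ l r] assms by (simp add: algebra_simps)
qed

lemma neg_ln_le_powr: "0 < u \<Longrightarrow> - ln u \<le> 2 * u powr (-1/2)" for u :: real
  using ln_le_minus_one[of "u powr (-1/2)"] by (simp add: ln_powr)

text \<open>Dropping the imaginary part of z and clipping its real part to [-1, 1] can only bring it
  closer to cos theta; then \<open>abs_cos_diff_ge\<close> applies. The estimate is uniform in
  z.\<close>

lemma cmod_cos_diff_ge: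
  obtains \<phi> where "\<phi> \<in> {0..pi}" "\<And>\<theta>. \<theta> \<in> {0..pi} \<Longrightarrow> (\<theta> - \<phi>)\<^sup>2 / 8 \<le> cmod (of_real (cos \<theta>) - z)"
proof -
  define t where "t = max (-1) (min 1 (Re z))"
  have t: "-1 \<le> t" "t \<le> 1" by (auto simp: t_def)
  show ?thesis
  proof (rule that[of "arccos t"])
    show "arccos t \<in> {0..pi}" using t by (auto intro: arccos_lbound arccos_ubound)
    fix \<theta> :: real assume \<theta>: "\<theta> \<in> {0..pi}"
    have "(\<theta> - arccos t)\<^sup>2 / 8 \<le> \<bar>cos \<theta> - t\<bar>"
      using abs_cos_diff_ge[OF \<theta> \<open>arccos t \<in> _\<close>] t by simp
    also have "\<dots> \<le> \<bar>cos \<theta> - Re z\<bar>"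
      using cos_le_one[of \<theta>] cos_ge_minus_one[of \<theta>] unfolding t_def by linarith
    also have "\<dots> \<le> cmod (of_real (cos \<theta>) - z)"
      using abs_Re_le_cmod[of "of_real (cos \<theta>) - z"] by simp
    finally show "(\<theta> - arccos t)\<^sup>2 / 8 \<le> cmod (of_real (cos \<theta>) - z)" .
  qed
qed

text \<open>With u the distance to the singularity, - ln (u^2 / 8) <= ln 8 + 4 u^(-1/2), and
  u^(-1/2) has integral at most 4 sqrt pi. The lower bound does not depend on z, as the iteration of
  the functional equation requires.\<close>

lemma
  shows log_mean_integrable: "(\<lambda>\<theta>. ln (cmod (of_real (cos \<theta>) - z))) integrable_on {0..pi}"
    and log_mean_lower: "- (pi * ln 8 + 16 * sqrt pi) \<le> log_mean z"
proof -
  obtain \<phi> where \<phi>: "\<phi> \<in> {0..pi}" "\<And>\<theta>. \<theta> \<in> {0..pi} \<Longrightarrow> (\<theta> - \<phi>)\<^sup>2 / 8 \<le> cmod (of_real (cos \<theta>) - z)"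
    using cmod_cos_diff_ge by metis
  \<comment> \<open>The point theta = phi needs its own value: \<open>0 powr (-1/2)\<close> is 0,
    while the logarithm there is hugely negative if z lies just off the interval.\<close>
  define h where "h \<theta> = (if \<theta> = \<phi> then \<bar>ln (cmod (of_real (cos \<theta>) - z))\<bar>
    else ln 8 + 4 * \<bar>\<theta> - \<phi>\<bar> powr (-1/2))" for \<theta>
  have h0: "h \<theta> \<ge> 0" for \<theta> unfolding h_def by simp
  have h_int: "(h has_integral pi * ln 8 + 4 * (2 * (sqrt \<phi> + sqrt (pi - \<phi>)))) {0..pi}"
  proof (rule has_integral_spike_finite)
    show "((\<lambda>\<theta>. ln 8 + 4 * \<bar>\<theta> - \<phi>\<bar> powr (-1/2)) has_integral pi * ln 8 + 4 * (2 * (sqrt \<phi> + sqrt (pi - \<phi>)))) {0..pi}"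
      using has_integral_add[OF has_integral_const_real[of "ln 8" 0 pi] has_integral_mult_right[OF has_integral_abs_powr_minus_half[OF \<phi>(1)], of 4]]
      by simp
    next
    show "finite {\<phi>}" by simp
  qed (simp add: h_def)
  have lower: "- h \<theta> \<le> ln (cmod (of_real (cos \<theta>) - z))" if \<theta>: "\<theta> \<in> {0..pi}" for \<theta>
  proof (cases "\<theta> = \<phi>")
    case True
    then show ?thesis unfolding h_def by simp
  next
    case False
    define u where "u = \<bar>\<theta> - \<phi>\<bar>"
    have u: "u > 0" "u\<^sup>2 / 8 \<le> cmod (of_real (cos \<theta>) - z)"
      using False \<phi>(2)[OF \<theta>] by (auto simp: u_def)
    have "- h \<theta> \<le> 2 * ln u - ln 8" using neg_ln_le_powr[OF u(1)] False by (simp add: h_def u_def)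
    also have "\<dots> = ln (u\<^sup>2 / 8)" using u by (simp add: ln_div ln_realpow)
    also have "\<dots> \<le> ln (cmod (of_real (cos \<theta>) - z))"
      using u by (subst ln_le_cancel_iff) (auto intro: less_le_trans[OF _ u(2)])
    finally show ?thesis .
  qed
  have upper: "ln (cmod (of_real (cos \<theta>) - z)) \<le> 1 + cmod z" for \<theta>
  proof (cases "cmod (of_real (cos \<theta>) - z) = 0")
    case False
    then have "ln (cmod (of_real (cos \<theta>) - z)) \<le> cmod (of_real (cos \<theta>) - z) - 1"
      by (intro ln_le_minus_one) auto
    also have "\<dots> \<le> cmod (of_real (cos \<theta>)) + cmod z"
      using norm_triangle_ineq4[of "of_real (cos \<theta>) :: complex" z] by simp
    also have "\<dots> \<le> 1 + cmod z" by simp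
    finally show ?thesis .
  qed simp
  show int: "(\<lambda>\<theta>. ln (cmod (of_real (cos \<theta>) - z))) integrable_on {0..pi}"
  proof -
    have "(\<lambda>\<theta>. ln (cmod (of_real (cos \<theta>) - z))) absolutely_integrable_on {0..pi}"
    proof (rule measurable_bounded_by_integrable_imp_absolutely_integrable)
      have "(\<lambda>\<theta>. ln (cmod (of_real (cos \<theta>) - z))) \<in> borel_measurable borel" by measurable
      then show "(\<lambda>\<theta>. ln (cmod (of_real (cos \<theta>) - z))) \<in> borel_measurable (lebesgue_on {0..pi})"
        by (intro measurable_restrict_space1 measurable_completion) simp
      show "(\<lambda>\<theta>. h \<theta> + (1 + cmod z)) integrable_on {0..pi}"
        using h_int by (intro integrable_add) auto
      show "norm (ln (cmod (of_real (cos \<theta>) - z))) \<le> h \<theta> + (1 + cmod z)" if "\<theta> \<in> {0..pi}" for \<theta>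
        using lower[OF that] upper[of \<theta>] h0[of \<theta>] norm_ge_zero[of z] unfolding real_norm_def abs_le_iff by linarith
    qed simp
    then show ?thesis by (rule set_lebesgue_integral_eq_integral)
  qed
  have "- (pi * ln 8 + 16 * sqrt pi) \<le> - (pi * ln 8 + 4 * (2 * (sqrt \<phi> + sqrt (pi - \<phi>))))"
  proof -
    have "sqrt \<phi> \<le> sqrt pi" "sqrt (pi - \<phi>) \<le> sqrt pi" using \<phi>(1) by auto
    then show ?thesis unfolding distrib_left by linarith
  qed
  also have "\<dots> \<le> log_mean z"
    unfolding log_mean_def
    by (rule has_integral_le[OF has_integral_neg[OF h_int] integrable_integral[OF int]]) (use lower in auto)
  finally show "- (pi * ln 8 + 16 * sqrt pi) \<le> log_mean z" .
qed

text \<open>On the real line, the exponential of the Green function of the complement of [-1, 1]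
  with pole at infinity, that is, the modulus of the inverse Joukowski map.\<close>

definition green :: "real \<Rightarrow> real" where
  "green t = (if \<bar>t\<bar> \<le> 1 then 1 else \<bar>t\<bar> + sqrt (t\<^sup>2 - 1))"

lemma green_eq: "1 < t \<Longrightarrow> green t = t + sqrt (t\<^sup>2 - 1)"
  by (simp add: green_def)

lemma green_ge_1: "1 \<le> green t"
  proof (cases "\<bar>t\<bar> \<le> 1")
  case False
  then have "0 \<le> sqrt (t\<^sup>2 - 1)" using abs_square_le_1[of t] by (intro real_sqrt_ge_zero) linarith
  then have "1 \<le> \<bar>t\<bar> + sqrt (t\<^sup>2 - 1)" using False by linarith
  with False show ?thesis by (simp add: green_def)
qed (simp add: green_def)

lemma green_pos: "0 < green t"
  using green_ge_1[of t] by simp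

lemma green_minus [simp]: "green (- t) = green t"
  by (simp add: green_def)

lemma abs_le_green: "\<bar>t\<bar> \<le> green t"
  proof (cases "\<bar>t\<bar> \<le> 1")
  case False
  then have "0 \<le> sqrt (t\<^sup>2 - 1)" using abs_square_le_1[of t] by (intro real_sqrt_ge_zero) linarith
  with False show ?thesis by (simp add: green_def)
qed (simp add: green_def)

lemma green_le: "1 \<le> \<bar>t\<bar> \<Longrightarrow> green t \<le> 2 * \<bar>t\<bar>"
proof -
  assume "1 \<le> \<bar>t\<bar>"
  moreover have "sqrt (t\<^sup>2 - 1) \<le> sqrt (t\<^sup>2)" by (intro real_sqrt_le_mono) simp
  ultimately show ?thesis by (auto simp: green_def)
qed

text \<open>In the Joukowski coordinate t = (w + 1 / w) / 2 the map t -> 2 t^2 - 1 becomes w ->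
  w^2.\<close>

lemma green_double: "green (2 * t\<^sup>2 - 1) = (green t)\<^sup>2"
proof (cases "\<bar>t\<bar> \<le> 1")
  case True
  then have "t\<^sup>2 \<le> 1" by (simp add: abs_square_le_1)
  then have "\<bar>2 * t\<^sup>2 - 1\<bar> \<le> 1" unfolding abs_le_iff by simp
  then show ?thesis using True by (simp add: green_def)
next
  case False
  then have t2: "1 < t\<^sup>2" using abs_square_le_1[of t] by linarith
  have "(2 * t\<^sup>2 - 1)\<^sup>2 - 1 = (2 * \<bar>t\<bar>)\<^sup>2 * (t\<^sup>2 - 1)"
    by (simp add: power2_eq_square algebra_simps)
  then have "sqrt ((2 * t\<^sup>2 - 1)\<^sup>2 - 1) = 2 * \<bar>t\<bar> * sqrt (t\<^sup>2 - 1)"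
    by (simp add: real_sqrt_mult)
  moreover have "(\<bar>t\<bar> + sqrt (t\<^sup>2 - 1))\<^sup>2 = 2 * t\<^sup>2 - 1 + 2 * \<bar>t\<bar> * sqrt (t\<^sup>2 - 1)"
    using t2 by (simp add: power2_sum)
  ultimately show ?thesis using False t2 by (simp add: green_def)
qed

text \<open>Since cos (2 pi - theta) = cos theta, the integral over [0, 2 pi] is twice the one over
  [0, pi]; rescaling the variable by 2 halves it again.\<close>

lemma has_integral_cos_double:
  fixes f :: "real \<Rightarrow> real"
  assumes "((\<lambda>\<theta>. f (cos \<theta>)) has_integral I) {0..pi}"
  shows "((\<lambda>\<theta>. f (cos (2 * \<theta>))) has_integral I) {0..pi}"
proof -
  have "((\<lambda>\<theta>. f (cos (- \<theta>))) has_integral I) {-pi..-0}"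
    using assms has_integral_reflect_real[of "\<lambda>\<theta>. f (cos \<theta>)" I pi 0] by blast
  then have "((\<lambda>\<theta>. f (cos (1 *\<^sub>R \<theta> + (- (2 * pi))))) has_integral I /\<^sub>R 1 ^ DIM(real))
      (cbox ((-pi - (- (2 * pi))) /\<^sub>R 1) ((0 - (- (2 * pi))) /\<^sub>R 1))"
    by (intro has_integral_affinity') auto
  then have "((\<lambda>\<theta>. f (cos \<theta>)) has_integral I) {pi..2 * pi}"
    using cos_periodic[of "x - 2 * pi" for x] by simp
  from has_integral_combine[OF _ _ assms this]
  have "((\<lambda>\<theta>. f (cos \<theta>)) has_integral 2 * I) (cbox 0 (2 * pi))" by simp
  from has_integral_affinity'[OF this, of 2 0] show ?thesis by simp
qed

section \<open>Functional equation and sharp lower bounds for the logarithmic mean\<close>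

lemma finite_cos_eq: "finite {\<theta> \<in> {0..pi}. cos \<theta> = t}"
  by (rule finite_subset[of _ "{arccos t}"]) (auto simp: arccos_cos)

lemma log_mean_has_integral:
  "((\<lambda>\<theta>. ln \<bar>cos \<theta> - t\<bar>) has_integral log_mean (of_real t)) {0..pi}"
  using integrable_integral[OF log_mean_integrable[of "of_real t"]]
  unfolding log_mean_def of_real_diff[symmetric] norm_of_real .

lemma log_mean_minus: "log_mean (of_real (- t)) = log_mean (of_real t)"
proof -
  have reflect: "((\<lambda>\<theta>. ln \<bar>cos (- \<theta>) - t\<bar>) has_integral log_mean (of_real t)) {-pi..-0}"
    using log_mean_has_integral[of t] has_integral_reflect_real[of "\<lambda>\<theta>. ln \<bar>cos \<theta> - t\<bar>" _ pi 0] by blast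
  have shift: "cos (- (1 *\<^sub>R \<theta> + (- pi))) = - cos \<theta>" for \<theta>
    using cos_minus_pi[of \<theta>] by simp
  have box: "cbox ((-pi - (- pi)) /\<^sub>R 1) ((-0 - (- pi)) /\<^sub>R 1) = {0..pi}" by simp
  have "((\<lambda>\<theta>. ln \<bar>cos (- (1 *\<^sub>R \<theta> + (- pi))) - t\<bar>) has_integral log_mean (of_real t) /\<^sub>R 1 ^ DIM(real))
      (cbox ((-pi - (- pi)) /\<^sub>R 1) ((-0 - (- pi)) /\<^sub>R 1))"
    by (rule has_integral_affinity') (use reflect in auto)
  then have "((\<lambda>\<theta>. ln \<bar>- cos \<theta> - t\<bar>) has_integral log_mean (of_real t)) {0..pi}"
    unfolding box shift by simp
  moreover have "\<bar>- c - t\<bar> = \<bar>c - (- t)\<bar>" for c by linarith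
  ultimately have "((\<lambda>\<theta>. ln \<bar>cos \<theta> - (- t)\<bar>) has_integral log_mean (of_real t)) {0..pi}"
    by (simp only:)
  with log_mean_has_integral[of "-t"] show ?thesis by (rule has_integral_unique)
qed

text \<open>\<open>cos (2\<theta>)\<close> has the same law as \<open>cos \<theta>\<close>. Iterating this functional equation turns crude
  bounds on \<open>log_mean\<close> into sharp ones.\<close>
lemma log_mean_double:
  "log_mean (of_real (2 * t\<^sup>2 - 1)) + pi * ln 2 = 2 * (log_mean (of_real t) + pi * ln 2)"
proof -
  have "((\<lambda>\<theta>. ln \<bar>cos (2 * \<theta>) - (2 * t\<^sup>2 - 1)\<bar>) has_integral log_mean (of_real (2 * t\<^sup>2 - 1))) {0..pi}"
    by (rule has_integral_cos_double[OF log_mean_has_integral])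
  moreover have "((\<lambda>\<theta>. ln \<bar>cos (2 * \<theta>) - (2 * t\<^sup>2 - 1)\<bar>) has_integral
      pi * ln 2 + (log_mean (of_real t) + log_mean (of_real (- t)))) {0..pi}"
  \<comment> \<open>cos (2 theta) - (2 t^2 - 1) = 2 (cos theta - t) (cos theta + t). Its zeros are
    exempted because \<open>ln 0 = 0\<close> breaks the logarithm of a product.\<close>
  proof (rule has_integral_spike_finite)
    show "finite ({\<theta> \<in> {0..pi}. cos \<theta> = t} \<union> {\<theta> \<in> {0..pi}. cos \<theta> = - t})"
      using finite_cos_eq by simp
    show "((\<lambda>\<theta>. ln 2 + (ln \<bar>cos \<theta> - t\<bar> + ln \<bar>cos \<theta> - (- t)\<bar>)) has_integral
      pi * ln 2 + (log_mean (of_real t) + log_mean (of_real (- t)))) {0..pi}"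
      using has_integral_const_real[of "ln 2 :: real" 0 pi]
      by (intro has_integral_add log_mean_has_integral) simp
    fix \<theta> assume "\<theta> \<in> {0..pi} - ({\<theta> \<in> {0..pi}. cos \<theta> = t} \<union> {\<theta> \<in> {0..pi}. cos \<theta> = - t})"
    then have n: "cos \<theta> - t \<noteq> 0" "cos \<theta> - (- t) \<noteq> 0" by auto
    have "cos (2 * \<theta>) - (2 * t\<^sup>2 - 1) = 2 * ((cos \<theta> - t) * (cos \<theta> - (- t)))"
      using cos_double_cos[of \<theta>] by (simp add: power2_eq_square algebra_simps)
    then show "ln \<bar>cos (2 * \<theta>) - (2 * t\<^sup>2 - 1)\<bar> = ln 2 + (ln \<bar>cos \<theta> - t\<bar> + ln \<bar>cos \<theta> - (- t)\<bar>)"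
      using n by (simp only: abs_mult) (simp add: ln_mult)
  qed
  ultimately show ?thesis
    unfolding log_mean_minus by (auto dest: has_integral_unique)
qed

text \<open>For |t| <= 2 the uniform bound \<open>log_mean_lower\<close> suffices; for |t| > 2 the
  integrand is at least ln (|t| / 2) while green t <= 2 |t|. Either way only a constant is
  lost.\<close>

lemma log_mean_ge_crude: "\<exists>C. \<forall>t. pi * (ln (green t) - C) \<le> log_mean (of_real t) + pi * ln 2"
proof -
  define C where "C = ln 4 + (pi * ln 8 + 16 * sqrt pi) / pi"
  have "pi * (ln (green t) - C) \<le> log_mean (of_real t) + pi * ln 2" for t
  proof (cases "\<bar>t\<bar> \<le> 2")
    case True
    have "green t \<le> 4"
      using green_le[of t] True by (cases "1 \<le> \<bar>t\<bar>") (auto simp: green_def)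
    then have "ln (green t) \<le> ln 4" using green_pos[of t] by simp
    then have "ln (green t) - C \<le> - ((pi * ln 8 + 16 * sqrt pi) / pi)" by (simp add: C_def)
    then have "pi * (ln (green t) - C) \<le> pi * - ((pi * ln 8 + 16 * sqrt pi) / pi)"
      by (intro mult_left_mono) auto
    also have "\<dots> = - (pi * ln 8 + 16 * sqrt pi)" by simp
    also have "\<dots> \<le> log_mean (of_real t)" by (rule log_mean_lower)
    also have "\<dots> \<le> log_mean (of_real t) + pi * ln 2" by simp
    finally show ?thesis .
  next
    case False
    have "C \<ge> ln 2" unfolding C_def by (rule order_trans[of _ "ln 4"]) auto
    have "ln (green t) \<le> ln (2 * \<bar>t\<bar>)" using green_le[of t] green_pos[of t] False by (intro ln_mono) auto
    also have "\<dots> = ln 2 + ln \<bar>t\<bar>" using False by (intro ln_mult_pos) auto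
    finally have "ln (green t) - C \<le> ln (\<bar>t\<bar> / 2) + ln 2" using \<open>C \<ge> ln 2\<close> False by (subst ln_divide_pos) auto
    then have "pi * (ln (green t) - C) \<le> pi * ln (\<bar>t\<bar> / 2) + pi * ln 2"
      by (simp flip: distrib_left)
    moreover have "pi * ln (\<bar>t\<bar> / 2) \<le> log_mean (of_real t)"
    proof (rule has_integral_le[OF _ log_mean_has_integral])
      show "((\<lambda>\<theta>. ln (\<bar>t\<bar> / 2)) has_integral pi * ln (\<bar>t\<bar> / 2)) {0..pi}"
        using has_integral_const_real[of "ln (\<bar>t\<bar> / 2)" 0 pi] by simp
      show "ln (\<bar>t\<bar> / 2) \<le> ln \<bar>cos \<theta> - t\<bar>" for \<theta>
        using False cos_le_one[of \<theta>] cos_ge_minus_one[of \<theta>] by (intro ln_mono) linarith+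
    qed
    ultimately show ?thesis by simp
  qed
  then show ?thesis by blast
qed

text \<open>Both pi * ln (green t) and the right-hand side are doubled by t -> 2 t^2 - 1, so k
  applications of the functional equation divide the error of the crude bound by 2 ^ k.\<close>

lemma log_mean_real_ge: "pi * ln (green t) \<le> log_mean (of_real t) + pi * ln 2"
proof -
  define L where "L t = log_mean (of_real t) + pi * ln 2" for t
  obtain C where C: "\<And>t. pi * (ln (green t) - C) \<le> L t"
    using log_mean_ge_crude unfolding L_def by blast
  have step: "pi * (ln (green t) - C / 2 ^ k) \<le> L t" for t k
  proof (induction k arbitrary: t)
    case 0
    show ?case using C by simp
  next
    case (Suc k)
    have "pi * (ln (green (2 * t\<^sup>2 - 1)) - C / 2 ^ k) \<le> 2 * L t"
      using Suc.IH[of "2 * t\<^sup>2 - 1"] log_mean_double[of t] unfolding L_def by simp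
    then show ?case using green_pos[of t] by (simp add: green_double ln_realpow algebra_simps)
  qed
  have "(\<lambda>k. pi * (ln (green t) - C / 2 ^ k)) \<longlonglongrightarrow> pi * (ln (green t) - 0)"
    by (intro tendsto_intros) real_asymp
  then have "pi * (ln (green t) - 0) \<le> L t"
    by (rule LIMSEQ_le_const2) (use step in auto)
  then show ?thesis by (simp add: L_def)
qed

text \<open>An imaginary part only increases the distance to cos theta. The bound by the modulus
  serves for non-leading coefficients, in which the zeros themselves occur as factors.\<close>

lemma
  shows log_mean_ge_green: "pi * ln (green (Re z) / 2) \<le> log_mean z"
    and log_mean_ge_cmod: "z \<noteq> 0 \<Longrightarrow> pi * ln (cmod z / 4) \<le> log_mean z"
proof -
  have "log_mean (of_real (Re z)) \<le> log_mean z"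
  proof (rule has_integral_le)
    \<comment> \<open>Where cos theta = Re z, the convention \<open>ln 0 = 0\<close> could violate
      monotonicity, so the smaller integrand is altered on this finite set.\<close>
    define S where "S = {\<theta> \<in> {0..pi}. cos \<theta> = Re z}"
    show "((\<lambda>\<theta>. if \<theta> \<in> S then ln (cmod (of_real (cos \<theta>) - z)) else ln \<bar>cos \<theta> - Re z\<bar>) has_integral
        log_mean (of_real (Re z))) {0..pi}"
      by (rule has_integral_spike_finite[OF _ _ log_mean_has_integral, of S]) (use finite_cos_eq in \<open>auto simp: S_def\<close>)
    show "((\<lambda>\<theta>. ln (cmod (of_real (cos \<theta>) - z))) has_integral log_mean z) {0..pi}"
      unfolding log_mean_def by (rule integrable_integral[OF log_mean_integrable])
    fix \<theta> assume "\<theta> \<in> {0..pi}"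
    then show "(if \<theta> \<in> S then ln (cmod (of_real (cos \<theta>) - z)) else ln \<bar>cos \<theta> - Re z\<bar>) \<le> ln (cmod (of_real (cos \<theta>) - z))"
      using abs_Re_le_cmod[of "of_real (cos \<theta>) - z"] by (auto simp: S_def intro!: ln_mono)
  qed
  then show 1: "pi * ln (green (Re z) / 2) \<le> log_mean z"
    using log_mean_real_ge[of "Re z"] green_pos[of "Re z"] by (simp add: ln_div right_diff_distrib)
  show "pi * ln (cmod z / 4) \<le> log_mean z" if "z \<noteq> 0"
  proof (cases "cmod z \<le> 2")
    case True
    have "ln (cmod z / 4) \<le> ln (green (Re z) / 2)"
      using True that green_ge_1[of "Re z"] by (intro ln_mono) auto
    then have "pi * ln (cmod z / 4) \<le> pi * ln (green (Re z) / 2)" by (intro mult_left_mono) auto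
    with 1 show ?thesis by linarith
  next
    case False
    show ?thesis unfolding log_mean_def
    proof (rule has_integral_le[OF _ integrable_integral[OF log_mean_integrable]])
      show "((\<lambda>\<theta>. ln (cmod z / 4)) has_integral pi * ln (cmod z / 4)) {0..pi}"
        using has_integral_const_real[of "ln (cmod z / 4)" 0 pi] by simp
      fix \<theta>
      have "cmod z - cmod (of_real (cos \<theta>)) \<le> cmod (of_real (cos \<theta>) - z)"
        by (metis norm_minus_commute norm_triangle_ineq2)
      then have "cmod z / 4 \<le> cmod (of_real (cos \<theta>) - z)" using False abs_cos_le_one[of \<theta>] unfolding norm_of_real by linarith
      then show "ln (cmod z / 4) \<le> ln (cmod (of_real (cos \<theta>) - z))" using that by (intro ln_mono) auto
    qed
  qed
qed

section \<open>Zeros outside an interval\<close>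

text \<open>In the expansion of the product, d of the linear factors contribute their leading term
  and the others their root. A leading term is paid for by V x >= 1/2, or g / 2 on
  \<open>Out\<close>, whence 2 ^ d; a root by cmod x <= 4 * V x, with a further g for membership in
  \<open>Out\<close>. There are at most (size A + 1) ^ (size A - d) choices. The induction on
  \<open>A\<close> carries out this count one zero at a time.\<close>

lemma coeff_prod_mset_bound:
  fixes V :: "complex \<Rightarrow> real" and g :: real
  assumes g: "g \<ge> 1"
    and V_pos: "\<And>z. V z \<ge> 1 / 2"
    and V_out: "\<And>z. z \<in> Out \<Longrightarrow> V z \<ge> g / 2"
    and V_cmod: "\<And>z. V z \<ge> cmod z / 4"
    and d: "d \<le> size A"
  shows "cmod (coeff (\<Prod>x\<in>#A. [:-x, 1:]) d) / 2 ^ d * g ^ size (filter_mset (\<lambda>x. x \<in> Out) A)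
    \<le> (4 * g * (real (size A) + 1)) ^ (size A - d) * (\<Prod>x\<in>#A. V x)"
  using d
proof (induction A arbitrary: d)
  case empty
  then show ?case by simp
next
  case (add x A)
  define P where "P = (\<Prod>x\<in>#A. [:-x, 1:])"
  define L where "L = size A"
  define G where "G = g ^ size (filter_mset (\<lambda>x. x \<in> Out) A)"
  define \<psi> where "\<psi> = (if x \<in> Out then g else 1)"
  define U where "U = (\<Prod>x\<in>#A. V x)"
  \<comment> \<open>One more zero raises the base by 4 * g, which is exactly what the term with the
    root \<open>x\<close> consumes; the shifted coefficient gets by with the base
    \<open>M\<close>.\<close>
  define M where "M = 4 * g * (real L + 1)"
  have pos: "G \<ge> 0" "\<psi> \<ge> 1" "\<psi> \<le> g" "M \<ge> 0" "V x > 0"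
    using g V_pos[of x] by (auto simp: G_def \<psi>_def M_def intro!: mult_nonneg_nonneg)
  have U: "U \<ge> 0"
    unfolding U_def by (induction A) (use V_pos in \<open>auto intro!: mult_nonneg_nonneg order_trans[OF _ V_pos]\<close>)
  have V\<psi>: "\<psi> / 2 \<le> V x" using V_out V_pos by (auto simp: \<psi>_def)
  have IH: "cmod (coeff P d) / 2 ^ d * G \<le> M ^ (L - d) * U" if "d \<le> L" for d
    using add.IH[of d] that by (simp add: P_def L_def G_def U_def M_def add.commute)
  have t1: "(if d = 0 then 0 else cmod (coeff P (d - 1))) / 2 ^ d * (G * \<psi>) \<le> M ^ (Suc L - d) * (V x * U)"
  proof (cases d)
    case 0
    then show ?thesis using pos U by simp
  next
    case (Suc e)
    have "(cmod (coeff P e) / 2 ^ e * G) * (\<psi> / 2) \<le> (M ^ (L - e) * U) * V x"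
    proof (rule mult_mono)
      show "cmod (coeff P e) / 2 ^ e * G \<le> M ^ (L - e) * U"
        using IH[of e] Suc add.prems by (simp add: L_def)
    qed (use V\<psi> pos U in auto)
    then show ?thesis using Suc by (simp add: mult_ac)
  qed
  have t2: "cmod x * cmod (coeff P d) / 2 ^ d * (G * \<psi>) \<le> 4 * g * M ^ (L - d) * (V x * U)" if "d \<le> L"
  proof -
    have "(cmod (coeff P d) / 2 ^ d * G) * (cmod x * \<psi>) \<le> (M ^ (L - d) * U) * ((4 * V x) * g)"
    proof (rule mult_mono)
      show "cmod x * \<psi> \<le> 4 * V x * g" using V_cmod[of x] pos by (intro mult_mono) auto
    qed (use IH[OF that] pos U in auto)
    then show ?thesis by (simp add: mult_ac)
  qed
  have Pd: "coeff P d = 0" if "d > L"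
  proof -
    have "degree P \<le> L" unfolding P_def L_def
    proof (induction A)
      case (add x A)
      have "degree ([:-x, 1:] * (\<Prod>x\<in>#A. [:-x, 1:])) \<le> 1 + degree (\<Prod>x\<in>#A. [:-x, 1:])"
        by (rule order_trans[OF degree_mult_le]) simp
      with add show ?case by simp
    qed simp
    with that show ?thesis by (intro coeff_eq_0) simp
  qed
  have "cmod (coeff ([:-x, 1:] * P) d) \<le> cmod x * cmod (coeff P d) + (if d = 0 then 0 else cmod (coeff P (d - 1)))"
  proof (cases d)
    case (Suc e)
    then show ?thesis
      using norm_triangle_ineq4[of "coeff P e" "x * coeff P (Suc e)"] by (simp add: norm_mult)
  qed (simp add: norm_mult)
  then have "cmod (coeff ([:-x, 1:] * P) d) / 2 ^ d * (G * \<psi>)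
    \<le> (cmod x * cmod (coeff P d) + (if d = 0 then 0 else cmod (coeff P (d - 1)))) / 2 ^ d * (G * \<psi>)"
    using pos by (intro mult_right_mono divide_right_mono) auto
  also have "\<dots> = cmod x * cmod (coeff P d) / 2 ^ d * (G * \<psi>) + (if d = 0 then 0 else cmod (coeff P (d - 1))) / 2 ^ d * (G * \<psi>)"
    by (simp add: add_divide_distrib distrib_right)
  also have "\<dots> \<le> (M + 4 * g) ^ (Suc L - d) * (V x * U)"
  proof (cases "d \<le> L")
    case True
    then obtain j where j: "Suc L - d = Suc j" "L - d = j" by (simp add: Suc_diff_le)
    have "cmod x * cmod (coeff P d) / 2 ^ d * (G * \<psi>) + (if d = 0 then 0 else cmod (coeff P (d - 1))) / 2 ^ d * (G * \<psi>)
      \<le> 4 * g * M ^ j * (V x * U) + M ^ Suc j * (V x * U)"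
      using t1 t2[OF True] unfolding j by (rule add_mono[rotated])
    also have "\<dots> = (M + 4 * g) * M ^ j * (V x * U)" by (simp add: algebra_simps)
    also have "\<dots> \<le> (M + 4 * g) * (M + 4 * g) ^ j * (V x * U)"
      using pos U g by (intro mult_right_mono mult_left_mono power_mono) auto
    finally show ?thesis unfolding j by simp
  next
    \<comment> \<open>Here d = L + 1, so only the shifted coefficient is left.\<close>
    case False
    then show ?thesis using t1 Pd add.prems by (simp add: L_def)
  qed
  also have "M + 4 * g = 4 * g * (real (Suc L) + 1)" by (simp add: M_def algebra_simps)
  finally show ?case
    by (cases "x \<in> Out") (simp_all add: P_def G_def \<psi>_def U_def L_def mult_ac)
qed

section \<open>A Jensen-type bound for the number of outer zeros\<close>

lemma finite_cos_vimage: "finite T \<Longrightarrow> finite {\<theta> \<in> {0..pi}. cos \<theta> \<in> T}"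
proof -
  assume "finite T"
  moreover have "inj_on cos {0..pi}" by (auto simp: inj_on_def intro: cos_inj_pi)
  ultimately have "finite (cos -` T \<inter> {0..pi})" by (rule finite_vimage_IntI)
  then show ?thesis by (rule rev_finite_subset) auto
qed

lemma ln_prod_mset_has_integral:
  "((\<lambda>\<theta>. ln (cmod (poly (\<Prod>x\<in>#A. [:-x, 1:]) (of_real (cos \<theta>))))) has_integral (\<Sum>x\<in>#A. log_mean x)) {0..pi}"
proof (induction A)
  case empty
  then show ?case by simp
next
  case (add x A)
  define P where "P = (\<Prod>x\<in>#A. [:-x, 1:])"
  define S where "S = {\<theta> \<in> {0..pi}. cos \<theta> \<in> of_real -` {z. poly ([:-x, 1:] * P) z = 0}}"
  have "P \<noteq> 0" unfolding P_def by (auto simp: prod_mset_zero_iff)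
  then have "[:-x, 1:] * P \<noteq> 0" by (intro no_zero_divisors) auto
  then have "finite {z. poly ([:-x, 1:] * P) z = 0}" by (rule poly_roots_finite)
  then have "finite S" unfolding S_def
    by (intro finite_cos_vimage finite_vimageI) (auto intro: inj_of_real)
  have "((\<lambda>\<theta>. ln (cmod (of_real (cos \<theta>) - x)) + ln (cmod (poly P (of_real (cos \<theta>))))) has_integral
      (log_mean x + (\<Sum>x\<in>#A. log_mean x))) {0..pi}"
    using add.IH unfolding P_def log_mean_def[of x]
    by (intro has_integral_add integrable_integral[OF log_mean_integrable])
  then have "((\<lambda>\<theta>. ln (cmod (poly ([:-x, 1:] * P) (of_real (cos \<theta>))))) has_integral
      (log_mean x + (\<Sum>x\<in>#A. log_mean x))) {0..pi}"
  proof (rule has_integral_spike_finite[OF \<open>finite S\<close>, rotated])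
    fix \<theta> assume "\<theta> \<in> {0..pi} - S"
    then have "poly ([:-x, 1:] * P) (of_real (cos \<theta>)) \<noteq> 0" by (simp add: S_def)
    then show "ln (cmod (poly ([:-x, 1:] * P) (of_real (cos \<theta>)))) =
        ln (cmod (of_real (cos \<theta>) - x)) + ln (cmod (poly P (of_real (cos \<theta>))))"
      by (subst poly_mult, subst norm_mult, subst ln_mult_pos) (auto simp: algebra_simps)
  qed
  then show ?case by (simp add: P_def)
qed

lemma poly_map_poly_of_real: "poly (map_poly of_real P) (of_real x) = (of_real (poly P x) :: 'a :: {comm_ring_1, real_algebra_1})"
  by (induction P) (auto simp: map_poly_pCons)

lemma ln_abs_poly_has_integral:
  fixes P :: "real poly"
  assumes P: "map_poly complex_of_real P = smult (of_real l) (\<Prod>x\<in>#A. [:-x, 1:])" and l: "l \<noteq> 0"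
  shows "((\<lambda>\<theta>. ln \<bar>poly P (cos \<theta>)\<bar>) has_integral pi * ln \<bar>l\<bar> + (\<Sum>x\<in>#A. log_mean x)) {0..pi}"
proof -
  define Pr where "Pr = (\<Prod>x\<in>#A. [:-x, 1:])"
  have "Pr \<noteq> 0" unfolding Pr_def by (auto simp: prod_mset_zero_iff)
  then have P0: "P \<noteq> 0" using P l unfolding Pr_def by auto
  have 0: "((\<lambda>\<theta>. ln \<bar>l\<bar> + ln (cmod (poly Pr (of_real (cos \<theta>))))) has_integral pi * ln \<bar>l\<bar> + (\<Sum>x\<in>#A. log_mean x)) {0..pi}"
    unfolding Pr_def using has_integral_const_real[of "ln \<bar>l\<bar>" 0 pi]
    by (intro has_integral_add ln_prod_mset_has_integral) simp
  have fin: "finite {\<theta> \<in> {0..pi}. cos \<theta> \<in> {x. poly P x = 0}}"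
    by (intro finite_cos_vimage poly_roots_finite P0)
  show ?thesis
  proof (rule has_integral_spike_finite[OF fin _ 0])
    fix \<theta> assume \<theta>: "\<theta> \<in> {0..pi} - {\<theta> \<in> {0..pi}. cos \<theta> \<in> {x. poly P x = 0}}"
    have "complex_of_real (poly P (cos \<theta>)) = of_real l * poly Pr (of_real (cos \<theta>))"
      unfolding poly_map_poly_of_real[symmetric] P Pr_def by simp
    then have eq: "\<bar>poly P (cos \<theta>)\<bar> = \<bar>l\<bar> * cmod (poly Pr (of_real (cos \<theta>)))"
      by (metis norm_mult norm_of_real)
    then have "cmod (poly Pr (of_real (cos \<theta>))) > 0" using \<theta> by auto
    then show "ln \<bar>poly P (cos \<theta>)\<bar> = ln \<bar>l\<bar> + ln (cmod (poly Pr (of_real (cos \<theta>))))"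
      unfolding eq using l by (intro ln_mult_pos) auto
  qed
qed

lemma poly_complex_factorization:
  fixes P :: "real poly"
  assumes "P \<noteq> 0"
  obtains A where "size A = degree P"
    "map_poly complex_of_real P = smult (of_real (lead_coeff P)) (\<Prod>x\<in>#A. [:-x, 1:])"
proof -
  define R where "R = map_poly complex_of_real P"
  have R: "R \<noteq> 0" "degree R = degree P" "lead_coeff R = of_real (lead_coeff P)"
    unfolding R_def using assms by (auto simp: map_poly_eq_0_iff degree_map_poly coeff_map_poly)
  from alg_closed_imp_factorization[OF R(1)] show ?thesis
    using that R unfolding R_def by metis
qed

lemma ln_abs_poly_integrable:
  fixes P :: "real poly"
  assumes "P \<noteq> 0"
  shows "(\<lambda>\<theta>. ln \<bar>poly P (cos \<theta>)\<bar>) integrable_on {0..pi}"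
  using poly_complex_factorization[OF assms] ln_abs_poly_has_integral assms
  by (metis has_integral_integrable leading_coeff_0_iff)

lemma card_set_mset_le: "card (set_mset A) \<le> size A"
  by (induction A) (auto simp: card_insert_if)

lemma green_mono: "1 \<le> t \<Longrightarrow> t \<le> \<bar>x\<bar> \<Longrightarrow> green t \<le> green x"
proof (cases "t \<le> 1")
  assume "1 \<le> t" "t \<le> \<bar>x\<bar>"
  then show ?thesis if "t \<le> 1" using that green_ge_1[of x] by (simp add: green_def)
  assume "\<not> t \<le> 1"
  moreover have "sqrt (t\<^sup>2 - 1) \<le> sqrt (x\<^sup>2 - 1)"
    using \<open>1 \<le> t\<close> \<open>t \<le> \<bar>x\<bar>\<close> abs_le_square_iff[of t x] by simp
  ultimately show ?thesis using \<open>t \<le> \<bar>x\<bar>\<close> by (simp add: green_def add_mono)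
qed

text \<open>Jensen's formula with the arcsine law in place of the circle: the log mean of
  \<open>P\<close> is the sum of those of its zeros, where each zero gives at least - ln 2 and each
  outer one ln (green t) more. Starting from coefficient \<open>d\<close> instead of the leading one
  costs the last summand.\<close>

lemma card_outer_roots_unit:
  fixes P :: "real poly"
  assumes c: "coeff P d \<noteq> 0" and t: "t \<ge> 1"
  shows "real (card {x. poly P x = 0 \<and> t \<le> \<bar>x\<bar>}) * ln (green t)
    \<le> integral {0..pi} (\<lambda>\<theta>. ln \<bar>poly P (cos \<theta>)\<bar>) / pi - ln \<bar>coeff P d\<bar> + d * ln 2
      + real (degree P - d) * ln (4 * green t * (degree P + 1))"
proof -
  have P0: "P \<noteq> 0" using c by auto
  have dle: "d \<le> degree P" using c by (rule le_degree)
  define l where "l = lead_coeff P"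
  have l: "l \<noteq> 0" using P0 by (simp add: l_def)
  obtain A where A: "size A = degree P" "map_poly complex_of_real P = smult (of_real l) (\<Prod>x\<in>#A. [:-x, 1:])"
    using poly_complex_factorization[OF P0] unfolding l_def by metis
  define Pr where "Pr = (\<Prod>x\<in>#A. [:-x, 1:])"
  \<comment> \<open>The geometric mean of the linear factor |cos theta - z| over the arcsine
    law.\<close>
  define V where "V z = exp (log_mean z / pi)" for z
  define Out where "Out = {z. \<exists>x. z = complex_of_real x \<and> t \<le> \<bar>x\<bar>}"
  have V_green: "green (Re z) / 2 \<le> V z" for z
  proof -
    have "green (Re z) / 2 = exp (ln (green (Re z) / 2))" using green_pos by simp
    also have "\<dots> \<le> V z" unfolding V_def using log_mean_ge_green[of z] by (simp add: field_simps)
    finally show ?thesis .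
  qed
  have V_cmod: "cmod z / 4 \<le> V z" for z
  proof (cases "z = 0")
    case False
    then have "cmod z / 4 = exp (ln (cmod z / 4))" by simp
    also have "\<dots> \<le> V z" unfolding V_def using log_mean_ge_cmod[OF False] by (simp add: field_simps)
    finally show ?thesis .
  qed (simp add: V_def)
  have bound: "cmod (coeff Pr d) / 2 ^ d * green t ^ size (filter_mset (\<lambda>x. x \<in> Out) A)
    \<le> (4 * green t * (real (size A) + 1)) ^ (size A - d) * (\<Prod>x\<in>#A. V x)"
    unfolding Pr_def
  proof (rule coeff_prod_mset_bound)
    show "V z \<ge> 1 / 2" for z using V_green[of z] green_ge_1[of "Re z"] by simp
    show "V z \<ge> green t / 2" if "z \<in> Out" for z
      using that V_green[of z] green_mono[OF t] by (force simp: Out_def)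
  qed (use V_cmod green_ge_1 A dle in auto)
  have prodV: "(\<Prod>x\<in>#A. V x) = exp ((\<Sum>x\<in>#A. log_mean x) / pi)"
    unfolding V_def by (induction A) (auto simp: exp_add add_divide_distrib)
  have "complex_of_real (coeff P d) = of_real l * coeff Pr d"
    using arg_cong[OF A(2), of "\<lambda>R. coeff R d"] by (simp add: coeff_map_poly Pr_def)
  then have cdn: "\<bar>coeff P d\<bar> = \<bar>l\<bar> * cmod (coeff Pr d)"
    by (metis norm_mult norm_of_real)
  have cn0: "cmod (coeff Pr d) > 0" using c cdn by auto
  have I: "integral {0..pi} (\<lambda>\<theta>. ln \<bar>poly P (cos \<theta>)\<bar>) = pi * ln \<bar>l\<bar> + (\<Sum>x\<in>#A. log_mean x)"
    by (rule integral_unique[OF ln_abs_poly_has_integral[OF A(2) l]])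
  \<comment> \<open>Zeros count once on the left and with multiplicity on the right.\<close>
  have card: "card {x. poly P x = 0 \<and> t \<le> \<bar>x\<bar>} \<le> size (filter_mset (\<lambda>x. x \<in> Out) A)"
  proof -
    have "poly (\<Prod>x\<in>#A. [:-x, 1:]) z = 0 \<longleftrightarrow> z \<in># A" for z
      by (induction A) auto
    then have root: "of_real x \<in># A" if "poly P x = 0" for x
      using that poly_map_poly_of_real[of P x] A(2) l by (metis mult_eq_0_iff of_real_0 of_real_eq_0_iff poly_smult)
    have "card {x. poly P x = 0 \<and> t \<le> \<bar>x\<bar>} = card (complex_of_real ` {x. poly P x = 0 \<and> t \<le> \<bar>x\<bar>})"
      by (rule card_image[symmetric]) (simp add: inj_on_def)
    also have "\<dots> \<le> card (set_mset (filter_mset (\<lambda>x. x \<in> Out) A))"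
      using root by (intro card_mono) (auto simp: Out_def)
    also have "\<dots> \<le> size (filter_mset (\<lambda>x. x \<in> Out) A)"
      by (rule card_set_mset_le)
    finally show ?thesis .
  qed
  have "real (card {x. poly P x = 0 \<and> t \<le> \<bar>x\<bar>}) * ln (green t) \<le> real (size (filter_mset (\<lambda>x. x \<in> Out) A)) * ln (green t)"
    using card green_ge_1[of t] by (intro mult_right_mono) auto
  also have "\<dots> = ln (cmod (coeff Pr d) / 2 ^ d * green t ^ size (filter_mset (\<lambda>x. x \<in> Out) A)) - ln (cmod (coeff Pr d)) + d * ln 2"
    using cn0 green_pos[of t] by (simp add: ln_mult ln_div ln_realpow)
  also have "\<dots> \<le> ln ((4 * green t * (real (size A) + 1)) ^ (size A - d) * (\<Prod>x\<in>#A. V x)) - ln (cmod (coeff Pr d)) + d * ln 2"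
    using bound cn0 green_pos[of t] by (intro add_right_mono diff_right_mono ln_mono) auto
  also have "ln ((4 * green t * (real (size A) + 1)) ^ (size A - d) * (\<Prod>x\<in>#A. V x)) =
      real (degree P - d) * ln (4 * green t * (degree P + 1)) + (\<Sum>x\<in>#A. log_mean x) / pi"
    using green_pos[of t] A(1) unfolding prodV by (subst ln_mult_pos) (auto simp: ln_realpow add.commute)
  also have "ln (cmod (coeff Pr d)) = ln \<bar>coeff P d\<bar> - ln \<bar>l\<bar>"
    unfolding cdn using l cn0 by (simp add: ln_mult)
  finally show ?thesis
    unfolding I by (simp add: add_divide_distrib)
qed

lemma card_outer_roots:
  fixes P :: "real poly"
  assumes c: "coeff P d \<noteq> 0" and t: "t \<ge> 1" and b: "b > 0"
  shows "real (card {x. poly P x = 0 \<and> t * b \<le> \<bar>x\<bar>}) * ln (green t)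
    \<le> integral {0..pi} (\<lambda>\<theta>. ln \<bar>poly P (b * cos \<theta>)\<bar>) / pi - ln \<bar>coeff P d\<bar> - d * ln (b / 2)
      + real (degree P - d) * ln (4 * green t * (degree P + 1))"
proof -
  define R where "R = pcompose P [:0, b:]"
  have coeffR: "coeff R k = b ^ k * coeff P k" for k
    unfolding R_def by (rule coeff_pcompose_linear)
  have polyR: "poly R x = poly P (b * x)" for x by (simp add: R_def poly_pcompose mult.commute)
  have degR: "degree R = degree P" using b by (simp add: R_def degree_pcompose)
  have "{x. poly P x = 0 \<and> t * b \<le> \<bar>x\<bar>} = (\<lambda>x. b * x) ` {x. poly R x = 0 \<and> t \<le> \<bar>x\<bar>}"
  proof (intro equalityI subsetI)
    fix x assume "x \<in> {x. poly P x = 0 \<and> t * b \<le> \<bar>x\<bar>}"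
    then show "x \<in> (\<lambda>x. b * x) ` {x. poly R x = 0 \<and> t \<le> \<bar>x\<bar>}"
      using b by (intro image_eqI[of _ _ "x / b"]) (auto simp: polyR field_simps)
  next
    fix x assume "x \<in> (\<lambda>x. b * x) ` {x. poly R x = 0 \<and> t \<le> \<bar>x\<bar>}"
    then show "x \<in> {x. poly P x = 0 \<and> t * b \<le> \<bar>x\<bar>}"
      using b by (auto simp: polyR abs_mult mult.commute)
  qed
  then have "card {x. poly P x = 0 \<and> t * b \<le> \<bar>x\<bar>} = card {x. poly R x = 0 \<and> t \<le> \<bar>x\<bar>}"
    using b by (simp add: card_image inj_on_def)
  moreover have "ln \<bar>coeff R d\<bar> = d * ln b + ln \<bar>coeff P d\<bar>"
    unfolding coeffR using b c by (simp add: abs_mult ln_mult ln_realpow)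
  moreover have "coeff R d \<noteq> 0" using b c by (simp add: coeffR)
  ultimately show ?thesis
    using card_outer_roots_unit[of R d t] b t
    by (simp add: polyR degR ln_div algebra_simps)
qed

text \<open>Since sin^2 = (1 - cos) (1 + cos), this is a case of \<open>log_mean\<close>. It handles
  the Jacobian of x = b cos theta in the next lemma.\<close>

lemma log_mean_sin: "((\<lambda>\<theta>. ln (sin \<theta>)) has_integral (log_mean 1 + log_mean (-1)) / 2) {0..pi}"
proof (rule has_integral_spike_finite)
  show "((\<lambda>\<theta>. (ln \<bar>cos \<theta> - 1\<bar> + ln \<bar>cos \<theta> - (-1)\<bar>) / 2) has_integral (log_mean 1 + log_mean (-1)) / 2) {0..pi}"
    using log_mean_has_integral[of 1] log_mean_has_integral[of "-1"]
    by (intro has_integral_divide has_integral_add) auto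
  show "finite {0, pi}" by simp
  fix \<theta> assume "\<theta> \<in> {0..pi} - {0, pi}"
  then have s: "sin \<theta> > 0" by (intro sin_gt_zero) auto
  have "2 * ln (sin \<theta>) = ln ((sin \<theta>)\<^sup>2)" using s by (simp add: ln_realpow)
  also have "(sin \<theta>)\<^sup>2 = (1 - cos \<theta>) * (cos \<theta> - (-1))"
    by (simp add: sin_squared_eq algebra_simps power2_eq_square)
  also have "\<dots> = \<bar>cos \<theta> - 1\<bar> * \<bar>cos \<theta> - (-1)\<bar>"
    by (subst abs_of_nonpos, use cos_le_one[of \<theta>] in simp, subst abs_of_nonneg, use cos_ge_minus_one[of \<theta>] in linarith, simp)
  also have "ln (\<bar>cos \<theta> - 1\<bar> * \<bar>cos \<theta> - (-1)\<bar>) = ln \<bar>cos \<theta> - 1\<bar> + ln \<bar>cos \<theta> - (-1)\<bar>"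
  proof (rule ln_mult_pos)
    have "(cos \<theta>)\<^sup>2 < 1" using s sin_cos_squared_add[of \<theta>] by (smt (verit) zero_less_power2)
    then show "0 < \<bar>cos \<theta> - 1\<bar>" "0 < \<bar>cos \<theta> - (-1)\<bar>" using cos_le_one[of \<theta>] cos_ge_minus_one[of \<theta>] by (smt (verit) power2_eq_1_iff)+
  qed
  finally show "ln (sin \<theta>) = (ln \<bar>cos \<theta> - 1\<bar> + ln \<bar>cos \<theta> - (-1)\<bar>) / 2" by simp
qed

text \<open>The concavity of the logarithm enters only through \<open>ln y \<le> y / S - 1 + ln S\<close>.\<close>
lemma integral_ln_poly_le:
  fixes P :: "real poly" and Q :: "real \<Rightarrow> real"
  assumes P: "P \<noteq> 0" and b: "b > 0" and Q: "continuous_on UNIV Q"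
    and int: "integrable lborel (\<lambda>x. (poly P x)\<^sup>2 * exp (- Q x) ^ 2)"
    and S: "(\<integral>x. (poly P x)\<^sup>2 * exp (- Q x) ^ 2 \<partial>lborel) \<le> S" "S > 0"
  shows "integral {0..pi} (\<lambda>\<theta>. ln \<bar>poly P (b * cos \<theta>)\<bar>)
    \<le> integral {0..pi} (\<lambda>\<theta>. Q (b * cos \<theta>)) + pi / 2 * ln S - pi / 2 * ln (b / 2)"
proof -
  define F where "F x = (poly P x)\<^sup>2 * exp (- Q x) ^ 2" for x
  have F0: "F x \<ge> 0" for x by (simp add: F_def)
  have contF: "continuous_on UNIV F" unfolding F_def by (intro continuous_intros Q)
  \<comment> \<open>The Jacobian of x = b cos theta is included, so \<open>y\<close> integrates to
    the weighted square norm on [-b, b], while ln y = ln b + ln (sin theta) + 2 ln |P| - 2 Q away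
    from zeros.\<close>
  define y where "y \<theta> = (b * sin \<theta>) * F (b * cos \<theta>)" for \<theta>
  have y_int: "(y has_integral integral {-b..b} F) {0..pi}"
  proof -
    \<comment> \<open>The substitution uses the increasing function - b cos theta; the reflection is
      undone afterwards.\<close>
    have "((\<lambda>\<theta>. (b * sin \<theta>) *\<^sub>R F (- (- b * cos \<theta>))) has_integral integral {- b * cos 0..- b * cos pi} (\<lambda>x. F (- x))) {0..pi}"
    proof (rule has_integral_substitution)
      show "(\<lambda>\<theta>. - b * cos \<theta>) ` {0..pi} \<subseteq> {-b..b}"
      proof (intro image_subsetI)
        fix \<theta> :: real
        have "\<bar>- b * cos \<theta>\<bar> \<le> b" using b by (simp add: abs_mult mult_left_le)
        then show "- b * cos \<theta> \<in> {-b..b}" unfolding abs_le_iff by simp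
      qed
      show "continuous_on {-b..b} (\<lambda>x. F (- x))"
        by (rule continuous_on_compose2[OF contF]) (auto intro!: continuous_intros)
      show "((\<lambda>\<theta>. - b * cos \<theta>) has_field_derivative b * sin x) (at x within {0..pi})" for x
        by (auto intro!: derivative_eq_intros)
    qed (use b in auto)
    moreover have "integral {-b..b} (\<lambda>x. F (- x)) = integral {-b..b} F"
      using Henstock_Kurzweil_Integration.integral_reflect_real[of b "-b" F] by simp
    ultimately show ?thesis by (simp add: y_def[abs_def])
  qed
  have "integral {-b..b} F = (LINT x:{-b..b}|lborel. F x)"
  proof (rule set_borel_integral_eq_integral(2)[symmetric])
    show "set_integrable lborel {-b..b} F"
      using contF unfolding set_integrable_def
      by (intro borel_integrable_compact) (auto intro: continuous_on_subset)
  qed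
  also have "\<dots> \<le> (\<integral>x. F x \<partial>lborel)"
    unfolding set_lebesgue_integral_def
  proof (rule integral_mono)
    show "integrable lborel (\<lambda>x. indicator {-b..b} x *\<^sub>R F x)"
      using borel_integrable_compact[of "{-b..b}" F] contF
      by (auto simp: set_integrable_def intro: continuous_on_subset)
  qed (use int F0 in \<open>auto simp: F_def indicator_def\<close>)
  finally have yS: "integral {-b..b} F \<le> S" using S(1) by (simp add: F_def)
  define Z where "Z = {0, pi} \<union> {\<theta> \<in> {0..pi}. cos \<theta> \<in> (\<lambda>x. x / b) ` {x. poly P x = 0}}"
  have finZ: "finite Z" unfolding Z_def by (intro finite_UnI finite_cos_vimage finite_imageI poly_roots_finite P) simp
  define rhs where "rhs \<theta> = 2 * Q (b * cos \<theta>) - ln b - ln (sin \<theta>) + (y \<theta> / S - 1 + ln S)" for \<theta>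
  have Pint: "(\<lambda>\<theta>. ln \<bar>poly P (b * cos \<theta>)\<bar>) integrable_on {0..pi}"
  proof -
    have "pcompose P [:0, b:] \<noteq> 0" using P b by (simp add: pcompose_eq_0_iff)
    from ln_abs_poly_integrable[OF this] show ?thesis by (simp add: poly_pcompose mult.commute)
  qed
  have Qint: "(\<lambda>\<theta>. Q (b * cos \<theta>)) integrable_on {0..pi}"
    by (intro integrable_continuous_real continuous_on_compose2[OF Q]) (auto intro!: continuous_intros)
  have l: "((\<lambda>\<theta>. if \<theta> \<in> Z then rhs \<theta> else 2 * ln \<bar>poly P (b * cos \<theta>)\<bar>) has_integral 2 * integral {0..pi} (\<lambda>\<theta>. ln \<bar>poly P (b * cos \<theta>)\<bar>)) {0..pi}"
    by (rule has_integral_spike_finite[OF finZ _ has_integral_mult_right[OF integrable_integral[OF Pint]]]) auto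
  have r: "(rhs has_integral 2 * integral {0..pi} (\<lambda>\<theta>. Q (b * cos \<theta>)) - pi * ln b - (log_mean 1 + log_mean (-1)) / 2
      + (integral {-b..b} F / S - pi + pi * ln S)) {0..pi}"
    unfolding rhs_def
    using has_integral_const_real[of "ln b" 0 pi] has_integral_const_real[of "1::real" 0 pi] has_integral_const_real[of "ln S" 0 pi]
    by (intro has_integral_add has_integral_diff has_integral_mult_right integrable_integral[OF Qint] log_mean_sin has_integral_divide y_int) auto
  have "2 * integral {0..pi} (\<lambda>\<theta>. ln \<bar>poly P (b * cos \<theta>)\<bar>) \<le> 2 * integral {0..pi} (\<lambda>\<theta>. Q (b * cos \<theta>)) - pi * ln b - (log_mean 1 + log_mean (-1)) / 2
      + (integral {-b..b} F / S - pi + pi * ln S)"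
  proof (rule has_integral_le[OF l r])
    fix \<theta> assume \<theta>: "\<theta> \<in> {0..pi}"
    show "(if \<theta> \<in> Z then rhs \<theta> else 2 * ln \<bar>poly P (b * cos \<theta>)\<bar>) \<le> rhs \<theta>"
    proof (cases "\<theta> \<in> Z")
      case False
      have s: "sin \<theta> > 0" using False \<theta> unfolding Z_def by (intro sin_gt_zero) auto
      have p: "poly P (b * cos \<theta>) \<noteq> 0"
        using False \<theta> b unfolding Z_def by (auto simp: image_iff)
      have yp: "y \<theta> > 0" using s p b by (simp add: y_def F_def)
      have "ln (y \<theta>) = ln b + ln (sin \<theta>) + (2 * ln \<bar>poly P (b * cos \<theta>)\<bar> - 2 * Q (b * cos \<theta>))"
      proof -
        have sq: "ln ((poly P (b * cos \<theta>))\<^sup>2) = 2 * ln \<bar>poly P (b * cos \<theta>)\<bar>"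
          using p ln_realpow[of "\<bar>poly P (b * cos \<theta>)\<bar>" 2] by simp
        have "y \<theta> = (b * sin \<theta>) * ((poly P (b * cos \<theta>))\<^sup>2 * exp (- (2 * Q (b * cos \<theta>))))"
          by (simp add: y_def F_def exp_double[symmetric])
        also have "ln \<dots> = ln b + ln (sin \<theta>) + (ln ((poly P (b * cos \<theta>))\<^sup>2) - 2 * Q (b * cos \<theta>))"
          using s p b by (simp add: ln_mult_pos)
        also note sq
        finally show ?thesis .
      qed
      moreover have "ln (y \<theta> / S) \<le> y \<theta> / S - 1" using yp S by (intro ln_le_minus_one) auto
      moreover have "ln (y \<theta> / S) = ln (y \<theta>) - ln S" using yp S by (intro ln_divide_pos) auto
      ultimately show ?thesis using False unfolding rhs_def by simp
    qed simp
  qed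
  \<comment> \<open>The integral of y / S - 1 is nonpositive: y / S contributes at most 1, the
    constant contributes pi.\<close>
  moreover have "integral {-b..b} F / S \<le> 1" using yS S by simp
  then have "integral {-b..b} F / S \<le> pi" using pi_ge_two by linarith
  moreover have "- (2 * pi * ln 2) \<le> log_mean 1 + log_mean (-1)"
    using log_mean_ge_green[of 1] log_mean_ge_green[of "-1"] by (simp add: green_def ln_div)
  moreover have "pi * ln b = pi * ln (b / 2) + pi * ln 2" using b by (simp add: ln_div algebra_simps)
  ultimately show ?thesis by (simp add: field_simps)
qed

section \<open>Even external fields\<close>

text \<open>\<open>s * mrs_density Q s\<close> is the number \<open>n\<close> (not necessarily an integer) with \<open>a\<^sub>n = s\<close>.\<close>
definition mrs_density :: "(real \<Rightarrow> real) \<Rightarrow> real \<Rightarrow> real" where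
  "mrs_density Q s = 2 / pi * integral {0..pi/2} (\<lambda>\<theta>. sin \<theta> * deriv Q (s * sin \<theta>))"

text \<open>For even \<open>Q\<close>, its mean over the arcsine law of [-b, b], folded to a quarter
  period. Its derivative in b is \<open>mrs_density Q b\<close>.\<close>

definition arcsine_mean :: "(real \<Rightarrow> real) \<Rightarrow> real \<Rightarrow> real" where
  "arcsine_mean Q b = 2 / pi * integral {0..pi/2} (\<lambda>\<theta>. Q (b * sin \<theta>))"

text \<open>The substitution t = sin theta removes the endpoint singularity of the defining
  integral.\<close>

lemma MRS_number_imp_density:
  assumes cont: "continuous_on UNIV (deriv Q)" and nonneg: "\<And>x. x \<ge> 0 \<Longrightarrow> deriv Q x \<ge> 0"
    and mrs: "MRS_number Q n s"
  shows "s * mrs_density Q s = real n"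
proof -
  have s: "s > 0" using mrs by (simp add: MRS_number_def)
  define f where "f t = s * t * deriv Q (s * t) / sqrt (1 - t\<^sup>2)" for t
  define h where "h \<theta> = s * (sin \<theta> * deriv Q (s * sin \<theta>))" for \<theta>
  have cont_h: "continuous_on UNIV h" unfolding h_def
    by (intro continuous_intros continuous_on_compose2[OF cont]) auto
  have fg: "f (sin x) * cos x = h x" if "0 < x" "x < pi/2" for x
  proof -
    have "cos x > 0" using that by (intro cos_gt_zero) auto
    then have "sqrt (1 - (sin x)\<^sup>2) = cos x" by (simp add: cos_squared_eq[symmetric])
    then show ?thesis using \<open>cos x > 0\<close> by (simp add: f_def h_def)
  qed
  have int_h: "set_integrable lborel {0..pi/2} h"
    using cont_h unfolding set_integrable_def
    by (intro borel_integrable_compact) (auto intro: continuous_on_subset)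
  have "(LBINT t=0..1. f t) = (LBINT x=ereal 0..ereal (pi/2). f (sin x) * cos x)"
  proof (rule interval_integral_substitution_nonneg(2))
    show "isCont f (sin x)" if "ereal 0 < ereal x" "ereal x < ereal (pi/2)" for x
    proof -
      have x: "0 < x" "x < pi/2" using that by auto
      have "cos x > 0" using x by (intro cos_gt_zero) auto
      then have "(sin x)\<^sup>2 < 1" using sin_cos_squared_add[of x] by (smt (verit) zero_less_power)
      then have "sqrt (1 - (sin x)\<^sup>2) \<noteq> 0" by simp
      moreover have "isCont (\<lambda>t. deriv Q (s * t)) (sin x)"
        by (rule continuous_on_interior[of UNIV])
           (auto intro!: continuous_on_compose2[OF cont] continuous_intros)
      ultimately show ?thesis unfolding f_def by (intro continuous_intros) auto
    qed
    show "0 \<le> f (sin x)" if "ereal 0 < ereal x" "ereal x < ereal (pi/2)" for x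
    proof -
      have "0 \<le> sin x" using that by (intro sin_ge_zero) auto
      then show ?thesis unfolding f_def using s nonneg by (auto intro!: divide_nonneg_nonneg mult_nonneg_nonneg simp: abs_square_le_1)
    qed
    show "0 \<le> cos x" if "ereal 0 \<le> ereal x" "ereal x \<le> ereal (pi/2)" for x
      using that by (intro cos_ge_zero) auto
    show "((ereal \<circ> sin \<circ> real_of_ereal) \<longlongrightarrow> 0) (at_right (ereal 0))"
      unfolding ereal_tendsto_simps zero_ereal_def
      by (intro tendsto_eq_intros) (auto intro: tendsto_eq_intros simp: zero_ereal_def)
    show "((ereal \<circ> sin \<circ> real_of_ereal) \<longlongrightarrow> 1) (at_left (ereal (pi/2)))"
    proof -
      have "(sin \<longlongrightarrow> sin (pi/2)) (at_left (pi/2))" by (intro tendsto_intros)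
      then show ?thesis unfolding ereal_tendsto_simps one_ereal_def by simp
    qed
    have "set_integrable lborel {0<..<pi/2} h"
      by (rule set_integrable_subset[OF int_h]) auto
    then show "set_integrable lborel (einterval (ereal 0) (ereal (pi/2))) (\<lambda>x. f (sin x) * cos x)"
      by (subst set_integrable_cong[where f' = h, OF refl refl]) (auto simp: fg einterval_eq)
  qed (auto intro!: derivative_eq_intros)
  also have "\<dots> = (LBINT x=ereal 0..ereal (pi/2). h x)"
    by (rule interval_integral_cong) (auto simp: fg min_def max_def split: if_splits)
  also have "\<dots> = integral {0..pi/2} h"
    by (rule interval_integral_eq_integral[OF _ int_h]) simp
  finally have "real n = 2 / pi * integral {0..pi/2} h"
    using mrs by (simp add: MRS_number_def f_def)
  also have "integral {0..pi/2} h = s * integral {0..pi/2} (\<lambda>\<theta>. sin \<theta> * deriv Q (s * sin \<theta>))"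
    unfolding h_def by (rule integral_mult_right)
  finally show ?thesis by (simp add: mrs_density_def)
qed

lemma ln_green_divide:
  assumes "0 < u" "u \<le> x"
  shows "ln (green (x / u)) = ln ((1 + sqrt (1 - (u / x)\<^sup>2)) / (u / x))"
proof (cases "u = x")
  case True
  then show ?thesis using assms by (simp add: green_def)
next
  case False
  define v where "v = u / x"
  have v: "0 < v" "v < 1" using assms False by (auto simp: v_def)
  have "green (x / u) = 1 / v + sqrt ((1 / v)\<^sup>2 - 1)"
    using v assms False unfolding green_def by (simp add: v_def)
  also have "sqrt ((1 / v)\<^sup>2 - 1) = sqrt ((1 - v\<^sup>2) / v\<^sup>2)"
    using v by (simp add: field_simps)
  also have "\<dots> = sqrt (1 - v\<^sup>2) / v"
    using v by (simp add: real_sqrt_divide)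
  also have "1 / v + sqrt (1 - v\<^sup>2) / v = (1 + sqrt (1 - v\<^sup>2)) / v"
    by (simp add: add_divide_distrib)
  finally show ?thesis by (simp add: v_def)
qed

locale external_field =
  fixes Q :: "real \<Rightarrow> real" and a :: "nat \<Rightarrow> real"
  assumes Q_differentiable: "\<And>x. Q differentiable (at x)"
    and cont_deriv_Q: "continuous_on UNIV (deriv Q)"
    and mono_deriv_Q: "mono (deriv Q)"
    and Q_nonneg: "\<And>x. 0 \<le> Q x"
    and Q_0: "Q 0 = 0"
    and Q_even: "\<And>x. Q (- x) = Q x"
    and a_MRS: "\<And>n. n \<ge> 1 \<Longrightarrow> MRS_number Q n (a n)"
begin

section \<open>Convexity of the field and growth of the numbers a n\<close>

lemma Q_DERIV: "(Q has_real_derivative deriv Q x) (at x within S)"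
  using Q_differentiable[of x] by (simp add: DERIV_deriv_iff_real_differentiable has_field_derivative_at_within)

lemma cont_Q: "continuous_on S Q"
  using Q_DERIV by (intro continuous_at_imp_continuous_on ballI DERIV_isCont)

lemma deriv_Q_0: "deriv Q 0 = 0"
  by (rule DERIV_local_min[OF Q_DERIV, of 1]) (auto simp: Q_nonneg Q_0)

lemma deriv_Q_nonneg: "0 \<le> x \<Longrightarrow> 0 \<le> deriv Q x"
  using monoD[OF mono_deriv_Q, of 0 x] deriv_Q_0 by simp

lemma Q_diff_le:
  assumes "x \<le> y"
  shows "Q y - Q x \<le> (y - x) * deriv Q y"
proof (cases "x = y")
  case False
  then have "x < y" using assms by simp
  from MVT2[OF this, of Q "deriv Q"] Q_DERIV obtain z where z: "z < y" "Q y - Q x = (y - x) * deriv Q z"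
    by blast
  then show ?thesis
    using monoD[OF mono_deriv_Q, of z y] assms by (auto intro!: mult_left_mono)
qed simp

lemma density_integrand_continuous: "continuous_on A (\<lambda>\<theta>. sin \<theta> * deriv Q (s * sin \<theta>))"
  by (intro continuous_intros continuous_on_compose2[OF cont_deriv_Q]) auto

lemma mrs_density_mono:
  assumes "0 \<le> s" "s \<le> t"
  shows "mrs_density Q s \<le> mrs_density Q t"
proof -
  have "integral {0..pi/2} (\<lambda>\<theta>. sin \<theta> * deriv Q (s * sin \<theta>)) \<le> integral {0..pi/2} (\<lambda>\<theta>. sin \<theta> * deriv Q (t * sin \<theta>))"
  proof (rule integral_le)
    fix \<theta> :: real assume "\<theta> \<in> {0..pi/2}"
    then have "sin \<theta> \<ge> 0" by (intro sin_ge_zero) auto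
    then show "sin \<theta> * deriv Q (s * sin \<theta>) \<le> sin \<theta> * deriv Q (t * sin \<theta>)"
      using assms by (intro mult_left_mono monoD[OF mono_deriv_Q] mult_right_mono)
  qed (intro integrable_continuous_real density_integrand_continuous)+
  then show ?thesis by (simp add: mrs_density_def divide_right_mono)
qed

lemma mrs_density_0: "mrs_density Q 0 = 0"
  by (simp add: mrs_density_def deriv_Q_0)

lemma mrs_density_nonneg: "0 \<le> s \<Longrightarrow> 0 \<le> mrs_density Q s"
  using mrs_density_mono[of 0 s] mrs_density_0 by simp

lemma a_pos: "n \<ge> 1 \<Longrightarrow> 0 < a n"
  using a_MRS by (simp add: MRS_number_def)

lemma a_density: "n \<ge> 1 \<Longrightarrow> a n * mrs_density Q (a n) = real n"
  using MRS_number_imp_density[OF cont_deriv_Q deriv_Q_nonneg a_MRS] by blast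

text \<open>The function s * mrs_density Q s is nondecreasing. Applied to the largest n with a n <=
  s, this bounds the number of the \<open>a i\<close> up to s.\<close>

lemma a_density_ge:
  assumes "n \<ge> 1" "a n \<le> s"
  shows "real n \<le> s * mrs_density Q s"
proof -
  have "0 < a n" by (rule a_pos[OF assms(1)])
  then have "a n * mrs_density Q (a n) \<le> s * mrs_density Q s"
    using assms by (intro mult_mono mrs_density_mono mrs_density_nonneg) auto
  then show ?thesis using a_density[OF assms(1)] by simp
qed

lemma a_mono:
  assumes "1 \<le> j" "j \<le> k"
  shows "a j \<le> a k"
proof (rule ccontr)
  assume "\<not> a j \<le> a k"
  then have less: "a k < a j" by simp
  have "mrs_density Q (a j) > 0"
    using a_density[of j] a_pos[of j] assms by (smt (verit) mult_nonneg_nonpos of_nat_1 of_nat_mono)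
  have "real k = a k * mrs_density Q (a k)" using a_density[of k] assms by simp
  also have "\<dots> \<le> a k * mrs_density Q (a j)"
    using less a_pos[of k] assms by (intro mult_left_mono mrs_density_mono) auto
  also have "\<dots> < a j * mrs_density Q (a j)" using less \<open>mrs_density Q (a j) > 0\<close> by simp
  also have "\<dots> = real j" using a_density[of j] assms by simp
  finally show False using assms by simp
qed

text \<open>The quotient a n / n = 1 / mrs_density Q (a n) is nonincreasing in n, because the
  density is nondecreasing. All growth information on \<open>a n\<close> comes from here.\<close>

lemma a_ratio:
  assumes "1 \<le> j" "j \<le> k"
  shows "a k * real j \<le> a j * real k"
proof -
  have "a k * real j = a k * (a j * mrs_density Q (a j))" using a_density[of j] assms by simp
  also have "\<dots> \<le> a k * (a j * mrs_density Q (a k))"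
    using a_mono[OF assms] a_pos[of j] a_pos[of k] assms by (intro mult_left_mono mrs_density_mono) auto
  also have "\<dots> = a j * real k" using a_density[of k] assms by (simp add: mult_ac)
  finally show ?thesis .
qed

lemma ln_a_ratio:
  assumes "1 \<le> j" "j \<le> k"
  shows "ln (a k) - ln (a j) \<le> ln (real k / real j)"
proof -
  have "a k / a j \<le> real k / real j"
    using a_ratio[OF assms] a_pos[of j] assms by (simp add: field_simps)
  then have "ln (a k / a j) \<le> ln (real k / real j)"
    using a_pos[of j] a_pos[of k] assms by (intro ln_mono) auto
  then show ?thesis using a_pos[of j] a_pos[of k] assms by (simp add: ln_div)
qed

text \<open>By \<open>hat_box\<close>, Q x is the integral of x * mrs_density Q (x sin psi). With s
  = x sin psi the integrand is (s * mrs_density Q s) / sin psi, whose numerator is at least the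
  number of i with a i <= s; and 1 / sin psi, integrated over sin psi >= a i / x, gives ln (green (x
  / a i)).\<close>

lemma Q_ge_sum_ln_green: "(\<Sum>i=1..D. ln (green (x / a i))) \<le> Q x"
proof -
  have *: "(\<Sum>i=1..D. ln (green (x / a i))) \<le> Q x" if x: "x > 0" for x
  proof -
    \<comment> \<open>Terms with a i >= x vanish; the strict inequality keeps a i / x in the open
      interval that \<open>integral_inverse_sin\<close> requires.\<close>
    define I where "I = {i \<in> {1..D}. a i < x}"
    have I: "finite I" "\<And>i. i \<in> I \<Longrightarrow> 1 \<le> i \<and> 0 < a i \<and> a i < x"
      using a_pos by (auto simp: I_def)
    have Qx: "((\<lambda>\<psi>. x * mrs_density Q (x * sin \<psi>)) has_integral Q x) {0..pi/2}"
    proof -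
      have "continuous_on {0..1} (\<lambda>t. deriv Q (x * t))"
        by (intro continuous_on_compose2[OF cont_deriv_Q] continuous_intros) auto
      from hat_box[OF this]
      have "((\<lambda>\<psi>. (x * (2 / pi)) * integral {0..pi/2} (\<lambda>\<theta>. sin \<theta> * deriv Q (x * (sin \<psi> * sin \<theta>)))) has_integral
          (x * (2 / pi)) * (pi / 2 * integral {0..1} (\<lambda>t. deriv Q (x * t)))) {0..pi/2}"
        by (rule has_integral_mult_right)
      moreover have "((\<lambda>t. x * deriv Q (x * t)) has_integral (Q (x * 1) - Q (x * 0))) {0..1}"
      proof (rule fundamental_theorem_of_calculus)
        show "((\<lambda>t. Q (x * t)) has_vector_derivative x * deriv Q (x * t)) (at t within {0..1})" for t
        proof -
          have "((\<lambda>t. x * t) has_real_derivative x) (at t within {0..1})"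
            by (auto intro!: derivative_eq_intros)
          from DERIV_chain2[where f = Q and g = "\<lambda>t. x * t", OF Q_DERIV this] show ?thesis
            by (simp add: mult.commute flip: has_real_derivative_iff_has_vector_derivative)
        qed
      qed simp
      then have "integral {0..1} (\<lambda>t. x * deriv Q (x * t)) = Q (x * 1) - Q (x * 0)"
        by (rule integral_unique)
      then have "x * integral {0..1} (\<lambda>t. deriv Q (x * t)) = Q x"
        unfolding integral_mult_right by (simp add: Q_0)
      ultimately show ?thesis by (simp add: mrs_density_def mult_ac)
    qed
    have sum: "((\<lambda>\<psi>. \<Sum>i\<in>I. if a i / x \<le> sin \<psi> then 1 / sin \<psi> else 0) has_integral (\<Sum>i\<in>I. ln (green (x / a i)))) {0..pi/2}"
    proof (rule has_integral_sum[OF I(1)])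
      fix i assume "i \<in> I"
      then have "0 < a i" "a i < x" using I by auto
      then show "((\<lambda>\<psi>. if a i / x \<le> sin \<psi> then 1 / sin \<psi> else 0) has_integral ln (green (x / a i))) {0..pi/2}"
        using integral_inverse_sin[of "a i / x"] by (subst ln_green_divide) auto
    qed
    have "(\<Sum>i\<in>I. ln (green (x / a i))) \<le> Q x"
    proof (rule has_integral_le[OF sum Qx])
      fix \<psi> :: real assume \<psi>: "\<psi> \<in> {0..pi/2}"
      then have s0: "sin \<psi> \<ge> 0" by (intro sin_ge_zero) auto
      define s where "s = x * sin \<psi>"
      define J where "J = {i \<in> I. a i / x \<le> sin \<psi>}"
      have J: "finite J" "\<And>i. i \<in> J \<Longrightarrow> 1 \<le> i \<and> a i \<le> s"
        using I x by (auto simp: J_def s_def field_simps)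
      have count: "real (card J) \<le> s * mrs_density Q s"
      proof (cases "J = {}")
        case True
        then show ?thesis using s0 x mrs_density_nonneg by (simp add: s_def)
      next
        case False
        have "J \<subseteq> {1..Max J}" using J by auto
        then have "card J \<le> Max J" using card_mono[of "{1..Max J}" J] by simp
        also have "real (Max J) \<le> s * mrs_density Q s"
          using J(2)[of "Max J"] Max_in[OF J(1) False] by (intro a_density_ge) auto
        finally show ?thesis by simp
      qed
      have "(\<Sum>i\<in>I. if a i / x \<le> sin \<psi> then 1 / sin \<psi> else 0) = real (card J) / sin \<psi>"
        using I(1) by (simp add: J_def sum.If_cases Int_def)
      also have "\<dots> \<le> x * mrs_density Q (x * sin \<psi>)"
      proof (cases "sin \<psi> = 0")
        case True
        then show ?thesis by (simp add: mrs_density_0)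
      next
        case False
        then show ?thesis using count s0 by (simp add: s_def field_simps)
      qed
      finally show "(\<Sum>i\<in>I. if a i / x \<le> sin \<psi> then 1 / sin \<psi> else 0) \<le> x * mrs_density Q (x * sin \<psi>)" .
    qed
    also have "(\<Sum>i\<in>I. ln (green (x / a i))) = (\<Sum>i=1..D. ln (green (x / a i)))"
    proof (rule sum.mono_neutral_left)
      show "\<forall>i\<in>{1..D} - I. ln (green (x / a i)) = 0"
      proof
        fix i assume i: "i \<in> {1..D} - I"
        then have "0 < a i" "x \<le> a i" using a_pos[of i] by (auto simp: I_def)
        then have "\<bar>x / a i\<bar> \<le> 1" using x by simp
        then show "ln (green (x / a i)) = 0" by (simp add: green_def)
      qed
    qed (auto simp: I_def)
    finally show ?thesis .
  qed
  consider "x > 0" | "x = 0" | "- x > 0" by linarith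
  then show ?thesis
  proof cases
    case 3
    from *[OF this] show ?thesis by (simp add: Q_even)
  qed (use * in \<open>auto simp: Q_0 green_def\<close>)
qed

section \<open>Growth of the arcsine mean\<close>

lemma arcsine_mean_integrable: "(\<lambda>\<theta>. Q (b * sin \<theta>)) integrable_on {0..pi/2}"
  by (intro integrable_continuous_real continuous_on_compose2[OF cont_Q[of UNIV]] continuous_intros) auto

lemma arcsine_mean_diff:
  assumes "0 \<le> b'" "b' \<le> b"
  shows "arcsine_mean Q b - arcsine_mean Q b' \<le> (b - b') * mrs_density Q b"
proof -
  have "integral {0..pi/2} (\<lambda>\<theta>. Q (b * sin \<theta>)) - integral {0..pi/2} (\<lambda>\<theta>. Q (b' * sin \<theta>))
    = integral {0..pi/2} (\<lambda>\<theta>. Q (b * sin \<theta>) - Q (b' * sin \<theta>))"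
    by (rule integral_diff[OF arcsine_mean_integrable arcsine_mean_integrable, symmetric])
  also have "\<dots> \<le> integral {0..pi/2} (\<lambda>\<theta>. (b - b') * (sin \<theta> * deriv Q (b * sin \<theta>)))"
  proof (rule integral_le)
    fix \<theta> :: real assume "\<theta> \<in> {0..pi/2}"
    then have "sin \<theta> \<ge> 0" by (intro sin_ge_zero) auto
    then have "Q (b * sin \<theta>) - Q (b' * sin \<theta>) \<le> (b * sin \<theta> - b' * sin \<theta>) * deriv Q (b * sin \<theta>)"
      using assms by (intro Q_diff_le mult_right_mono)
    then show "Q (b * sin \<theta>) - Q (b' * sin \<theta>) \<le> (b - b') * (sin \<theta> * deriv Q (b * sin \<theta>))"
      by (simp add: algebra_simps)
  qed (intro integrable_diff arcsine_mean_integrable integrable_continuous_real continuous_intros density_integrand_continuous)+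
  also have "\<dots> = (b - b') * integral {0..pi/2} (\<lambda>\<theta>. sin \<theta> * deriv Q (b * sin \<theta>))"
    by (rule integral_mult_right)
  finally have "2 / pi * (integral {0..pi/2} (\<lambda>\<theta>. Q (b * sin \<theta>)) - integral {0..pi/2} (\<lambda>\<theta>. Q (b' * sin \<theta>)))
      \<le> 2 / pi * ((b - b') * integral {0..pi/2} (\<lambda>\<theta>. sin \<theta> * deriv Q (b * sin \<theta>)))"
    by (intro mult_left_mono) auto
  then show ?thesis
    unfolding arcsine_mean_def mrs_density_def by (simp add: right_diff_distrib mult_ac)
qed

lemma arcsine_mean_mono:
  assumes "0 \<le> b'" "b' \<le> b"
  shows "arcsine_mean Q b' \<le> arcsine_mean Q b"
proof -
  have Qmono: "Q x \<le> Q y" if "0 \<le> x" "x \<le> y" for x y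
    using that deriv_Q_nonneg by (intro DERIV_nonneg_imp_nondecreasing[OF that(2)]) (meson Q_DERIV order_trans)
  have "integral {0..pi/2} (\<lambda>\<theta>. Q (b' * sin \<theta>)) \<le> integral {0..pi/2} (\<lambda>\<theta>. Q (b * sin \<theta>))"
  proof (rule integral_le)
    fix \<theta> :: real assume "\<theta> \<in> {0..pi/2}"
    then have "sin \<theta> \<ge> 0" by (intro sin_ge_zero) auto
    then show "Q (b' * sin \<theta>) \<le> Q (b * sin \<theta>)"
      using assms by (intro Qmono mult_nonneg_nonneg mult_right_mono)
  qed (rule arcsine_mean_integrable)+
  then show ?thesis by (simp add: arcsine_mean_def divide_right_mono)
qed

text \<open>1 - b' / b <= ln (b / b') makes the increment logarithmic; its factor b * mrs_density Q
  b equals n at b = a n.\<close>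

lemma arcsine_mean_diff_ln:
  assumes "0 < b'" "b' \<le> b"
  shows "arcsine_mean Q b - arcsine_mean Q b' \<le> (b * mrs_density Q b) * (ln b - ln b')"
proof -
  have "1 - b' / b \<le> ln b - ln b'"
    using ln_le_minus_one[of "b' / b"] assms by (simp add: ln_div)
  then have "(1 - b' / b) * (b * mrs_density Q b) \<le> (ln b - ln b') * (b * mrs_density Q b)"
    using mrs_density_nonneg[of b] assms by (intro mult_right_mono) auto
  moreover have "(1 - b' / b) * (b * mrs_density Q b) = (b - b') * mrs_density Q b"
    using assms by (simp add: field_simps)
  ultimately show ?thesis
    using arcsine_mean_diff[of b' b] assms by (simp add: mult.commute)
qed

text \<open>Summation by parts: from a d to a (d + 1) the mean grows by at most (d + 1) (ln (a (d +
  1)) - ln (a d)). The sum on the left is the one that bounds the leading coefficient in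
  \<open>neg_ln_\<gamma>_le\<close>.\<close>

lemma arcsine_mean_a_le:
  assumes "d \<ge> 1"
  shows "arcsine_mean Q (a d) + (\<Sum>i=1..d. ln (a i)) \<le> 1 + (real d + 1) * ln (a d) - ln (a 1)"
  using assms
proof (induction d rule: dec_induct)
  case base
  have "arcsine_mean Q (a 1) \<le> 1"
    using arcsine_mean_diff[of 0 "a 1"] a_pos[of 1] a_density[of 1] by (simp add: arcsine_mean_def Q_0)
  then show ?case by simp
next
  case (step d)
  have "arcsine_mean Q (a (Suc d)) - arcsine_mean Q (a d) \<le> (a (Suc d) * mrs_density Q (a (Suc d))) * (ln (a (Suc d)) - ln (a d))"
    using step.hyps a_mono[of d "Suc d"] a_pos[of d] by (intro arcsine_mean_diff_ln) auto
  also have "a (Suc d) * mrs_density Q (a (Suc d)) = real d + 1"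
    using a_density[of "Suc d"] by simp
  finally show ?case using step.IH by (simp add: algebra_simps)
qed

lemma integral_Q_cos: "integral {0..pi} (\<lambda>\<theta>. Q (b * cos \<theta>)) = pi * arcsine_mean Q b"
proof -
  define I where "I = integral {0..pi/2} (\<lambda>\<theta>. Q (b * sin \<theta>))"
  have r: "((\<lambda>\<theta>. Q (b * sin \<theta>)) has_integral I) {0..pi/2}"
    unfolding I_def by (rule integrable_integral[OF arcsine_mean_integrable])
  then have "((\<lambda>\<theta>. Q (b * sin (- \<theta>))) has_integral I) {-(pi/2)..-0}"
    using has_integral_reflect_real[of "\<lambda>\<theta>. Q (b * sin \<theta>)" I "pi/2" 0] by blast
  then have l: "((\<lambda>\<theta>. Q (b * sin \<theta>)) has_integral I) {-(pi/2)..0}" by (simp add: Q_even)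
  have lr: "((\<lambda>\<theta>. Q (b * sin \<theta>)) has_integral I + I) (cbox (-(pi/2)) (pi/2))"
    using has_integral_combine[OF _ _ l r] by simp
  have "((\<lambda>\<theta>. Q (b * sin (1 *\<^sub>R \<theta> + (- (pi/2))))) has_integral (I + I) /\<^sub>R 1 ^ DIM(real))
      (cbox ((-(pi/2) - (- (pi/2))) /\<^sub>R 1) ((pi/2 - (- (pi/2))) /\<^sub>R 1))"
    by (rule has_integral_affinity'[OF lr]) simp
  moreover have "Q (b * sin (1 *\<^sub>R \<theta> + (- (pi/2)))) = Q (b * cos \<theta>)" for \<theta>
  proof -
    have "sin (1 *\<^sub>R \<theta> + (- (pi/2))) = - cos \<theta>" by (simp add: sin_diff)
    then show ?thesis using Q_even[of "b * cos \<theta>"] by simp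
  qed
  ultimately have "((\<lambda>\<theta>. Q (b * cos \<theta>)) has_integral 2 * I) {0..pi}" by simp
  then show ?thesis by (simp add: integral_unique arcsine_mean_def I_def)
qed

end

section \<open>Leading coefficients of orthonormal polynomials\<close>

fun cheb :: "nat \<Rightarrow> real poly" where
  "cheb 0 = 1"
| "cheb (Suc 0) = [:0, 1:]"
| "cheb (Suc (Suc n)) = [:0, 2:] * cheb (Suc n) - cheb n"

lemma degree_cheb_le: "degree (cheb n) \<le> n"
proof (induction n rule: cheb.induct)
  case (3 n)
  have "degree ([:0, 2:] * cheb (Suc n)) \<le> Suc (Suc n)"
    using 3 by (intro order_trans[OF degree_mult_le]) auto
  with 3 show ?case by (auto intro!: degree_diff_le)
qed auto

lemma coeff_cheb: "coeff (cheb (Suc n)) (Suc n) = 2 ^ n"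
proof (induction n)
  case (Suc n)
  have "coeff (cheb n) (Suc (Suc n)) = 0"
    by (intro coeff_eq_0 le_less_trans[OF degree_cheb_le]) simp
  with Suc show ?case by simp
qed auto

lemma poly_cheb_cos: "poly (cheb n) (cos \<phi>) = cos (real n * \<phi>)"
proof (induction n rule: cheb.induct)
  case (3 n)
  have "cos (real (Suc (Suc n)) * \<phi>) + cos (real n * \<phi>) = 2 * cos \<phi> * cos (real (Suc n) * \<phi>)"
    using cos_plus_cos[of "real (Suc (Suc n)) * \<phi>" "real n * \<phi>"] by (simp add: algebra_simps add_divide_distrib)
  with 3 show ?case by (simp add: algebra_simps)
qed auto

lemma poly_cheb_joukowski:
  assumes "w \<noteq> 0"
  shows "poly (cheb n) ((w + 1 / w) / 2) = (w ^ n + 1 / w ^ n) / 2"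
proof (induction n rule: cheb.induct)
  case (3 n)
  have "poly (cheb (Suc (Suc n))) ((w + 1 / w) / 2)
    = (w + 1 / w) * ((w ^ Suc n + 1 / w ^ Suc n) / 2) - (w ^ n + 1 / w ^ n) / 2"
    unfolding 3[symmetric] by (simp add: algebra_simps)
  also have "\<dots> = (w ^ Suc (Suc n) + 1 / w ^ Suc (Suc n)) / 2"
    using assms by (simp add: field_simps)
  finally show ?case .
qed (use assms in auto)

text \<open>On [-1, 1] the value is a cosine. Outside, it is (w ^ n + 1 / w ^ n) / 2 with |w| =
  green t, an average whose second term is at most 1 in modulus.\<close>

lemma abs_poly_cheb_le: "\<bar>poly (cheb n) t\<bar> \<le> green t ^ n"
proof (cases "\<bar>t\<bar> \<le> 1")
  case True
  then have "poly (cheb n) t = cos (real n * arccos t)"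
    using poly_cheb_cos[of n "arccos t"] by (simp add: abs_le_iff)
  then show ?thesis using True by (simp add: green_def)
next
  case False
  \<comment> \<open>The solution of (w + 1 / w) / 2 = t with modulus green t, so it has the sign of
    t.\<close>
  define w where "w = sgn t * green t"
  have g: "green t > 0" "green t = \<bar>t\<bar> + sqrt (t\<^sup>2 - 1)"
    using False green_pos[of t] by (simp_all add: green_def)
  have w: "w \<noteq> 0" "\<bar>w\<bar> = green t" using False g by (auto simp: w_def abs_mult sgn_if)
  have t2: "t\<^sup>2 \<ge> 1" using False abs_square_le_1[of t] by linarith
  have "green t * (\<bar>t\<bar> - sqrt (t\<^sup>2 - 1)) = 1"
    unfolding g using t2 by (simp add: algebra_simps power2_eq_square)
  then have "1 / green t = \<bar>t\<bar> - sqrt (t\<^sup>2 - 1)" using g(1) by (simp add: field_simps)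
  then have "green t + 1 / green t = 2 * \<bar>t\<bar>" using g(2) by simp
  then have t: "t = (w + 1 / w) / 2"
    using False by (cases "t > 0") (auto simp: w_def sgn_if)
  have "\<bar>poly (cheb n) t\<bar> = \<bar>w ^ n + 1 / w ^ n\<bar> / 2"
    unfolding t poly_cheb_joukowski[OF w(1)] by simp
  also have "\<dots> \<le> (\<bar>w ^ n\<bar> + \<bar>1 / w ^ n\<bar>) / 2" by (intro divide_right_mono abs_triangle_ineq) simp
  also have "\<bar>w ^ n\<bar> = green t ^ n" by (simp add: power_abs w)
  also have "\<bar>1 / w ^ n\<bar> = 1 / green t ^ n" by (simp add: power_abs w)
  also have "1 / green t ^ n \<le> green t ^ n"
  proof -
    have "1 \<le> green t ^ n" by (rule one_le_power[OF green_ge_1])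
    then have "1 / green t ^ n \<le> 1" using g(1) by (simp add: divide_le_eq)
    with \<open>1 \<le> green t ^ n\<close> show ?thesis by linarith
  qed
  finally show ?thesis by simp
qed

text \<open>For m >= 1 the scaled Chebyshev polynomial has leading coefficient 2 ^ (m - 1) / u ^ m,
  the inverse of the prefactor.\<close>

definition monic_cheb :: "nat \<Rightarrow> real \<Rightarrow> real poly" where
  "monic_cheb m u = smult (2 * (u / 2) ^ m) (pcompose (cheb m) [:0, 1 / u:])"

lemma degree_monic_cheb_le: "degree (monic_cheb m u) \<le> m"
  unfolding monic_cheb_def
  by (rule order_trans[OF degree_smult_le order_trans[OF degree_pcompose_le]])
     (use degree_cheb_le[of m] in \<open>auto split: if_splits\<close>)

lemma coeff_monic_cheb: "m \<ge> 1 \<Longrightarrow> u > 0 \<Longrightarrow> coeff (monic_cheb m u) m = 1"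
  by (cases m) (auto simp: monic_cheb_def coeff_pcompose_linear coeff_cheb power_divide)

lemma abs_poly_monic_cheb_le:
  "u > 0 \<Longrightarrow> \<bar>poly (monic_cheb m u) x\<bar> \<le> 2 * (u / 2) ^ m * green (x / u) ^ m"
  using abs_poly_cheb_le[of m "x / u"]
  by (simp add: monic_cheb_def poly_pcompose abs_mult mult_left_mono)

section \<open>Top coefficients of products, and sums over blocks of indices\<close>

lemma coeff_mult_top:
  fixes p q :: "'a::comm_semiring_1 poly"
  assumes "degree p \<le> m" "degree q \<le> n"
  shows "coeff (p * q) (m + n) = coeff p m * coeff q n"
proof -
  have "coeff (p * q) (m + n) = (\<Sum>i\<le>m + n. coeff p i * coeff q (m + n - i))" by (rule coeff_mult)
  also have "\<dots> = (\<Sum>i\<in>{m}. coeff p i * coeff q (m + n - i))"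
  proof (rule sum.mono_neutral_right)
    show "\<forall>i\<in>{..m + n} - {m}. coeff p i * coeff q (m + n - i) = 0"
    proof
      fix i assume "i \<in> {..m + n} - {m}"
      then consider "i > m" | "m + n - i > n" by fastforce
      then show "coeff p i * coeff q (m + n - i) = 0"
        using assms by cases (auto simp: coeff_eq_0)
    qed
  qed auto
  finally show ?thesis by simp
qed

lemma coeff_prod_top:
  fixes f :: "'b \<Rightarrow> 'a::comm_semiring_1 poly"
  assumes "finite K" "\<And>k. k \<in> K \<Longrightarrow> degree (f k) \<le> m"
  shows "degree (\<Prod>k\<in>K. f k) \<le> m * card K \<and> coeff (\<Prod>k\<in>K. f k) (m * card K) = (\<Prod>k\<in>K. coeff (f k) m)"
  using assms
proof (induction rule: finite_induct)
  case (insert k K)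
  have "degree (f k * (\<Prod>k\<in>K. f k)) \<le> m + m * card K"
    using insert by (intro order_trans[OF degree_mult_le] add_mono) auto
  moreover have "coeff (f k * (\<Prod>k\<in>K. f k)) (m + m * card K) = coeff (f k) m * (\<Prod>k\<in>K. coeff (f k) m)"
    using insert by (subst coeff_mult_top) auto
  ultimately show ?case using insert by simp
qed simp

lemma sum_antimono_block:
  fixes f :: "nat \<Rightarrow> real"
  assumes "\<And>i j. 1 \<le> i \<Longrightarrow> i \<le> j \<Longrightarrow> f j \<le> f i"
  shows "real m * (\<Sum>k=1..K. f (k * m)) \<le> (\<Sum>i=1..K * m. f i)"
proof (induction K)
  case (Suc K)
  have "real m * f (Suc K * m) = (\<Sum>i=K * m + 1..K * m + m. f (Suc K * m))" by simp
  also have "\<dots> \<le> (\<Sum>i=K * m + 1..K * m + m. f i)"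
    by (intro sum_mono assms) auto
  finally have "real m * f (Suc K * m) \<le> (\<Sum>i=K * m + 1..K * m + m. f i)" .
  moreover have "(\<Sum>i=1..Suc K * m. f i) = (\<Sum>i=1..K * m. f i) + (\<Sum>i=K * m + 1..K * m + m. f i)"
    using sum.ub_add_nat[of 1 "K * m" f m] by (simp add: add.commute)
  ultimately show ?case using Suc.IH by (simp add: distrib_left)
qed simp

text \<open>Right endpoints overestimate an increasing sequence, so each block is compared with the
  following one; the last block has no successor and remains as the extra term.\<close>

lemma sum_mono_block:
  fixes l :: "nat \<Rightarrow> real"
  assumes l0: "l 0 \<ge> 0" and mono: "\<And>i j. i \<le> j \<Longrightarrow> l i \<le> l j"
  shows "real m * (\<Sum>k=1..K. l (k * m)) \<le> (\<Sum>i=1..K * m. l i) + real m * l (K * m)"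
proof (induction K)
  case 0
  then show ?case using l0 by simp
next
  case (Suc K)
  have "real m * l (K * m) = (\<Sum>i=K * m + 1..K * m + m. l (K * m))" by simp
  also have "\<dots> \<le> (\<Sum>i=K * m + 1..K * m + m. l i)"
    by (intro sum_mono mono) auto
  finally have "real m * l (K * m) \<le> (\<Sum>i=K * m + 1..K * m + m. l i)" .
  moreover have "(\<Sum>i=1..Suc K * m. l i) = (\<Sum>i=1..K * m. l i) + (\<Sum>i=K * m + 1..K * m + m. l i)"
    using sum.ub_add_nat[of 1 "K * m" l m] by (simp add: add.commute)
  ultimately show ?case using Suc.IH by (simp add: distrib_left)
qed

section \<open>Expansion in orthonormal polynomials\<close>

locale orthonormal_system = external_field +
  fixes p :: "nat \<Rightarrow> real poly"
  assumes orthonormal: "orthonormal_polys Q p"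
begin

definition \<gamma> :: "nat \<Rightarrow> real" where "\<gamma> d = lead_coeff (p d)"

lemma degree_p: "degree (p d) = d" and \<gamma>_pos: "\<gamma> d > 0"
  using orthonormal unfolding orthonormal_polys_def \<gamma>_def by blast+

lemma coeff_p: "coeff (p d) d = \<gamma> d"
  using degree_p[of d] by (simp add: \<gamma>_def)

definition combination :: "(nat \<Rightarrow> real) \<Rightarrow> nat \<Rightarrow> real poly" where
  "combination c n = (\<Sum>j\<le>n. smult (c j) (p j))"

lemma degree_combination_le: "degree (combination c n) \<le> n"
  unfolding combination_def
  by (intro degree_sum_le) (auto intro: order_trans[OF degree_smult_le] simp: degree_p)

lemma poly_combination: "poly (combination c n) x = (\<Sum>j\<le>n. c j * poly (p j) x)"
  by (simp add: combination_def poly_sum)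

lemma coeff_combination_top: "coeff (combination c n) n = c n * \<gamma> n"
proof -
  have "coeff (combination c n) n = (\<Sum>j\<le>n. c j * coeff (p j) n)"
    by (simp add: combination_def coeff_sum)
  also have "\<dots> = (\<Sum>j\<in>{n}. c j * coeff (p j) n)"
    by (rule sum.mono_neutral_right) (auto simp: coeff_eq_0 degree_p)
  finally show ?thesis by (simp add: coeff_p)
qed

lemma combination_exists: "degree P \<le> n \<Longrightarrow> \<exists>c. P = combination c n"
proof (induction n arbitrary: P)
  case 0
  then obtain a where "P = [:a:]" using degree_eq_zeroE[of P] by auto
  moreover obtain b where "p 0 = [:b:]" "b \<noteq> 0"
    using degree_p[of 0] \<gamma>_pos[of 0] coeff_p[of 0] by (metis coeff_pCons_0 degree_eq_zeroE less_irrefl)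
  ultimately have "P = combination (\<lambda>_. a / b) 0" by (simp add: combination_def)
  then show ?case by blast
next
  case (Suc n)
  define e where "e = coeff P (Suc n) / \<gamma> (Suc n)"
  define R where "R = P - smult e (p (Suc n))"
  have "degree R \<le> Suc n" unfolding R_def
    by (intro degree_diff_le Suc.prems) (use degree_smult_le[of e "p (Suc n)"] in \<open>simp add: degree_p\<close>)
  moreover have "coeff R (Suc n) = 0"
    using \<gamma>_pos[of "Suc n"] by (simp add: R_def e_def coeff_p)
  ultimately have "degree R \<le> n"
    by (metis eq_zero_or_degree_less le_Suc_eq less_Suc_eq_le degree_0 le0)
  then obtain c where c: "R = combination c n" using Suc.IH by blast
  have "P = combination (c(Suc n := e)) (Suc n)"
    using c by (simp add: combination_def R_def algebra_simps)
  then show ?case by blast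
qed

lemma
  shows combination_integrable: "integrable lborel (\<lambda>x. (poly (combination c n) x)\<^sup>2 * exp (- Q x) ^ 2)"
    and combination_integral: "(\<integral>x. (poly (combination c n) x)\<^sup>2 * exp (- Q x) ^ 2 \<partial>lborel) = (\<Sum>j\<le>n. (c j)\<^sup>2)"
proof -
  have eq: "(poly (combination c n) x)\<^sup>2 * exp (- Q x) ^ 2
    = (\<Sum>i\<le>n. \<Sum>j\<le>n. (c i * c j) * (poly (p i) x * poly (p j) x * exp (- Q x) ^ 2))" for x
    unfolding poly_combination power2_eq_square[of "\<Sum>j\<le>n. c j * poly (p j) x"] sum_product
    by (simp only: sum_distrib_right) (simp only: mult_ac)
  have int: "integrable lborel (\<lambda>x. (c i * c j) * (poly (p i) x * poly (p j) x * exp (- Q x) ^ 2))" for i j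
    using orthonormal by (intro integrable_mult_right) (auto simp: orthonormal_polys_def)
  show "integrable lborel (\<lambda>x. (poly (combination c n) x)\<^sup>2 * exp (- Q x) ^ 2)"
    unfolding eq by (intro Bochner_Integration.integrable_sum int)
  have "(\<integral>x. (poly (combination c n) x)\<^sup>2 * exp (- Q x) ^ 2 \<partial>lborel)
    = (\<Sum>i\<le>n. \<Sum>j\<le>n. (c i * c j) * (if i = j then 1 else 0))"
    unfolding eq using orthonormal int
    by (simp add: Bochner_Integration.integral_sum Bochner_Integration.integrable_sum orthonormal_polys_def)
  also have "\<dots> = (\<Sum>j\<le>n. (c j)\<^sup>2)"
    by (simp add: power2_eq_square if_distrib cong: if_cong)
  finally show "(\<integral>x. (poly (combination c n) x)\<^sup>2 * exp (- Q x) ^ 2 \<partial>lborel) = (\<Sum>j\<le>n. (c j)\<^sup>2)" .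
qed

text \<open>Only the top basis polynomial contributes to coefficient \<open>d\<close>, and its
  square is one term of Parseval's sum. Any monic test polynomial of small norm thus bounds the
  leading coefficient \<open>\<gamma> d\<close> from below.\<close>

lemma extremal_leading_coeff:
  assumes "degree P \<le> d"
  shows "(coeff P d)\<^sup>2 \<le> (\<gamma> d)\<^sup>2 * (\<integral>x. (poly P x)\<^sup>2 * exp (- Q x) ^ 2 \<partial>lborel)"
proof -
  obtain c where c: "P = combination c d" using combination_exists[OF assms] by blast
  have "(coeff P d)\<^sup>2 = (\<gamma> d)\<^sup>2 * (c d)\<^sup>2"
    by (simp add: c coeff_combination_top power_mult_distrib mult.commute)
  also have "(c d)\<^sup>2 \<le> (\<Sum>j\<le>d. (c j)\<^sup>2)" by (intro member_le_sum) auto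
  finally show ?thesis by (simp add: c combination_integral mult_left_mono)
qed

text \<open>By \<open>sum_mono_block\<close> the block sum overshoots by at most m (ln (a d) - ln (a
  1)), and \<open>ln_a_ratio\<close> bounds that by m ln d.\<close>

lemma ln_a_block_sum:
  assumes m: "1 \<le> m" and d: "1 \<le> d" and K: "K * m \<le> d"
  shows "real m * (\<Sum>k=1..K. ln (a (k * m))) \<le> (\<Sum>i=1..d. ln (a i)) - real (d - K * m) * ln (a 1) + real m * ln (real d)"
proof -
  \<comment> \<open>Subtracting ln (a 1) makes the sequence nonnegative whatever the size of a 1;
    index 0 is a filler for \<open>sum_mono_block\<close>.\<close>
  define l where "l i = (if i = 0 then 0 else ln (a i) - ln (a 1))" for i
  have l_nonneg: "0 \<le> l i" for i
    using a_mono[of 1 i] a_pos[of 1] a_pos[of i] by (auto simp: l_def)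
  have l_mono: "l i \<le> l j" if "i \<le> j" for i j
    using a_mono[of i j] a_pos[of i] a_pos[of j] that l_nonneg[of j] by (auto simp: l_def)
  have "real m * (\<Sum>k=1..K. l (k * m)) \<le> (\<Sum>i=1..K * m. l i) + real m * l (K * m)"
    using l_nonneg l_mono by (intro sum_mono_block)
  also have "\<dots> \<le> (\<Sum>i=1..d. l i) + real m * l d"
    using K l_nonneg l_mono by (intro add_mono sum_mono2 mult_left_mono) auto
  also have "l d \<le> ln (real d)"
    using ln_a_ratio[of 1 d] d by (simp add: l_def)
  finally have *: "real m * (\<Sum>k=1..K. l (k * m)) \<le> (\<Sum>i=1..d. l i) + real m * ln (real d)"
    by (simp add: mult_left_mono)
  have "(\<Sum>k=1..K. l (k * m)) = (\<Sum>k=1..K. ln (a (k * m))) - real K * ln (a 1)"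
    using m by (subst sum.cong[OF refl, of _ _ "\<lambda>k. ln (a (k * m)) - ln (a 1)"]) (auto simp: l_def sum_subtractf)
  moreover have "(\<Sum>i=1..d. l i) = (\<Sum>i=1..d. ln (a i)) - real d * ln (a 1)"
    by (subst sum.cong[OF refl, of _ _ "\<lambda>i. ln (a i) - ln (a 1)"]) (auto simp: l_def sum_subtractf)
  ultimately have "real m * (\<Sum>k=1..K. ln (a (k * m))) - real m * (real K * ln (a 1))
      \<le> (\<Sum>i=1..d. ln (a i)) - real d * ln (a 1) + real m * ln (real d)"
    using * by (simp only: right_diff_distrib)
  moreover have "real (d - K * m) * ln (a 1) = real d * ln (a 1) - real m * (real K * ln (a 1))"
    using K by (simp add: of_nat_diff algebra_simps)
  ultimately show ?thesis by linarith
qed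

text \<open>The terms of \<open>Q_ge_sum_ln_green\<close> decrease in i, so a block is at least m
  times its last term. Of the d - K * m + 1 terms moved to index d + 1, all but one serve the power
  of x in \<open>exists_small_poly\<close> and one serves the factor 1 + |x|.\<close>

lemma sum_ln_green_blocks_le:
  assumes m: "1 \<le> m" and K: "K * m \<le> d"
  shows "real m * (\<Sum>k=1..K. ln (green (x / a (k * m)))) + real (d - K * m + 1) * ln (green (x / a (d + 1))) \<le> Q x"
proof -
  define f where "f i = ln (green (x / a i))" for i
  have anti: "f j \<le> f i" if "1 \<le> i" "i \<le> j" for i j
  proof -
    have ij: "0 < a i" "a i \<le> a j" using a_pos a_mono that by auto
    have "green (x / a j) \<le> green (x / a i)"
    proof (cases "1 \<le> \<bar>x / a j\<bar>")
      case True
      have "\<bar>x / a j\<bar> \<le> \<bar>x / a i\<bar>" using ij by (simp add: frac_le)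
      moreover have "green \<bar>x / a j\<bar> = green (x / a j)" using green_minus[of "x / a j"] by (simp add: abs_if)
      ultimately show ?thesis using green_mono[OF True] by simp
    next
      case False
      then have "green (x / a j) = 1" by (simp add: green_def)
      then show ?thesis using green_ge_1 by simp
    qed
    then show ?thesis unfolding f_def using green_pos by (intro ln_mono)
  qed
  have "real m * (\<Sum>k=1..K. f (k * m)) \<le> (\<Sum>i=1..K * m. f i)"
    by (rule sum_antimono_block) (rule anti)
  moreover have "real (d - K * m + 1) * f (d + 1) \<le> (\<Sum>i=K * m + 1..d + 1. f i)"
  proof -
    have "real (d - K * m + 1) * f (d + 1) = (\<Sum>i=K * m + 1..d + 1. f (d + 1))" using K by simp
    also have "\<dots> \<le> (\<Sum>i=K * m + 1..d + 1. f i)" by (intro sum_mono anti) auto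
    finally show ?thesis .
  qed
  moreover have "(\<Sum>i=1..K * m. f i) + (\<Sum>i=K * m + 1..d + 1. f i) = (\<Sum>i=1..d + 1. f i)"
    using sum.ub_add_nat[of 1 "K * m" f "d + 1 - K * m"] K by simp
  ultimately show ?thesis
    using Q_ge_sum_ln_green[of x "d + 1"] unfolding f_def by linarith
qed

text \<open>A power of x fills the degree up to d behind K Chebyshev polynomials of degree m. Their
  Green factors are absorbed by exp (Q x), and \<open>B\<close> keeps the remaining constants. The
  factor 1 + |x| secures square integrability after weighting.\<close>

lemma exists_small_poly:
  assumes m: "1 \<le> m" and K: "K * m \<le> d"
  defines "B \<equiv> a (d + 1) ^ (d - K * m) * (1 + a (d + 1)) * (\<Prod>k=1..K. 2 * (a (k * m) / 2) ^ m)"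
  obtains q where "degree q \<le> d" "coeff q d = 1" "\<And>x. \<bar>poly q x\<bar> * (1 + \<bar>x\<bar>) \<le> B * exp (Q x)"
proof -
  define A where "A = a (d + 1)"
  define \<rho> where "\<rho> = d - K * m"
  have A: "A > 0" unfolding A_def by (rule a_pos) simp
  have u: "a (k * m) > 0" if "k \<in> {1..K}" for k using that m by (intro a_pos) auto
  define q where "q = monom 1 \<rho> * (\<Prod>k=1..K. monic_cheb m (a (k * m)))"
  have top: "degree (\<Prod>k=1..K. monic_cheb m (a (k * m))) \<le> m * K"
      "coeff (\<Prod>k=1..K. monic_cheb m (a (k * m))) (m * K) = (\<Prod>k=1..K. coeff (monic_cheb m (a (k * m))) m)"
    using coeff_prod_top[of "{1..K}" "\<lambda>k. monic_cheb m (a (k * m))" m] degree_monic_cheb_le by auto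
  have d: "d = \<rho> + m * K" using K by (simp add: \<rho>_def mult.commute)
  show ?thesis
  proof (rule that)
    have "degree q \<le> \<rho> + m * K"
      unfolding q_def using top by (intro order_trans[OF degree_mult_le] add_mono degree_monom_le)
    then show "degree q \<le> d" using d by simp
    have "coeff q (\<rho> + m * K) = 1"
      unfolding q_def using top u m coeff_monic_cheb
      by (subst coeff_mult_top) (auto simp: degree_monom_le)
    then show "coeff q d = 1" using d by simp
    fix x
    define g where "g u = green (x / u)" for u
    have g: "g u \<ge> 1" for u using green_ge_1 by (simp add: g_def)
    \<comment> \<open>Since |t| <= green t, each factor x, and also 1 + |x|, costs one Green factor
      at index d + 1.\<close>
    have xA: "\<bar>x\<bar> \<le> A * g A"
      using abs_le_green[of "x / A"] A by (simp add: g_def field_simps)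
    have cheb: "\<bar>\<Prod>k=1..K. poly (monic_cheb m (a (k * m))) x\<bar> \<le> (\<Prod>k=1..K. 2 * (a (k * m) / 2) ^ m * g (a (k * m)) ^ m)"
      unfolding abs_prod g_def by (intro prod_mono) (use abs_poly_monic_cheb_le u in auto)
    have "\<bar>poly q x\<bar> * (1 + \<bar>x\<bar>) = (\<bar>x\<bar> ^ \<rho> * \<bar>\<Prod>k=1..K. poly (monic_cheb m (a (k * m))) x\<bar>) * (1 + \<bar>x\<bar>)"
      by (simp add: q_def poly_prod poly_monom abs_mult power_abs)
    also have "\<dots> \<le> ((A * g A) ^ \<rho> * (\<Prod>k=1..K. 2 * (a (k * m) / 2) ^ m * g (a (k * m)) ^ m)) * ((1 + A) * g A)"
    proof (intro mult_mono power_mono xA cheb)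
      show "1 + \<bar>x\<bar> \<le> (1 + A) * g A" using xA g[of A] by (simp add: distrib_right add_mono)
      have "0 \<le> (2 * (a (k * m) / 2) ^ m) * g (a (k * m)) ^ m" if "k \<in> {1..K}" for k
        using u[OF that] g[of "a (k * m)"] by (intro mult_nonneg_nonneg zero_le_power) auto
      then have "0 \<le> (\<Prod>k=1..K. 2 * (a (k * m) / 2) ^ m * g (a (k * m)) ^ m)"
        by (rule prod_nonneg)
      then show "0 \<le> (A * g A) ^ \<rho> * (\<Prod>k=1..K. 2 * (a (k * m) / 2) ^ m * g (a (k * m)) ^ m)"
        using A g[of A] by (intro mult_nonneg_nonneg zero_le_power) auto
    qed (use A g[of A] in auto)
    also have "\<dots> = B * (g A ^ (\<rho> + 1) * (\<Prod>k=1..K. g (a (k * m)) ^ m))"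
      unfolding B_def A_def[symmetric] \<rho>_def[symmetric] by (simp add: prod.distrib power_mult_distrib mult_ac)
    also have "\<dots> \<le> B * exp (Q x)"
    proof (rule mult_left_mono)
      have "g A ^ (\<rho> + 1) * (\<Prod>k=1..K. g (a (k * m)) ^ m)
        = exp (real m * (\<Sum>k=1..K. ln (g (a (k * m)))) + real (\<rho> + 1) * ln (g A))"
      proof -
        have e: "g u ^ j = exp (real j * ln (g u))" for u j
          using g[of u] by (simp add: exp_of_nat_mult)
        show ?thesis unfolding e by (simp add: exp_add exp_sum sum_distrib_left mult.commute)
      qed
      also have "\<dots> \<le> exp (Q x)"
        using sum_ln_green_blocks_le[OF m K, of x] by (simp add: g_def A_def \<rho>_def)
      finally show "g A ^ (\<rho> + 1) * (\<Prod>k=1..K. g (a (k * m)) ^ m) \<le> exp (Q x)" .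
      show "B \<ge> 0" unfolding B_def A_def[symmetric] using A u
        by (intro mult_nonneg_nonneg prod_nonneg zero_le_power) (auto simp: less_imp_le)
    qed
    finally show "\<bar>poly q x\<bar> * (1 + \<bar>x\<bar>) \<le> B * exp (Q x)" .
  qed
qed

lemma integral_inverse_1_plus_square:
  "integrable lborel (\<lambda>x::real. inverse (1 + x\<^sup>2))" "(\<integral>x. inverse (1 + x\<^sup>2) \<partial>lborel) = pi"
  using integrable_inverse_1_plus_square LBINT_inverse_1_plus_square
  by (simp_all add: set_integrable_def interval_lebesgue_integral_def set_lebesgue_integral_def einterval_def)

text \<open>The factor 1 + |x| turns the uniform bound into a weighted square norm of at most B^2
  pi; then \<open>extremal_leading_coeff\<close> applies.\<close>

lemma \<gamma>_lower_bound:
  assumes q: "degree q \<le> d" "coeff q d = 1" and B: "B > 0"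
    and bound: "\<And>x. \<bar>poly q x\<bar> * (1 + \<bar>x\<bar>) \<le> B * exp (Q x)"
  shows "- ln (\<gamma> d) \<le> ln B + ln pi / 2"
proof -
  have "(\<integral>x. (poly q x)\<^sup>2 * exp (- Q x) ^ 2 \<partial>lborel) \<le> (\<integral>x. B\<^sup>2 * inverse (1 + x\<^sup>2) \<partial>lborel)"
  proof (rule integral_mono')
    show "integrable lborel (\<lambda>x. B\<^sup>2 * inverse (1 + x\<^sup>2))"
      by (intro integrable_mult_right integral_inverse_1_plus_square)
    fix x :: real
    have "\<bar>poly q x\<bar> * exp (- Q x) * (1 + \<bar>x\<bar>) \<le> B"
      using bound[of x] by (simp add: exp_minus field_simps)
    then have "(\<bar>poly q x\<bar> * exp (- Q x) * (1 + \<bar>x\<bar>))\<^sup>2 \<le> B\<^sup>2"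
      by (intro power_mono) auto
    then have "(poly q x)\<^sup>2 * exp (- Q x) ^ 2 * (1 + \<bar>x\<bar>)\<^sup>2 \<le> B\<^sup>2"
      by (simp add: power_mult_distrib)
    moreover have "1 + x\<^sup>2 \<le> (1 + \<bar>x\<bar>)\<^sup>2" by (simp add: power2_eq_square algebra_simps)
    then have "(poly q x)\<^sup>2 * exp (- Q x) ^ 2 * (1 + x\<^sup>2) \<le> (poly q x)\<^sup>2 * exp (- Q x) ^ 2 * (1 + \<bar>x\<bar>)\<^sup>2"
      by (intro mult_left_mono) auto
    ultimately have "(poly q x)\<^sup>2 * exp (- Q x) ^ 2 * (1 + x\<^sup>2) \<le> B\<^sup>2" by linarith
    moreover have "1 + x\<^sup>2 > 0" by (simp add: add_pos_nonneg)
    ultimately show "(poly q x)\<^sup>2 * exp (- Q x) ^ 2 \<le> B\<^sup>2 * inverse (1 + x\<^sup>2)"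
      by (simp add: field_simps)
  qed simp
  also have "\<dots> = B\<^sup>2 * pi" by (simp add: integral_inverse_1_plus_square)
  finally have "(\<gamma> d)\<^sup>2 * (\<integral>x. (poly q x)\<^sup>2 * exp (- Q x) ^ 2 \<partial>lborel) \<le> (\<gamma> d)\<^sup>2 * (B\<^sup>2 * pi)"
    by (intro mult_left_mono) auto
  then have "1 \<le> (\<gamma> d)\<^sup>2 * (B\<^sup>2 * pi)"
    using extremal_leading_coeff[OF q(1)] q(2) by simp
  then have "ln 1 \<le> ln ((\<gamma> d)\<^sup>2 * (B\<^sup>2 * pi))" by (intro ln_mono) auto
  also have "\<dots> = 2 * ln (\<gamma> d) + (2 * ln B + ln pi)"
    using \<gamma>_pos[of d] B by (simp add: ln_mult_pos ln_realpow)
  finally show ?thesis by simp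
qed

text \<open>Up to the bracket, \<open>\<gamma> d\<close> is at least the product of the 2 / a i. In
  the bracket, d div m comes from the factor 2 of each Chebyshev polynomial, and the terms with m
  come from the blocks and the incomplete last one.\<close>

lemma neg_ln_\<gamma>_le:
  assumes m: "1 \<le> m" and d: "1 \<le> d"
  shows "- ln (\<gamma> d) \<le> (\<Sum>i=1..d. ln (a i)) - real d * ln 2
    + (ln pi / 2 + real (d div m + m) * ln 2 + ln (1 + a (d + 1)) + 2 * real m * ln (real d + 1))"
proof -
  define K where "K = d div m"
  have K: "K * m \<le> d" by (simp add: K_def)
  define \<rho> where "\<rho> = d - K * m"
  have \<rho>: "\<rho> \<le> m" "real d = real \<rho> + real K * real m"
  proof -
    have "\<rho> = d mod m" by (simp add: \<rho>_def K_def minus_div_mult_eq_mod)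
    then show "\<rho> \<le> m" using m by (simp add: less_imp_le)
    have "d = \<rho> + K * m" using K by (simp add: \<rho>_def)
    then show "real d = real \<rho> + real K * real m" by (metis of_nat_add of_nat_mult)
  qed
  define A where "A = a (d + 1)"
  have A: "A > 0" unfolding A_def by (rule a_pos) simp
  have u: "a (k * m) > 0" if "k \<in> {1..K}" for k using that m by (intro a_pos) auto
  define B where "B = A ^ \<rho> * (1 + A) * (\<Prod>k=1..K. 2 * (a (k * m) / 2) ^ m)"
  have P: "(\<Prod>k=1..K. 2 * (a (k * m) / 2) ^ m) > 0" using u by (intro prod_pos) auto
  then have B: "B > 0" unfolding B_def using A by auto
  obtain q where "degree q \<le> d" "coeff q d = 1" "\<And>x. \<bar>poly q x\<bar> * (1 + \<bar>x\<bar>) \<le> B * exp (Q x)"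
    using exists_small_poly[OF m K] unfolding B_def A_def \<rho>_def by metis
  from \<gamma>_lower_bound[OF this(1,2) B this(3)] have "- ln (\<gamma> d) \<le> ln B + ln pi / 2" .
  also have "ln B = real \<rho> * ln A + ln (1 + A) + ln (\<Prod>k=1..K. 2 * (a (k * m) / 2) ^ m)"
    unfolding B_def using A P by (simp add: ln_mult_pos ln_realpow)
  also have "ln (\<Prod>k=1..K. 2 * (a (k * m) / 2) ^ m) = (\<Sum>k=1..K. ln (2 * (a (k * m) / 2) ^ m))"
  proof (rule ln_prod)
    show "2 * (a (k * m) / 2) ^ m \<noteq> 0" if "k \<in> {1..K}" for k using u[OF that] by simp
  qed simp
  also have "\<dots> = (\<Sum>k=1..K. ln 2 + real m * (ln (a (k * m)) - ln 2))"
    using u by (intro sum.cong refl) (simp add: ln_mult_pos ln_realpow ln_divide_pos)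
  also have "\<dots> = real K * ln 2 + real m * (\<Sum>k=1..K. ln (a (k * m))) - real K * real m * ln 2"
    by (simp add: sum.distrib sum_subtractf sum_distrib_left[symmetric] algebra_simps)
  also have "\<dots> \<le> real K * ln 2 + ((\<Sum>i=1..d. ln (a i)) - real \<rho> * ln (a 1) + real m * ln (real d)) - real K * real m * ln 2"
    using ln_a_block_sum[OF m d K] by (simp add: \<rho>_def)
  finally have "- ln (\<gamma> d) \<le> real \<rho> * ln A + ln (1 + A) + (real K * ln 2 + ((\<Sum>i=1..d. ln (a i)) - real \<rho> * ln (a 1) + real m * ln (real d)) - real K * real m * ln 2) + ln pi / 2"
    by simp
  moreover have "real \<rho> * (ln A - ln (a 1)) \<le> real m * ln (real d + 1)"
  proof (rule mult_mono)
    show "ln A - ln (a 1) \<le> ln (real d + 1)" using ln_a_ratio[of 1 "d + 1"] by (simp add: A_def add.commute)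
  qed (use \<rho> a_mono[of 1 "d + 1"] a_pos[of 1] A in \<open>auto simp: A_def\<close>)
  moreover have "real m * ln (real d) \<le> real m * ln (real d + 1)"
    using d by (intro mult_left_mono ln_mono) auto
  moreover have "real K * real m * ln 2 = real d * ln 2 - real \<rho> * ln 2"
    unfolding \<rho>(2) by (simp add: algebra_simps)
  moreover have "real \<rho> * ln 2 \<le> real m * ln 2" using \<rho>(1) by (intro mult_right_mono) auto
  moreover have "real (K + m) * ln 2 = real K * ln 2 + real m * ln 2" by (simp add: distrib_right)
  ultimately show ?thesis
    unfolding K_def[symmetric] A_def[symmetric] right_diff_distrib by linarith
qed

text \<open>The d * ln 2 from ln (b / 2) cancels the one from \<open>\<gamma> d\<close>, and
  \<open>arcsine_mean_a_le\<close> disposes of the arcsine mean together with the sum of the ln (a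
  i). What remains of first order is d (ln (a d) - ln b).\<close>

lemma card_outer_zeros_le:
  assumes m: "1 \<le> m" and d: "1 \<le> d" "d \<le> n"
    and c: "c > 0" "c * \<gamma> d \<le> \<bar>coeff (combination x n) d\<bar>"
    and S: "S > 0" "(\<Sum>j\<le>n. (x j)\<^sup>2) \<le> S"
    and b: "0 < b" "b \<le> a n" and t: "1 \<le> t"
  shows "real (card {y. poly (combination x n) y = 0 \<and> t * b \<le> \<bar>y\<bar>}) * ln (green t)
    \<le> real d * ln (a n / b) + real n * ln (real n / real d) + ln (real n) + 1
      + (ln pi / 2 + real (d div m + m) * ln 2 + ln (1 + a (d + 1)) + 2 * real m * ln (real d + 1))
      + ln S / 2 - ln (b / 2) / 2 - ln c + real (n - d) * ln (4 * green t * (real n + 1))"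
proof -
  define P where "P = combination x n"
  have "0 < c * \<gamma> d" using c \<gamma>_pos[of d] by simp
  then have cd: "\<bar>coeff P d\<bar> > 0" unfolding P_def using c(2) by linarith
  then have cd0: "coeff P d \<noteq> 0" and P0: "P \<noteq> 0" by auto
  have deg: "degree P \<le> n" unfolding P_def by (rule degree_combination_le)
  have an: "0 < a d" "0 < a n" "0 < a 1" using d a_pos by auto
  have "real (card {y. poly P y = 0 \<and> t * b \<le> \<bar>y\<bar>}) * ln (green t)
    \<le> integral {0..pi} (\<lambda>\<theta>. ln \<bar>poly P (b * cos \<theta>)\<bar>) / pi - ln \<bar>coeff P d\<bar> - real d * ln (b / 2)
      + real (degree P - d) * ln (4 * green t * (real (degree P) + 1))"
    using card_outer_roots[OF cd0 t b(1)] by (simp add: add.commute)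
  moreover have "integral {0..pi} (\<lambda>\<theta>. ln \<bar>poly P (b * cos \<theta>)\<bar>) / pi \<le> arcsine_mean Q b + ln S / 2 - ln (b / 2) / 2"
  proof -
    have "integral {0..pi} (\<lambda>\<theta>. ln \<bar>poly P (b * cos \<theta>)\<bar>) \<le> pi * arcsine_mean Q b + pi / 2 * ln S - pi / 2 * ln (b / 2)"
      using integral_ln_poly_le[OF P0 b(1) cont_Q, of S] combination_integrable combination_integral S
      unfolding integral_Q_cos P_def by simp
    also have "\<dots> = (arcsine_mean Q b + ln S / 2 - ln (b / 2) / 2) * pi" by (simp add: algebra_simps)
    finally show ?thesis by (simp add: divide_le_eq)
  qed
  moreover have "- ln \<bar>coeff P d\<bar> \<le> - ln c - ln (\<gamma> d)"
  proof -
    have "ln (c * \<gamma> d) \<le> ln \<bar>coeff P d\<bar>" using c \<gamma>_pos[of d] by (intro ln_mono) (auto simp: P_def)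
    then show ?thesis using c \<gamma>_pos[of d] by (simp add: ln_mult_pos)
  qed
  moreover note neg_ln_\<gamma>_le[OF m d(1)]
  moreover have "real (degree P - d) * ln (4 * green t * (real (degree P) + 1)) \<le> real (n - d) * ln (4 * green t * (real n + 1))"
  proof (rule mult_mono)
    show "ln (4 * green t * (real (degree P) + 1)) \<le> ln (4 * green t * (real n + 1))"
      using deg green_pos[of t] by (intro ln_mono mult_left_mono mult_pos_pos) auto
    have "1 * 1 \<le> (4 * green t) * (real (degree P) + 1)"
      using green_ge_1[of t] by (intro mult_mono) auto
    then show "0 \<le> ln (4 * green t * (real (degree P) + 1))" by simp
  qed (use deg in auto)
  \<comment> \<open>As d may be smaller than n, b may exceed a d; convexity bounds the excess by n
    (ln (a n) - ln (a d)).\<close>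
  moreover have "arcsine_mean Q b \<le> arcsine_mean Q (a d) + real n * ln (real n / real d)"
  proof (cases "a d \<le> b")
    case True
    have "arcsine_mean Q b - arcsine_mean Q (a d) \<le> (b * mrs_density Q b) * (ln b - ln (a d))"
      using True an by (intro arcsine_mean_diff_ln)
    also have "\<dots> \<le> real n * (ln (a n) - ln (a d))"
    proof (rule mult_mono)
      have "b * mrs_density Q b \<le> a n * mrs_density Q (a n)"
        using b by (intro mult_mono mrs_density_mono mrs_density_nonneg) auto
      then show "b * mrs_density Q b \<le> real n" using a_density[of n] d by simp
    qed (use True b an in auto)
    also have "\<dots> \<le> real n * ln (real n / real d)" using ln_a_ratio[of d n] d by (intro mult_left_mono) auto
    finally show ?thesis by simp
  next
    case False
    then have "arcsine_mean Q b \<le> arcsine_mean Q (a d)" using b by (intro arcsine_mean_mono) auto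
    moreover have "0 \<le> real n * ln (real n / real d)" using d by (intro mult_nonneg_nonneg ln_ge_zero) auto
    ultimately show ?thesis by simp
  qed
  moreover note arcsine_mean_a_le[OF d(1)]
  moreover have "(real d + 1) * ln (a d) - ln (a 1) - real d * ln b \<le> real d * ln (a n / b) + ln (real n)"
  proof -
    have "ln (a d) \<le> ln (a n)" using an a_mono d by simp
    then have "(real d + 1) * ln (a d) \<le> (real d + 1) * ln (a n)" by (intro mult_left_mono) auto
    moreover have "ln (a n) - ln (a 1) \<le> ln (real n)" using ln_a_ratio[of 1 n] d by simp
    ultimately show ?thesis using an b by (simp add: ln_divide_pos algebra_simps)
  qed
  moreover have "real d * ln (b / 2) = real d * ln b - real d * ln 2" using b by (simp add: ln_divide_pos algebra_simps)
  ultimately show ?thesis unfolding P_def[symmetric] by linarith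
qed

end

section \<open>Small ball probabilities\<close>

text \<open>Fubini for the joint law: once Y is fixed, the event confines h Z to a ball of radius c.
  The map \<open>h\<close> is needed because \<open>Z\<close> will be a family indexed by a single
  element.\<close>

lemma (in prob_space) indep_small_ball:
  fixes h :: "'b \<Rightarrow> real"
  assumes ind: "indep_var N Y N' Z" and h: "h \<in> borel_measurable N'" and G: "G \<in> sets N" and f: "f \<in> borel_measurable N"
    and X: "\<And>y. prob {\<omega> \<in> space M. \<bar>h (Z \<omega>) - y\<bar> < c} \<le> q" and q: "0 \<le> q"
  shows "prob {\<omega> \<in> space M. Y \<omega> \<in> G \<and> \<bar>h (Z \<omega>) + f (Y \<omega>)\<bar> < c} \<le> q * prob {\<omega> \<in> space M. Y \<omega> \<in> G}"
proof -
  have rv [measurable]: "random_variable N Y" "random_variable N' Z" and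
    eq: "distr M N Y \<Otimes>\<^sub>M distr M N' Z = distr M (N \<Otimes>\<^sub>M N') (\<lambda>\<omega>. (Y \<omega>, Z \<omega>))"
    using ind unfolding indep_var_distribution_eq by auto
  note [measurable] = G f h
  interpret X: prob_space "distr M N' Z" by (rule prob_space_distr) simp
  define U where "U = {z \<in> space (N \<Otimes>\<^sub>M N'). fst z \<in> G \<and> \<bar>h (snd z) + f (fst z)\<bar> < c}"
  have U [measurable]: "U \<in> sets (N \<Otimes>\<^sub>M N')" unfolding U_def by measurable
  have "emeasure M {\<omega> \<in> space M. Y \<omega> \<in> G \<and> \<bar>h (Z \<omega>) + f (Y \<omega>)\<bar> < c} = emeasure (distr M (N \<Otimes>\<^sub>M N') (\<lambda>\<omega>. (Y \<omega>, Z \<omega>))) U"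
    using measurable_space[OF rv(1)] measurable_space[OF rv(2)]
    by (subst emeasure_distr) (auto simp: U_def space_pair_measure intro!: arg_cong[where f = "emeasure M"])
  also have "\<dots> = (\<integral>\<^sup>+ y. emeasure (distr M N' Z) (Pair y -` U) \<partial>distr M N Y)"
    unfolding eq[symmetric] by (rule X.emeasure_pair_measure_alt) (simp cong: sets_pair_measure_cong)
  also have "\<dots> \<le> (\<integral>\<^sup>+ y. ennreal q * indicator G y \<partial>distr M N Y)"
  proof (rule nn_integral_mono)
    fix y assume y: "y \<in> space (distr M N Y)"
    show "emeasure (distr M N' Z) (Pair y -` U) \<le> ennreal q * indicator G y"
    proof (cases "y \<in> G")
      case True
      then have "Pair y -` U = {x \<in> space N'. \<bar>h x - (- f y)\<bar> < c}" using y by (auto simp: U_def space_pair_measure)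
      then have "emeasure (distr M N' Z) (Pair y -` U) = emeasure M {\<omega> \<in> space M. \<bar>h (Z \<omega>) - (- f y)\<bar> < c}"
        using measurable_space[OF rv(2)]
        by (subst emeasure_distr) (auto intro!: arg_cong[where f = "emeasure M"])
      also have "\<dots> \<le> ennreal q" using X[of "- f y"] unfolding emeasure_eq_measure by (rule ennreal_leI)
      finally show ?thesis using True by simp
    next
      case False
      then have "Pair y -` U = {}" by (auto simp: U_def)
      then show ?thesis by simp
    qed
  qed
  also have "\<dots> = ennreal q * emeasure M {\<omega> \<in> space M. Y \<omega> \<in> G}"
  proof -
    have "Y -` G \<inter> space M = {\<omega> \<in> space M. Y \<omega> \<in> G}" by auto
    then show ?thesis by (simp add: nn_integral_cmult_indicator emeasure_distr)
  qed
  finally show ?thesis using q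
    by (simp add: emeasure_eq_measure ennreal_mult'[symmetric])
qed

text \<open>Conditioning on \<open>X\<^sub>j\<close>, \<open>j > d\<close>, one index at a time.\<close>
lemma (in prob_space) sequential_small_ball:
  fixes X :: "nat \<Rightarrow> 'a \<Rightarrow> real"
  assumes ind: "indep_vars (\<lambda>_. borel) X UNIV"
    and X: "\<And>k y. prob {\<omega> \<in> space M. \<bar>X k \<omega> - y\<bar> < c} \<le> q" and q: "0 \<le> q"
  shows "k \<le> n \<Longrightarrow>
    prob {\<omega> \<in> space M. \<forall>d\<in>{n - k<..n}. \<bar>X d \<omega> + (\<Sum>j\<in>{d<..n}. w d j * X j \<omega>)\<bar> < c} \<le> q ^ k"
proof (induction k)
  case 0
  then show ?case by (simp add: prob_space)
next
  case (Suc k)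
  \<comment> \<open>The window grows downwards: the new index lies below all of \<open>J\<close>,
    and its linear combination involves only indices in \<open>J\<close>.\<close>
  define d0 where "d0 = n - k"
  define J where "J = {n - k<..n}"
  define N :: "(nat \<Rightarrow> real) measure" where "N = PiM J (\<lambda>_. borel)"
  define Y where "Y \<omega> = restrict (\<lambda>i. X i \<omega>) J" for \<omega>
  define G where "G = {y \<in> space N. \<forall>d\<in>J. \<bar>y d + (\<Sum>j\<in>{d<..n}. w d j * y j)\<bar> < c}"
  define f where "f y = (\<Sum>j\<in>J. w d0 j * y j)" for y
  have comp: "(\<lambda>y. y j) \<in> borel_measurable N" if "j \<in> J" for j
    unfolding N_def using that by measurable
  have sub: "{d<..n} \<subseteq> J" if "d \<in> J" for d using that by (auto simp: J_def)
  have f: "f \<in> borel_measurable N"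
    unfolding f_def by (intro borel_measurable_sum borel_measurable_times comp) auto
  have meas: "(\<lambda>y. \<bar>y d + (\<Sum>j\<in>{d<..n}. w d j * y j)\<bar>) \<in> borel_measurable N" if "d \<in> J" for d
    using sub[OF that] that
    by (intro borel_measurable_abs borel_measurable_add borel_measurable_sum borel_measurable_times comp) auto
  have G: "G \<in> sets N"
    unfolding G_def
    by (intro sets.sets_Collect_finite_All borel_measurable_less meas) (auto simp: J_def)
  have indep: "indep_var N Y (PiM {d0} (\<lambda>_. borel)) (\<lambda>\<omega>. restrict (\<lambda>i. X i \<omega>) {d0})"
    unfolding N_def Y_def by (rule indep_var_restrict[OF ind]) (auto simp: J_def d0_def)
  have proj: "(\<lambda>y. y d0) \<in> borel_measurable (PiM {d0} (\<lambda>_. borel :: real measure))"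
    by measurable
  have YG: "Y \<omega> \<in> G \<longleftrightarrow> (\<forall>d\<in>J. \<bar>X d \<omega> + (\<Sum>j\<in>{d<..n}. w d j * X j \<omega>)\<bar> < c)" for \<omega>
  proof -
    have "Y \<omega> \<in> space N" by (simp add: Y_def N_def space_PiM)
    moreover have "(\<Sum>j\<in>{d<..n}. w d j * Y \<omega> j) = (\<Sum>j\<in>{d<..n}. w d j * X j \<omega>)" if "d \<in> J" for d
      using sub[OF that] by (intro sum.cong) (auto simp: Y_def)
    ultimately show ?thesis by (simp add: G_def Y_def)
  qed
  have "{n - Suc k<..n} = insert d0 J" using Suc.prems by (auto simp: d0_def J_def)
  moreover have "f (Y \<omega>) = (\<Sum>j\<in>{d0<..n}. w d0 j * X j \<omega>)" for \<omega>
    unfolding f_def by (intro sum.cong) (auto simp: Y_def J_def d0_def)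
  ultimately have "{\<omega> \<in> space M. \<forall>d\<in>{n - Suc k<..n}. \<bar>X d \<omega> + (\<Sum>j\<in>{d<..n}. w d j * X j \<omega>)\<bar> < c}
    = {\<omega> \<in> space M. Y \<omega> \<in> G \<and> \<bar>X d0 \<omega> + f (Y \<omega>)\<bar> < c}"
    by (auto simp: YG)
  also have "prob \<dots> \<le> q * prob {\<omega> \<in> space M. Y \<omega> \<in> G}"
    using indep_small_ball[OF indep proj G f _ q, of c] X[of d0] by simp
  also have "\<dots> \<le> q * q ^ k"
    using Suc.IH Suc.prems q unfolding YG J_def by (intro mult_left_mono) auto
  finally show ?case by simp
qed

text \<open>The second moment about any y is at least 1, so X cannot stay within 1/2 of y almost
  surely; the bound on a higher moment forbids that this second moment comes from an event of
  arbitrarily small probability.\<close>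

lemma (in prob_space) uniform_anticoncentration:
  fixes e B :: real
  assumes e: "e > 0"
  obtains q where "0 \<le> q" "q < 1"
    "\<And>X y. X \<in> borel_measurable M \<Longrightarrow> integrable M X \<Longrightarrow> integrable M (\<lambda>\<omega>. (X \<omega>)\<^sup>2) \<Longrightarrow>
      expectation X = 0 \<Longrightarrow> expectation (\<lambda>\<omega>. (X \<omega>)\<^sup>2) = 1 \<Longrightarrow>
      integrable M (\<lambda>\<omega>. \<bar>X \<omega>\<bar> powr (2 + e)) \<Longrightarrow> expectation (\<lambda>\<omega>. \<bar>X \<omega>\<bar> powr (2 + e)) \<le> B \<Longrightarrow>
      prob {\<omega> \<in> space M. \<bar>X \<omega> - y\<bar> < 1 / 2} \<le> q"
proof -
  \<comment> \<open>Truncation level: values beyond \<open>R\<close> contribute at most R^(-e) B <=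
    1/8 to the second moment, hence 1/4 after the factor 2 in (X - y)^2 <= 2 X^2 + 2 y^2.\<close>
  define R where "R = (8 * (\<bar>B\<bar> + 1)) powr (1 / e)"
  have R: "R > 0" unfolding R_def by simp
  have Re: "R powr (- e) = 1 / (8 * (\<bar>B\<bar> + 1))"
    using e by (simp add: R_def powr_powr powr_minus_divide)
  have ReB: "2 * R powr (- e) * B \<le> 1 / 4"
    unfolding Re by (simp add: field_simps)
  \<comment> \<open>Bounds 2 X^2 + 2 y^2 for |X| <= R and |y| <= 3.\<close>
  define D where "D = 2 * R\<^sup>2 + 18"
  have D: "D \<ge> 18" by (simp add: D_def)
  show ?thesis
  proof (rule that[of "1 - 1 / (2 * D)"])
    show "0 \<le> 1 - 1 / (2 * D)" "1 - 1 / (2 * D) < 1" using D by (auto simp: field_simps)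
    fix X :: "'a \<Rightarrow> real" and y
    assume X [measurable]: "X \<in> borel_measurable M" and i1: "integrable M X" and i2: "integrable M (\<lambda>\<omega>. (X \<omega>)\<^sup>2)"
      and E1: "expectation X = 0" and E2: "expectation (\<lambda>\<omega>. (X \<omega>)\<^sup>2) = 1"
      and ie: "integrable M (\<lambda>\<omega>. \<bar>X \<omega>\<bar> powr (2 + e))" and Ee: "expectation (\<lambda>\<omega>. \<bar>X \<omega>\<bar> powr (2 + e)) \<le> B"
    define A where "A = {\<omega> \<in> space M. \<bar>X \<omega> - y\<bar> < 1 / 2}"
    have A [measurable]: "A \<in> sets M" unfolding A_def by measurable
    show "prob {\<omega> \<in> space M. \<bar>X \<omega> - y\<bar> < 1 / 2} \<le> 1 - 1 / (2 * D)"
    proof (cases "\<bar>y\<bar> \<le> 3")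
      case True
      have trunc: "(X \<omega>)\<^sup>2 \<le> R\<^sup>2 + R powr (- e) * \<bar>X \<omega>\<bar> powr (2 + e)" for \<omega>
      proof (cases "\<bar>X \<omega>\<bar> \<le> R")
        case True
        then have "(X \<omega>)\<^sup>2 \<le> R\<^sup>2" using power_mono[of "\<bar>X \<omega>\<bar>" R 2] by simp
        then show ?thesis by (simp add: add_increasing2)
      next
        case False
        then have x: "\<bar>X \<omega>\<bar> > 0" "\<bar>X \<omega>\<bar> \<ge> R" using R by auto
        have "1 \<le> (\<bar>X \<omega>\<bar> / R) powr e" using x R e by (intro ge_one_powr_ge_zero) auto
        then have "\<bar>X \<omega>\<bar> powr 2 * 1 \<le> \<bar>X \<omega>\<bar> powr 2 * (\<bar>X \<omega>\<bar> / R) powr e" by (intro mult_left_mono) auto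
        also have "\<dots> = R powr (- e) * \<bar>X \<omega>\<bar> powr (2 + e)"
          using x R by (simp add: powr_divide powr_add powr_minus_divide)
        also have "\<bar>X \<omega>\<bar> powr 2 = (X \<omega>)\<^sup>2" using x by (simp add: powr_numeral)
        finally show ?thesis by (simp add: add_increasing)
      qed
      have y2: "y\<^sup>2 \<le> 9" using True power_mono[of "\<bar>y\<bar>" 3 2] by simp
      have pt: "(X \<omega> - y)\<^sup>2 \<le> 1 / 4 + (D * indicator (space M - A) \<omega> + 2 * R powr (- e) * \<bar>X \<omega>\<bar> powr (2 + e))"
        if \<omega>: "\<omega> \<in> space M" for \<omega>
      proof (cases "\<omega> \<in> A")
        case True
        then have "\<bar>X \<omega> - y\<bar>\<^sup>2 \<le> (1 / 2)\<^sup>2" by (intro power_mono) (auto simp: A_def)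
        then have "(X \<omega> - y)\<^sup>2 \<le> 1 / 4" by (simp add: power2_eq_square)
        moreover have "0 \<le> 2 * R powr (- e) * \<bar>X \<omega>\<bar> powr (2 + e)" by simp
        moreover have "indicator (space M - A) \<omega> = (0 :: real)" using True by simp
        ultimately show ?thesis by (simp only: mult_zero_right)
      next
        case False
        have "(X \<omega> - y)\<^sup>2 \<le> 2 * (X \<omega>)\<^sup>2 + 2 * y\<^sup>2"
          using zero_le_power2[of "X \<omega> + y"] by (simp add: power2_sum power2_diff)
        also have "\<dots> \<le> 2 * (R\<^sup>2 + R powr (- e) * \<bar>X \<omega>\<bar> powr (2 + e)) + 2 * 9"
          using trunc[of \<omega>] y2 by (intro add_mono mult_left_mono) auto
        finally show ?thesis using False \<omega> by (simp add: D_def algebra_simps)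
      qed
      have iy: "integrable M (\<lambda>\<omega>. (X \<omega> - y)\<^sup>2)"
        unfolding power2_diff using i1 i2 by auto
      have iA: "integrable M (indicat_real (space M - A))"
        by (intro integrable_real_indicator) (auto simp: less_top[symmetric])
      have "1 \<le> 1 + y\<^sup>2" by simp
      also have "\<dots> = expectation (\<lambda>\<omega>. (X \<omega> - y)\<^sup>2)"
        unfolding power2_diff using i1 i2 E1 E2 by (simp add: prob_space)
      also have "\<dots> \<le> expectation (\<lambda>\<omega>. 1 / 4 + (D * indicator (space M - A) \<omega> + 2 * R powr (- e) * \<bar>X \<omega>\<bar> powr (2 + e)))"
        using ie iA by (intro integral_mono iy pt Bochner_Integration.integrable_add integrable_mult_right) auto
      also have "\<dots> = 1 / 4 + (D * prob (space M - A) + 2 * R powr (- e) * expectation (\<lambda>\<omega>. \<bar>X \<omega>\<bar> powr (2 + e)))"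
        using ie iA by (simp add: prob_space)
      also have "2 * R powr (- e) * expectation (\<lambda>\<omega>. \<bar>X \<omega>\<bar> powr (2 + e)) \<le> 2 * R powr (- e) * B"
        using Ee by (intro mult_left_mono) auto
      finally have "1 / 2 \<le> D * prob (space M - A)" using ReB by simp
      then have "1 / (2 * D) \<le> prob (space M - A)" using D by (simp add: field_simps)
      then show ?thesis unfolding A_def[symmetric] by (simp add: prob_compl)
    next
      \<comment> \<open>For |y| > 3 the event forces |X| >= 5/2, and Chebyshev's inequality
        suffices.\<close>
      case False
      have "25 / 4 * prob A = expectation (\<lambda>\<omega>. 25 / 4 * indicator A \<omega>)" by simp
      also have "\<dots> \<le> expectation (\<lambda>\<omega>. (X \<omega>)\<^sup>2)"
      proof (rule integral_mono[OF _ i2])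
        fix \<omega> assume "\<omega> \<in> space M"
        show "25 / 4 * indicator A \<omega> \<le> (X \<omega>)\<^sup>2"
        proof (cases "\<omega> \<in> A")
          case True
          then have "5 / 2 \<le> \<bar>X \<omega>\<bar>" using False by (auto simp: A_def abs_if split: if_splits)
          then have "(5 / 2)\<^sup>2 \<le> \<bar>X \<omega>\<bar>\<^sup>2" by (intro power_mono) auto
          then show ?thesis using True by (simp add: power2_eq_square)
        qed simp
      next
        show "integrable M (\<lambda>\<omega>. 25 / 4 * indicat_real A \<omega>)"
          by (intro integrable_mult_right integrable_real_indicator) (auto simp: less_top[symmetric])
      qed
      finally have "prob A \<le> 1 / 2" using E2 by simp
      also have "\<dots> \<le> 1 - 1 / (2 * D)" using D by (simp add: field_simps)
      finally show ?thesis unfolding A_def .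
    qed
  qed
qed

section \<open>Zeros of random orthonormal sums\<close>

lemma filterlim_floor_sqrt: "filterlim floor_sqrt at_top at_top"
  unfolding filterlim_at_top
proof
  fix Z :: nat
  show "eventually (\<lambda>n. Z \<le> floor_sqrt n) at_top"
    using eventually_ge_at_top[of "Z\<^sup>2"] by eventually_elim (rule le_floor_sqrtI)
qed

lemma div_floor_sqrt_le: "d \<le> n \<Longrightarrow> d div floor_sqrt n \<le> floor_sqrt n + 2"
proof -
  assume d: "d \<le> n"
  show ?thesis
  proof (cases "n = 0")
    case False
    then have s: "floor_sqrt n > 0" by simp
    have "n \<le> floor_sqrt n * (floor_sqrt n + 2)"
      using Suc_floor_sqrt_power2_gt[of n] by (simp add: power2_eq_square)
    then have "d div floor_sqrt n \<le> (floor_sqrt n * (floor_sqrt n + 2)) div floor_sqrt n"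
      using d by (intro div_le_mono) simp
    then show ?thesis using s by simp
  qed (use d in simp)
qed

lemma real_floor_sqrt_le: "real (floor_sqrt n) \<le> sqrt (real n)"
proof -
  have "real ((floor_sqrt n)\<^sup>2) \<le> real n" by (rule of_nat_mono) simp
  then show ?thesis by (intro real_le_rsqrt) simp
qed

text \<open>The remainder of \<open>card_outer_zeros_le\<close> for blocks and window of length
  about sqrt x, with A = a 1, r = 1 - 2 epsilon and g = green t. The term 3 ln x / 2 stems from the
  norm bound n ^ 3, and ln 2 from the lower bound 1/2 for the random factor.\<close>

definition zero_count_error :: "real \<Rightarrow> real \<Rightarrow> real \<Rightarrow> real \<Rightarrow> real" where
  "zero_count_error A r g x = x * (sqrt x / (x - sqrt x)) + ln x + 1
    + (ln pi / 2 + (2 * sqrt x + 2) * ln 2 + ln (1 + (x + 1) * A) + 2 * sqrt x * ln (x + 1))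
    + 3 * ln x / 2 - ln (r * A / 2) / 2 + ln 2 + sqrt x * ln (4 * g * (x + 1))"

lemma zero_count_error_limit:
  assumes "A > 0" "g > 0" "l > 0"
  shows "(\<lambda>n. (real n * L + zero_count_error A r g (real n)) / l / real n) \<longlonglongrightarrow> L / l"
proof -
  have "(\<lambda>n. (real n * L + zero_count_error A r g (real n)) / l / real n) \<longlonglongrightarrow> L * inverse l"
    unfolding zero_count_error_def using assms by real_asymp
  then show ?thesis by (simp only: divide_inverse[of L l])
qed

section \<open>Deterministic and expected counts of outer zeros\<close>

context orthonormal_system
begin

lemma rand_poly_eq: "rand_poly p a c n x = poly (combination c n) (a n * x)"
  by (simp add: rand_poly_def poly_combination)

lemma N_zeros_le_degree:
  assumes n: "n \<ge> 1"
  shows "N_zeros (rand_poly p a c n) (UNIV - D_set \<epsilon>) \<le> n"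
proof (cases "combination c n = 0")
  case True
  \<comment> \<open>For the zero polynomial the set of zeros is infinite, and its
    \<open>card\<close> is 0.\<close>
  have "infinite (UNIV - D_set \<epsilon>)"
  proof (rule infinite_super)
    show "{2 - \<epsilon>..} \<subseteq> UNIV - D_set \<epsilon>" by (auto simp: D_set_def)
  qed (rule infinite_Ici)
  moreover have "{x \<in> UNIV - D_set \<epsilon>. rand_poly p a c n x = 0} = UNIV - D_set \<epsilon>"
    using True by (auto simp: rand_poly_eq)
  ultimately have "N_zeros (rand_poly p a c n) (UNIV - D_set \<epsilon>) = 0"
    unfolding N_zeros_def by (metis card.infinite)
  then show ?thesis by simp
next
  case False
  have "N_zeros (rand_poly p a c n) (UNIV - D_set \<epsilon>) = card ((\<lambda>x. a n * x) ` {x \<in> UNIV - D_set \<epsilon>. poly (combination c n) (a n * x) = 0})"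
    using a_pos[OF n] by (subst card_image) (auto simp: inj_on_def N_zeros_def rand_poly_eq)
  also have "\<dots> \<le> card {y. poly (combination c n) y = 0}"
    by (intro card_mono poly_roots_finite False) auto
  also have "\<dots> \<le> n"
    using card_poly_roots_bound[OF False] degree_combination_le[of c n] by linarith
  finally show ?thesis .
qed

text \<open>Divided by \<open>\<gamma> d\<close>, the coefficient is c d plus a combination of later
  entries only, the form that \<open>sequential_small_ball\<close> handles.\<close>

lemma coeff_combination:
  assumes "d \<le> n"
  shows "coeff (combination c n) d = \<gamma> d * (c d + (\<Sum>j\<in>{d<..n}. coeff (p j) d / \<gamma> d * c j))"
proof -
  have "coeff (combination c n) d = (\<Sum>j\<le>n. c j * coeff (p j) d)"
    by (simp add: combination_def coeff_sum)
  also have "\<dots> = (\<Sum>j\<in>insert d {d<..n}. c j * coeff (p j) d)"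
    using assms by (intro sum.mono_neutral_right) (auto simp: coeff_eq_0 degree_p)
  also have "\<dots> = c d * \<gamma> d + (\<Sum>j\<in>{d<..n}. c j * coeff (p j) d)"
    by (simp add: coeff_p)
  also have "\<dots> = \<gamma> d * (c d + (\<Sum>j\<in>{d<..n}. coeff (p j) d / \<gamma> d * c j))"
    using \<gamma>_pos[of d] by (simp add: distrib_left sum_distrib_left mult_ac)
  finally show ?thesis .
qed

lemma N_zeros_outer_le:
  assumes n: "n \<ge> 2" and d: "d \<in> {n - floor_sqrt n<..n}"
    and small_ball: "1 / 2 \<le> \<bar>c d + (\<Sum>j\<in>{d<..n}. coeff (p j) d / \<gamma> d * c j)\<bar>"
    and norm: "(\<Sum>j\<le>n. (c j)\<^sup>2) \<le> real n ^ 3"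
    and eps: "0 < \<epsilon>" "\<epsilon> < 1 / 4"
  defines "t \<equiv> (1 - \<epsilon>) / (1 - 2 * \<epsilon>)"
  shows "real (N_zeros (rand_poly p a c n) (UNIV - D_set \<epsilon>)) * ln (green t)
    \<le> real n * ln (1 / (1 - 2 * \<epsilon>)) + zero_count_error (a 1) (1 - 2 * \<epsilon>) (green t) (real n)"
proof -
  define s where "s = floor_sqrt n"
  define r where "r = 1 - 2 * \<epsilon>"
  \<comment> \<open>Twice the margin of \<open>D_set\<close>: t * b is the endpoint of the scaled
    \<open>D_set \<epsilon>\<close>, and t > 1 leaves a positive ln (green t).\<close>
  define b where "b = r * a n"
  define P where "P = combination c n"
  have s: "s \<ge> 1" using n by (simp add: s_def Suc_le_eq)
  have sx: "real s \<le> sqrt (real n)" unfolding s_def by (rule real_floor_sqrt_le)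
  have xn: "sqrt (real n) < real n"
    using n by (intro real_less_lsqrt) (auto simp: power2_eq_square)
  have dn: "1 \<le> d" "d \<le> n" "n - d \<le> s" using d by (auto simp: s_def)
  have nd: "real (n - d) \<le> sqrt (real n)" "real n - sqrt (real n) \<le> real d"
    using dn sx by (auto simp: of_nat_diff)
  have an: "0 < a n" "0 < a 1" "a 1 \<le> a n" using n a_pos a_mono[of 1 n] by auto
  have r: "0 < r" "r < 1" using eps by (auto simp: r_def)
  have b: "0 < b" "b \<le> a n" using an r by (auto simp: b_def)
  have t: "1 \<le> t" "t * b = (1 - \<epsilon>) * a n" using eps r by (auto simp: t_def b_def r_def field_simps)
  have g: "1 \<le> green t" by (rule green_ge_1)
  have coeff: "1 / 2 * \<gamma> d \<le> \<bar>coeff P d\<bar>"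
    unfolding P_def coeff_combination[OF dn(2)] abs_mult using \<gamma>_pos[of d] mult_left_mono[OF small_ball, of "\<gamma> d"] by simp
  have P0: "P \<noteq> 0" using coeff \<gamma>_pos[of d] by auto
  have "N_zeros (rand_poly p a c n) (UNIV - D_set \<epsilon>) = card ((\<lambda>x. a n * x) ` {x \<in> UNIV - D_set \<epsilon>. poly P (a n * x) = 0})"
    using an by (subst card_image) (auto simp: inj_on_def N_zeros_def rand_poly_eq P_def)
  also have "\<dots> \<le> card {y. poly P y = 0 \<and> t * b \<le> \<bar>y\<bar>}"
  proof (intro card_mono)
    show "finite {y. poly P y = 0 \<and> t * b \<le> \<bar>y\<bar>}"
      by (rule finite_subset[OF _ poly_roots_finite[OF P0]]) auto
    have "(1 - \<epsilon>) * a n \<le> \<bar>a n * x\<bar>" if "x \<notin> D_set \<epsilon>" for x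
    proof -
      have "1 - \<epsilon> \<le> \<bar>x\<bar>" using that by (auto simp: D_set_def)
      then show ?thesis using an by (simp add: abs_mult mult.commute)
    qed
    then show "(\<lambda>x. a n * x) ` {x \<in> UNIV - D_set \<epsilon>. poly P (a n * x) = 0} \<subseteq> {y. poly P y = 0 \<and> t * b \<le> \<bar>y\<bar>}"
      unfolding t by auto
  qed
  finally have "real (N_zeros (rand_poly p a c n) (UNIV - D_set \<epsilon>)) * ln (green t)
      \<le> real (card {y. poly P y = 0 \<and> t * b \<le> \<bar>y\<bar>}) * ln (green t)"
    using g by (intro mult_right_mono) auto
  also have "\<dots> \<le> real d * ln (a n / b) + real n * ln (real n / real d) + ln (real n) + 1
      + (ln pi / 2 + real (d div s + s) * ln 2 + ln (1 + a (d + 1)) + 2 * real s * ln (real d + 1))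
      + ln (real n ^ 3) / 2 - ln (b / 2) / 2 - ln (1 / 2) + real (n - d) * ln (4 * green t * (real n + 1))"
    unfolding P_def
    by (rule card_outer_zeros_le) (use s dn coeff norm b t n in \<open>auto simp: P_def\<close>)
  also have "\<dots> \<le> real n * ln (1 / r) + real n * (sqrt (real n) / (real n - sqrt (real n))) + ln (real n) + 1
      + (ln pi / 2 + (2 * sqrt (real n) + 2) * ln 2 + ln (1 + (real n + 1) * a 1) + 2 * sqrt (real n) * ln (real n + 1))
      + 3 * ln (real n) / 2 - ln (r * a 1 / 2) / 2 - ln (1 / 2) + sqrt (real n) * ln (4 * green t * (real n + 1))"
  proof (intro add_mono diff_mono order_refl)
    have "a n / b = 1 / r" using an by (simp add: b_def)
    then show "real d * ln (a n / b) \<le> real n * ln (1 / r)"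
      using dn r by (auto intro!: mult_right_mono)
    have "ln (real n / real d) \<le> real n / real d - 1" using dn by (intro ln_le_minus_one) auto
    also have "\<dots> = real (n - d) / real d" using dn by (simp add: of_nat_diff field_simps)
    also have "\<dots> \<le> sqrt (real n) / (real n - sqrt (real n))" using nd xn by (intro frac_le) auto
    finally show "real n * ln (real n / real d) \<le> real n * (sqrt (real n) / (real n - sqrt (real n)))"
      by (intro mult_left_mono) auto
    have "real (d div s + s) \<le> real ((s + 2) + s)"
      using div_floor_sqrt_le[OF dn(2)] unfolding s_def by (intro of_nat_mono add_mono) auto
    also have "\<dots> \<le> 2 * sqrt (real n) + 2" using sx by simp
    finally show "real (d div s + s) * ln 2 \<le> (2 * sqrt (real n) + 2) * ln 2" by (intro mult_right_mono) auto
    have "a (d + 1) \<le> (real d + 1) * a 1" using a_ratio[of 1 "d + 1"] by (simp add: algebra_simps)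
    also have "\<dots> \<le> (real n + 1) * a 1" using dn an by (intro mult_right_mono) auto
    finally show "ln (1 + a (d + 1)) \<le> ln (1 + (real n + 1) * a 1)"
      using a_pos[of "d + 1"] by (intro ln_mono) auto
    show "2 * real s * ln (real d + 1) \<le> 2 * sqrt (real n) * ln (real n + 1)"
      using sx dn by (intro mult_mono ln_mono) auto
    show "ln (real n ^ 3) / 2 \<le> 3 * ln (real n) / 2" using n by (simp add: ln_realpow)
    show "ln (r * a 1 / 2) / 2 \<le> ln (b / 2) / 2"
      using an r by (intro divide_right_mono ln_mono) (auto simp: b_def)
    have "1 * 1 \<le> (4 * green t) * (real n + 1)" using g by (intro mult_mono) auto
    then show "real (n - d) * ln (4 * green t * (real n + 1)) \<le> sqrt (real n) * ln (4 * green t * (real n + 1))"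
      using nd by (intro mult_right_mono ln_ge_zero) auto
  qed
  also have "\<dots> = real n * ln (1 / r) + zero_count_error (a 1) r (green t) (real n)"
    by (simp add: zero_count_error_def ln_div)
  finally show ?thesis unfolding r_def .
qed

lemma limsup_expected_outer_zeros_le:
  fixes \<xi> :: "nat \<Rightarrow> 'w \<Rightarrow> real"
  assumes "prob_space M" and indep: "prob_space.indep_vars M (\<lambda>_. borel) \<xi> UNIV"
    and int: "\<And>k. integrable M (\<lambda>\<omega>. (\<xi> k \<omega>)\<^sup>2)" "\<And>k. prob_space.expectation M (\<lambda>\<omega>. (\<xi> k \<omega>)\<^sup>2) = 1"
    and q: "0 \<le> q" "q < 1"
    and small: "\<And>k y. prob_space.prob M {\<omega> \<in> space M. \<bar>\<xi> k \<omega> - y\<bar> < 1 / 2} \<le> q"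
    and eps: "0 < \<epsilon>" "\<epsilon> < 1 / 4"
  shows "limsup (expected_outer_zeros M p a \<xi> \<epsilon>)
    \<le> ennreal (ln (1 / (1 - 2 * \<epsilon>)) / ln (green ((1 - \<epsilon>) / (1 - 2 * \<epsilon>))))"
proof -
  interpret M: prob_space M by fact
  have meas [measurable]: "\<xi> k \<in> borel_measurable M" for k
    using indep by (simp add: M.indep_vars_def)
  define t where "t = (1 - \<epsilon>) / (1 - 2 * \<epsilon>)"
  define l where "l = ln (green t)"
  define L where "L = ln (1 / (1 - 2 * \<epsilon>))"
  have "1 < t" using eps by (simp add: t_def field_simps)
  then have "1 < green t" using abs_le_green[of t] by simp
  then have l: "l > 0" by (simp add: l_def)
  have L: "L \<ge> 0" unfolding L_def using eps by (intro ln_ge_zero) (simp add: field_simps)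
  define V where "V n = (real n * L + zero_count_error (a 1) (1 - 2 * \<epsilon>) (green t) (real n)) / l" for n :: nat
  define U where "U n = max 0 (V n / real n) + (q ^ floor_sqrt n + (real n + 1) / real n ^ 3)" for n :: nat
  define w where "w d j = coeff (p j) d / \<gamma> d" for d j
  have "expected_outer_zeros M p a \<xi> \<epsilon> n \<le> ennreal (U n)" if n: "n \<ge> 2" for n
  proof -
    \<comment> \<open>No coefficient with index in the top window reaches half of its
      \<open>\<gamma> d\<close>; this has probability at most q ^ floor_sqrt n.\<close>
    define bad1 where "bad1 = {\<omega> \<in> space M. \<forall>d\<in>{n - floor_sqrt n<..n}. \<bar>\<xi> d \<omega> + (\<Sum>j\<in>{d<..n}. w d j * \<xi> j \<omega>)\<bar> < 1 / 2}"
    \<comment> \<open>The norm enters the count through its logarithm, so any exponent above 1 would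
      do in place of 3; Markov's inequality then gives probability o(1).\<close>
    define bad2 where "bad2 = {\<omega> \<in> space M. real n ^ 3 \<le> (\<Sum>j\<le>n. (\<xi> j \<omega>)\<^sup>2)}"
    have [measurable]: "bad1 \<in> sets M" unfolding bad1_def by measurable
    have [measurable]: "bad2 \<in> sets M" unfolding bad2_def by measurable
    have "M.prob bad1 \<le> q ^ floor_sqrt n"
      unfolding bad1_def
      by (rule M.sequential_small_ball[OF indep small q(1)]) (rule floor_sqrt_le)
    moreover have "M.prob bad2 \<le> (real n + 1) / real n ^ 3"
    proof -
      have "M.prob bad2 \<le> M.expectation (\<lambda>\<omega>. \<Sum>j\<le>n. (\<xi> j \<omega>)\<^sup>2) / real n ^ 3"
        unfolding bad2_def using n int
        by (intro integral_Markov_inequality_measure[where A = "{}"]) (auto intro!: sum_nonneg)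
      also have "M.expectation (\<lambda>\<omega>. \<Sum>j\<le>n. (\<xi> j \<omega>)\<^sup>2) = real n + 1"
        using int by (simp add: Bochner_Integration.integral_sum)
      finally show ?thesis .
    qed
    ultimately have bad: "M.prob (bad1 \<union> bad2) \<le> q ^ floor_sqrt n + (real n + 1) / real n ^ 3"
      using measure_Un_le[of bad1 M bad2] by simp
    have pointwise: "ennreal (real (N_zeros (rand_poly p a (\<lambda>j. \<xi> j \<omega>) n) (UNIV - D_set \<epsilon>)))
        \<le> ennreal (V n) + ennreal (real n) * indicator (bad1 \<union> bad2) \<omega>" if \<omega>: "\<omega> \<in> space M" for \<omega>
    proof (cases "\<omega> \<in> bad1 \<union> bad2")
      \<comment> \<open>The trivial bound n is affordable here, as the bad events have probability
        o(1).\<close>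
      case True
      have "real (N_zeros (rand_poly p a (\<lambda>j. \<xi> j \<omega>) n) (UNIV - D_set \<epsilon>)) \<le> real n"
        using N_zeros_le_degree[of n] n by simp
      then have "ennreal (real (N_zeros (rand_poly p a (\<lambda>j. \<xi> j \<omega>) n) (UNIV - D_set \<epsilon>))) \<le> ennreal (real n)"
        by (rule ennreal_leI)
      then show ?thesis using True by (simp add: add_increasing)
    next
      case False
      then obtain d where d: "d \<in> {n - floor_sqrt n<..n}" "1 / 2 \<le> \<bar>\<xi> d \<omega> + (\<Sum>j\<in>{d<..n}. w d j * \<xi> j \<omega>)\<bar>"
        using \<omega> by (auto simp: bad1_def not_less)
      have "(\<Sum>j\<le>n. (\<xi> j \<omega>)\<^sup>2) \<le> real n ^ 3" using False \<omega> by (auto simp: bad2_def)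
      from N_zeros_outer_le[OF n d(1) d(2)[unfolded w_def] this eps]
      have "real (N_zeros (rand_poly p a (\<lambda>j. \<xi> j \<omega>) n) (UNIV - D_set \<epsilon>)) \<le> V n"
        using l by (simp add: V_def L_def l_def t_def field_simps)
      then show ?thesis using False by (simp add: ennreal_leI)
    qed
    have "(\<integral>\<^sup>+ \<omega>. ennreal (real (N_zeros (rand_poly p a (\<lambda>j. \<xi> j \<omega>) n) (UNIV - D_set \<epsilon>))) \<partial>M)
      \<le> (\<integral>\<^sup>+ \<omega>. ennreal (V n) + ennreal (real n) * indicator (bad1 \<union> bad2) \<omega> \<partial>M)"
      by (intro nn_integral_mono pointwise)
    also have "\<dots> = ennreal (V n) + ennreal (real n) * emeasure M (bad1 \<union> bad2)"
      by (simp add: nn_integral_add nn_integral_cmult_indicator M.emeasure_space_1)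
    also have "\<dots> \<le> ennreal (real n * max 0 (V n / real n)) + ennreal (real n * (q ^ floor_sqrt n + (real n + 1) / real n ^ 3))"
    proof (intro add_mono)
      show "ennreal (V n) \<le> ennreal (real n * max 0 (V n / real n))"
        using n by (intro ennreal_leI) (auto simp: max_def field_simps)
      show "ennreal (real n) * emeasure M (bad1 \<union> bad2) \<le> ennreal (real n * (q ^ floor_sqrt n + (real n + 1) / real n ^ 3))"
        using bad by (simp add: M.emeasure_eq_measure ennreal_mult'[symmetric] ennreal_leI mult_left_mono)
    qed
    also have "\<dots> = ennreal (real n * U n)"
      using q by (subst ennreal_plus[symmetric]) (auto simp: U_def distrib_left)
    finally have "expected_outer_zeros M p a \<xi> \<epsilon> n \<le> ennreal (real n * U n) / of_nat n"
      unfolding expected_outer_zeros_def by (rule divide_right_mono_ennreal)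
    also have "\<dots> = ennreal (U n)"
      using n q by (simp add: ennreal_of_nat_eq_real_of_nat U_def divide_ennreal)
    finally show ?thesis .
  qed
  then have "limsup (expected_outer_zeros M p a \<xi> \<epsilon>) \<le> limsup (\<lambda>n. ennreal (U n))"
    by (intro Limsup_mono) (auto intro: eventually_sequentiallyI[of 2])
  also have "U \<longlonglongrightarrow> max 0 (L / l) + (0 + 0)"
    unfolding U_def
  proof (intro tendsto_add tendsto_max tendsto_const)
    show "(\<lambda>n. V n / real n) \<longlonglongrightarrow> L / l"
      unfolding V_def using a_pos[of 1] green_pos[of t] l by (intro zero_count_error_limit) auto
    show "(\<lambda>n. q ^ floor_sqrt n) \<longlonglongrightarrow> 0"
      by (rule filterlim_compose[OF LIMSEQ_power_zero filterlim_floor_sqrt]) (use q in simp)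
    show "(\<lambda>n. (real n + 1) / real n ^ 3) \<longlonglongrightarrow> 0" by real_asymp
  qed
  then have "(\<lambda>n. ennreal (U n)) \<longlonglongrightarrow> ennreal (L / l)"
    using L l by (intro tendsto_ennrealI) (simp add: max_def)
  then have "limsup (\<lambda>n. ennreal (U n)) = ennreal (L / l)"
    by (intro lim_imp_Limsup) auto
  finally show ?thesis by (simp add: L_def l_def t_def)
qed

text \<open>In \<open>limsup_expected_outer_zeros_le\<close> the numerator is of order 2 epsilon and
  the denominator of order sqrt (2 epsilon). The moments enter through
  \<open>uniform_anticoncentration\<close>, which supplies one q < 1 for all indices.\<close>

lemma tendsto_limsup_expected_outer_zeros:
  fixes \<xi> :: "nat \<Rightarrow> 'w \<Rightarrow> real"
  assumes M: "prob_space M" and indep: "prob_space.indep_vars M (\<lambda>_. borel) \<xi> UNIV"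
    and int: "\<And>k. integrable M (\<xi> k)" "\<And>k. integrable M (\<lambda>\<omega>. (\<xi> k \<omega>)\<^sup>2)"
    and mean: "\<And>k. prob_space.expectation M (\<xi> k) = 0"
    and var: "\<And>k. prob_space.expectation M (\<lambda>\<omega>. (\<xi> k \<omega>)\<^sup>2) = 1"
    and e: "e > 0"
    and moment: "\<And>k. integrable M (\<lambda>\<omega>. \<bar>\<xi> k \<omega>\<bar> powr (2 + e))"
      "\<And>k. prob_space.expectation M (\<lambda>\<omega>. \<bar>\<xi> k \<omega>\<bar> powr (2 + e)) \<le> B"
  shows "((\<lambda>\<epsilon>. limsup (expected_outer_zeros M p a \<xi> \<epsilon>)) \<longlongrightarrow> 0) (at_right 0)"
proof -
  interpret M: prob_space M by fact
  have meas: "\<xi> k \<in> borel_measurable M" for k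
    using indep by (simp add: M.indep_vars_def)
  obtain q where q: "0 \<le> q" "q < 1" and small: "\<And>k y. M.prob {\<omega> \<in> space M. \<bar>\<xi> k \<omega> - y\<bar> < 1 / 2} \<le> q"
  proof (rule M.uniform_anticoncentration[OF e, where B = B])
    fix q assume "0 \<le> q" "q < 1" and *: "\<And>X y. X \<in> borel_measurable M \<Longrightarrow> integrable M X \<Longrightarrow> integrable M (\<lambda>\<omega>. (X \<omega>)\<^sup>2) \<Longrightarrow>
      M.expectation X = 0 \<Longrightarrow> M.expectation (\<lambda>\<omega>. (X \<omega>)\<^sup>2) = 1 \<Longrightarrow>
      integrable M (\<lambda>\<omega>. \<bar>X \<omega>\<bar> powr (2 + e)) \<Longrightarrow> M.expectation (\<lambda>\<omega>. \<bar>X \<omega>\<bar> powr (2 + e)) \<le> B \<Longrightarrow>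
      M.prob {\<omega> \<in> space M. \<bar>X \<omega> - y\<bar> < 1 / 2} \<le> q"
    have "M.prob {\<omega> \<in> space M. \<bar>\<xi> k \<omega> - y\<bar> < 1 / 2} \<le> q" for k y
      by (rule *[OF meas int mean var moment])
    then show thesis by (rule that[OF \<open>0 \<le> q\<close> \<open>q < 1\<close>])
  qed
  define f where "f \<epsilon> = ln (1 / (1 - 2 * \<epsilon>)) / ln (green ((1 - \<epsilon>) / (1 - 2 * \<epsilon>)))" for \<epsilon>
  have small_eps: "eventually (\<lambda>\<epsilon>::real. \<epsilon> \<in> {0<..<1/4}) (at_right 0)"
    by (rule eventually_at_right_real) simp
  have "(f \<longlongrightarrow> 0) (at_right 0)"
  proof (rule tendsto_cong[THEN iffD1])
    show "((\<lambda>\<epsilon>::real. ln (1 / (1 - 2 * \<epsilon>)) / ln ((1 - \<epsilon>) / (1 - 2 * \<epsilon>) + sqrt (((1 - \<epsilon>) / (1 - 2 * \<epsilon>))\<^sup>2 - 1))) \<longlongrightarrow> 0) (at_right 0)"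
      by real_asymp
    show "eventually (\<lambda>\<epsilon>. ln (1 / (1 - 2 * \<epsilon>)) / ln ((1 - \<epsilon>) / (1 - 2 * \<epsilon>) + sqrt (((1 - \<epsilon>) / (1 - 2 * \<epsilon>))\<^sup>2 - 1)) = f \<epsilon>) (at_right 0)"
      using small_eps
    proof eventually_elim
      case (elim \<epsilon>)
      then have "1 < (1 - \<epsilon>) / (1 - 2 * \<epsilon>)" by (simp add: field_simps)
      then show ?case unfolding f_def by (subst green_eq) auto
    qed
  qed
  then have "((\<lambda>\<epsilon>. ennreal (f \<epsilon>)) \<longlongrightarrow> ennreal 0) (at_right 0)" by (rule tendsto_ennrealI)
  then have lim: "((\<lambda>\<epsilon>. ennreal (f \<epsilon>)) \<longlongrightarrow> 0) (at_right 0)" by simp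
  have le: "eventually (\<lambda>\<epsilon>. limsup (expected_outer_zeros M p a \<xi> \<epsilon>) \<le> ennreal (f \<epsilon>)) (at_right 0)"
    using small_eps
  proof eventually_elim
    case (elim \<epsilon>)
    then show ?case
      unfolding f_def by (intro limsup_expected_outer_zeros_le[OF M indep int(2) var q small]) auto
  qed
  have "eventually (\<lambda>\<epsilon>. 0 \<le> limsup (expected_outer_zeros M p a \<xi> \<epsilon>)) (at_right 0)" by simp
  from tendsto_sandwich[OF this le tendsto_const lim] show ?thesis .
qed

end

section \<open>The weight class, and both kinds of coefficients\<close>

lemma external_field_F_C2:
  assumes "F_C2 Q" "\<forall>x. Q (- x) = Q x" "\<forall>n\<ge>1. MRS_number Q n (a n)"
  shows "external_field Q a"
  using assms unfolding F_C2_def external_field_def by auto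

theorem theorem2p4:
  fixes Q :: "real \<Rightarrow> real" and p :: "nat \<Rightarrow> real poly" and a :: "nat \<Rightarrow> real"
    and \<alpha> \<epsilon>0 :: real
    and M :: "'w measure" and \<xi> :: "nat \<Rightarrow> 'w \<Rightarrow> real"
    and M' :: "'v measure" and \<xi>' :: "nat \<Rightarrow> 'v \<Rightarrow> real"
  assumes FC2: "F_C2 Q"
    and even: "\<forall>x. Q (- x) = Q x"
    and T_lim: "(T_fun Q \<longlongrightarrow> \<alpha>) at_top" and alpha: "1 < \<alpha>"
    and orth: "orthonormal_polys Q p"
    and MRS: "\<forall>n\<ge>1. MRS_number Q n (a n)"
    and M: "prob_space M"
    and indep: "prob_space.indep_vars M (\<lambda>_. borel) \<xi> UNIV"
    and meas: "\<forall>k. \<xi> k \<in> borel_measurable M"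
    and integr: "\<forall>k. integrable M (\<xi> k) \<and> integrable M (\<lambda>\<omega>. (\<xi> k \<omega>)\<^sup>2)"
    and mean0: "\<forall>k. prob_space.expectation M (\<xi> k) = 0"
    and var1: "\<forall>k. prob_space.variance M (\<xi> k) = 1"
    and eps0: "\<epsilon>0 > 0"
    and moment: "\<exists>B. \<forall>k. integrable M (\<lambda>\<omega>. \<bar>\<xi> k \<omega>\<bar> powr (2 + \<epsilon>0)) \<and>
                          prob_space.expectation M (\<lambda>\<omega>. \<bar>\<xi> k \<omega>\<bar> powr (2 + \<epsilon>0)) \<le> B"
    and M': "prob_space M'"
    and indep': "prob_space.indep_vars M' (\<lambda>_. borel) \<xi>' UNIV"
    and gauss: "\<forall>k. distributed M' lborel (\<xi>' k) std_normal_density"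
  shows "((\<lambda>\<epsilon>. limsup (expected_outer_zeros M p a \<xi> \<epsilon>)) \<longlongrightarrow> 0) (at_right 0)
       \<and> ((\<lambda>\<epsilon>. limsup (expected_outer_zeros M' p a \<xi>' \<epsilon>)) \<longlongrightarrow> 0) (at_right 0)"
proof
  interpret external_field Q a by (rule external_field_F_C2[OF FC2 even MRS])
  interpret orthonormal_system Q a p by unfold_locales (rule orth)
  obtain B where B: "\<And>k. integrable M (\<lambda>\<omega>. \<bar>\<xi> k \<omega>\<bar> powr (2 + \<epsilon>0))"
      "\<And>k. prob_space.expectation M (\<lambda>\<omega>. \<bar>\<xi> k \<omega>\<bar> powr (2 + \<epsilon>0)) \<le> B"
    using moment by blast
  show "((\<lambda>\<epsilon>. limsup (expected_outer_zeros M p a \<xi> \<epsilon>)) \<longlongrightarrow> 0) (at_right 0)"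
    by (rule tendsto_limsup_expected_outer_zeros[OF M indep _ _ _ _ eps0 B])
       (use integr mean0 var1 in auto)
  interpret M': prob_space M' by (rule M')
  have D: "distributed M' lborel (\<xi>' k) std_normal_density" for k using gauss by blast
  have moments: "integrable M' (\<lambda>\<omega>. \<xi>' k \<omega> ^ j)" for k j
    using distributed_integrable[OF D, of "\<lambda>x. x ^ j" k] integrable_std_normal_moment[of j] by simp
  have mean: "M'.expectation (\<xi>' k) = 0" for k
    by (rule M'.standard_normal_distributed_expectation[OF D])
  have var: "M'.expectation (\<lambda>\<omega>. (\<xi>' k \<omega>)\<^sup>2) = 1" for k
    using M'.standard_normal_distributed_variance[OF D[of k]] mean[of k] by simp
  \<comment> \<open>The moment bound is applied with exponent 2 + 2: the fourth moment is the same
    for all k.\<close>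
  have fourth: "M'.expectation (\<lambda>\<omega>. \<xi>' k \<omega> ^ 4) = integral\<^sup>L lborel (\<lambda>x. std_normal_density x * x ^ 4)" for k
    by (rule distributed_integral[OF D, symmetric]) auto
  have powr4: "\<bar>x\<bar> powr (2 + 2) = x ^ 4" for x :: real
    using powr_numeral[of "\<bar>x\<bar>" "num.Bit0 (num.Bit0 num.One)"] by (cases "x = 0") (simp_all add: power_even_abs_numeral)
  show "((\<lambda>\<epsilon>. limsup (expected_outer_zeros M' p a \<xi>' \<epsilon>)) \<longlongrightarrow> 0) (at_right 0)"
    by (rule tendsto_limsup_expected_outer_zeros[OF M' indep' _ moments mean var, of 2 "integral\<^sup>L lborel (\<lambda>x. std_normal_density x * x ^ 4)"])
       (use moments[of _ 1] moments[of _ 4] fourth in \<open>simp_all add: powr4\<close>)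
qed

end
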